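(* Let $H$ be a pointed Hopf algebra over a field $\Bbbk$ and let $A$ be a right $H$-simple left $H$-comodule algebra. Then the map $$G(H)/F(A)\longrightarrow \mathrm{Simp}({}^H\mathfrak{M}_A),\qquad [g]\longmapsto {}^{[g]}\!A,$$ is a well-defined one-to-one correspondence (bijection), where $\mathrm{Simp}({}^H\mathfrak{M}_A)$ denotes the isomorphism classes of simple objects in ${}^H\mathfrak{M}_A$.
   Context: Everything is over a field $\Bbbk$. A Hopf algebra is pointed if each of its simple subcoalgebras is one-dimensional. $G(H)=\{g\in H\mid\Delta(g)=g\otimes g,\ \varepsilon(g)=1\}$ is the group of group-like elements. A left $H$-comodule algebra is an algebra $A$ that is a left $H$-comodule whose coaction $\rho\colon A\to H\otimes A$, $a\mapsto a_{(-1)}\otimes a_{(0)}$, is an algebra map. $A$ is right $H$-simple if $A\neq0$ and its only right ideals that are $H$-subcomodules are $0$ and $A$. ${}^H\mathfrak{M}_A$ is the category of left $H$-comodules $M$ that are also right $A$-modules with $\rho_M(ma)=m_{(-1)}a_{(-1)}\otimes m_{(0)}a_{(0)}$; morphisms are the $H$-comodule maps that are $A$-module maps. For $g\in G(H)$, ${}^{[g]}\!A\in{}^H\mathfrak{M}_A$ is $A$ as a right $A$-module, with the coaction $a\mapsto g a_{(-1)}\otimes a_{(0)}$. Put $A_g=\{a\in A\mid\rho(a)=g\otimes a\}$ and $F(A)=\{g\in G(H)\mid A_g\neq0\}$, which is a subgroup of $G(H)$ when $A$ is right $H$-simple; $G(H)/F(A)$ is the set of left cosets $gF(A)$. *)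

theory Defs
  imports
    "HOL-Algebra.Module" "HOL-Algebra.AbelCoset" "HOL-Algebra.Generated_Groups"
    "HOL-Algebra.Left_Coset"
begin

section \<open>Linear maps\<close>

definition linear_maps ::
  "('k, 'r) ring_scheme \<Rightarrow> ('k, 'm, 'y) module_scheme \<Rightarrow> ('k, 'n, 'z) module_scheme \<Rightarrow> ('m \<Rightarrow> 'n) set"
  where "linear_maps K M N =
    {f \<in> hom (add_monoid M) (add_monoid N).
      \<forall>c\<in>carrier K. \<forall>x\<in>carrier M. f (c \<odot>\<^bsub>M\<^esub> x) = c \<odot>\<^bsub>N\<^esub> f x}"

definition ground_module :: "('k, 'r) ring_scheme \<Rightarrow> ('k, 'k) module"
  where "ground_module K =
    \<lparr>carrier = carrier K, monoid.mult = monoid.mult K, one = one K, zero = zero K, add = add K, smult = monoid.mult K\<rparr>"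

section \<open>Tensor products over the ground field\<close>

text \<open>
  The tensor product of M and N is the free module on the set of pairs \<open>(x, y)\<close> of elements,
  realised as finitely supported functions, modulo the bilinearity relations; its elements are
  cosets. The fields \<open>mult\<close> and \<open>one\<close> that the library's module records inherit
  from rings carry no meaning where they are set to \<open>undefined\<close>.
\<close>

definition free_module :: "('k, 'r) ring_scheme \<Rightarrow> 's set \<Rightarrow> ('k, 's \<Rightarrow> 'k) module"
  where "free_module K S =
    \<lparr>carrier = {\<phi>. range \<phi> \<subseteq> carrier K \<and> finite {s. \<phi> s \<noteq> \<zero>\<^bsub>K\<^esub>} \<and> {s. \<phi> s \<noteq> \<zero>\<^bsub>K\<^esub>} \<subseteq> S},
     monoid.mult = undefined, one = undefined,
     zero = (\<lambda>s. \<zero>\<^bsub>K\<^esub>), add = (\<lambda>\<phi> \<psi> s. \<phi> s \<oplus>\<^bsub>K\<^esub> \<psi> s),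
     smult = (\<lambda>c \<phi> s. c \<otimes>\<^bsub>K\<^esub> \<phi> s)\<rparr>"

definition free_gen :: "('k, 'r) ring_scheme \<Rightarrow> 's \<Rightarrow> 's \<Rightarrow> 'k"
  where "free_gen K s = (\<lambda>t. if t = s then \<one>\<^bsub>K\<^esub> else \<zero>\<^bsub>K\<^esub>)"

definition quot_module :: "('k, 'm, 'z) module_scheme \<Rightarrow> 'm set \<Rightarrow> ('k, 'm set) module"
  where "quot_module V N =
    \<lparr>carrier = a_rcosets\<^bsub>V\<^esub> N, monoid.mult = undefined, one = undefined,
     zero = N, add = set_add V, smult = (\<lambda>c X. \<Union>x\<in>X. N +>\<^bsub>V\<^esub> (c \<odot>\<^bsub>V\<^esub> x))\<rparr>"

type_synonym ('k, 'm, 'n) tensor = "('m \<times> 'n \<Rightarrow> 'k) set"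

definition tensor_relations ::
  "('k, 'r) ring_scheme \<Rightarrow> ('k, 'm, 'y) module_scheme \<Rightarrow> ('k, 'n, 'z) module_scheme
    \<Rightarrow> ('m \<times> 'n \<Rightarrow> 'k) set"
  where "tensor_relations K M N =
    (let V = free_module K (carrier M \<times> carrier N); e = free_gen K in
      {e (x \<oplus>\<^bsub>M\<^esub> x', y) \<ominus>\<^bsub>V\<^esub> (e (x, y) \<oplus>\<^bsub>V\<^esub> e (x', y)) |x x' y.
         x \<in> carrier M \<and> x' \<in> carrier M \<and> y \<in> carrier N} \<union>
      {e (x, y \<oplus>\<^bsub>N\<^esub> y') \<ominus>\<^bsub>V\<^esub> (e (x, y) \<oplus>\<^bsub>V\<^esub> e (x, y')) |x y y'.
         x \<in> carrier M \<and> y \<in> carrier N \<and> y' \<in> carrier N} \<union>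
      {e (c \<odot>\<^bsub>M\<^esub> x, y) \<ominus>\<^bsub>V\<^esub> (c \<odot>\<^bsub>V\<^esub> e (x, y)) |c x y.
         c \<in> carrier K \<and> x \<in> carrier M \<and> y \<in> carrier N} \<union>
      {e (x, c \<odot>\<^bsub>N\<^esub> y) \<ominus>\<^bsub>V\<^esub> (c \<odot>\<^bsub>V\<^esub> e (x, y)) |c x y.
         c \<in> carrier K \<and> x \<in> carrier M \<and> y \<in> carrier N})"

definition tensor_null ::
  "('k, 'r) ring_scheme \<Rightarrow> ('k, 'm, 'y) module_scheme \<Rightarrow> ('k, 'n, 'z) module_scheme
    \<Rightarrow> ('m \<times> 'n \<Rightarrow> 'k) set"
  where "tensor_null K M N =
    \<Inter>{W. submodule W K (free_module K (carrier M \<times> carrier N)) \<and> tensor_relations K M N \<subseteq> W}"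

definition tensor_product ::
  "('k, 'r) ring_scheme \<Rightarrow> ('k, 'm, 'y) module_scheme \<Rightarrow> ('k, 'n, 'z) module_scheme
    \<Rightarrow> ('k, ('k, 'm, 'n) tensor) module"
  where "tensor_product K M N =
    quot_module (free_module K (carrier M \<times> carrier N)) (tensor_null K M N)"

definition pure_tensor ::
  "('k, 'r) ring_scheme \<Rightarrow> ('k, 'm, 'y) module_scheme \<Rightarrow> ('k, 'n, 'z) module_scheme
    \<Rightarrow> 'm \<Rightarrow> 'n \<Rightarrow> ('k, 'm, 'n) tensor"
  where "pure_tensor K M N x y =
    tensor_null K M N +>\<^bsub>free_module K (carrier M \<times> carrier N)\<^esub> free_gen K (x, y)"

text \<open>
  The linear map from the tensor product of M and N to P induced by a bilinear map \<open>f\<close>; the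
  value does not depend on the representative of the coset \<open>t\<close> when \<open>f\<close> is bilinear.
\<close>

definition tensor_lift ::
  "('k, 'r) ring_scheme \<Rightarrow> ('k, 'p, 'z) module_scheme \<Rightarrow> ('m \<Rightarrow> 'n \<Rightarrow> 'p)
    \<Rightarrow> ('k, 'm, 'n) tensor \<Rightarrow> 'p"
  where "tensor_lift K P f t =
    the_elem ((\<lambda>\<phi>. \<Oplus>\<^bsub>P\<^esub>s\<in>{s. \<phi> s \<noteq> \<zero>\<^bsub>K\<^esub>}. \<phi> s \<odot>\<^bsub>P\<^esub> f (fst s) (snd s)) ` t)"

definition tensor_map ::
  "('k, 'r) ring_scheme \<Rightarrow> ('k, 'p, 'y) module_scheme \<Rightarrow> ('k, 'q, 'z) module_scheme
    \<Rightarrow> ('m \<Rightarrow> 'p) \<Rightarrow> ('n \<Rightarrow> 'q) \<Rightarrow> ('k, 'm, 'n) tensor \<Rightarrow> ('k, 'p, 'q) tensor"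
  where "tensor_map K P Q f g =
    tensor_lift K (tensor_product K P Q) (\<lambda>x y. pure_tensor K P Q (f x) (g y))"

definition tensor_assoc ::
  "('k, 'r) ring_scheme \<Rightarrow> ('k, 'l, 'x) module_scheme \<Rightarrow> ('k, 'm, 'y) module_scheme
    \<Rightarrow> ('k, 'n, 'z) module_scheme
    \<Rightarrow> ('k, ('k, 'l, 'm) tensor, 'n) tensor \<Rightarrow> ('k, 'l, ('k, 'm, 'n) tensor) tensor"
  where "tensor_assoc K L M N =
    (let MN = tensor_product K M N; T = tensor_product K L MN in
      tensor_lift K T (\<lambda>t z.
        tensor_lift K T (\<lambda>x y. pure_tensor K L MN x (pure_tensor K M N y z)) t))"

text \<open>
  For bilinear \<open>p\<close> and \<open>q\<close>, the bilinear operation on tensors sending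
  \<open>x \<otimes> x'\<close> and \<open>y \<otimes> y'\<close> to \<open>p x y \<otimes> q x' y'\<close>.
\<close>

definition tensor_pairing ::
  "('k, 'r) ring_scheme \<Rightarrow> ('k, 'p, 'y) module_scheme \<Rightarrow> ('k, 'q, 'z) module_scheme
    \<Rightarrow> ('a \<Rightarrow> 'b \<Rightarrow> 'p) \<Rightarrow> ('c \<Rightarrow> 'd \<Rightarrow> 'q)
    \<Rightarrow> ('k, 'a, 'c) tensor \<Rightarrow> ('k, 'b, 'd) tensor \<Rightarrow> ('k, 'p, 'q) tensor"
  where "tensor_pairing K P Q p q t u =
    (let T = tensor_product K P Q in
      tensor_lift K T (\<lambda>x x'.
        tensor_lift K T (\<lambda>y y'. pure_tensor K P Q (p x y) (q x' y')) u) t)"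

definition tensor_algebra ::
  "('k, 'r) ring_scheme \<Rightarrow> ('k, 'm, 'y) module_scheme \<Rightarrow> ('k, 'n, 'z) module_scheme
    \<Rightarrow> ('k, ('k, 'm, 'n) tensor) module"
  where "tensor_algebra K A B =
    (tensor_product K A B)
      \<lparr>monoid.mult := tensor_pairing K A B (monoid.mult A) (monoid.mult B),
       one := pure_tensor K A B \<one>\<^bsub>A\<^esub> \<one>\<^bsub>B\<^esub>\<rparr>"

text \<open>For subspaces X of M and Y of N: the image of their tensor product in that of M and N.\<close>

definition tensor_sub ::
  "('k, 'r) ring_scheme \<Rightarrow> ('k, 'm, 'y) module_scheme \<Rightarrow> ('k, 'n, 'z) module_scheme
    \<Rightarrow> 'm set \<Rightarrow> 'n set \<Rightarrow> ('k, 'm, 'n) tensor set"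
  where "tensor_sub K M N X Y =
    generate (add_monoid (tensor_product K M N)) {pure_tensor K M N x y |x y. x \<in> X \<and> y \<in> Y}"

section \<open>Hopf algebras\<close>

text \<open>The library's locale \<open>algebra\<close> is restricted to commutative algebras.\<close>

locale unital_algebra = field K + module K A + A?: ring A
  for K (structure) and A (structure) +
  assumes smult_mult_left:
      "\<lbrakk>c \<in> carrier K; x \<in> carrier A; y \<in> carrier A\<rbrakk> \<Longrightarrow> (c \<odot>\<^bsub>A\<^esub> x) \<otimes>\<^bsub>A\<^esub> y = c \<odot>\<^bsub>A\<^esub> (x \<otimes>\<^bsub>A\<^esub> y)"
    and smult_mult_right:
      "\<lbrakk>c \<in> carrier K; x \<in> carrier A; y \<in> carrier A\<rbrakk> \<Longrightarrow> x \<otimes>\<^bsub>A\<^esub> (c \<odot>\<^bsub>A\<^esub> y) = c \<odot>\<^bsub>A\<^esub> (x \<otimes>\<^bsub>A\<^esub> y)"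

record ('k, 'h) coalgebra = "('k, 'h) module" +
  comult :: "'h \<Rightarrow> ('k, 'h, 'h) tensor"
  counit :: "'h \<Rightarrow> 'k"

record ('k, 'h) hopf_algebra = "('k, 'h) coalgebra" +
  antipode :: "'h \<Rightarrow> 'h"

locale coalgebra = field K + module K C
  for K (structure) and C :: "('k, 'h, 'z) coalgebra_scheme" (structure) +
  assumes comult_linear: "comult C \<in> linear_maps K C (tensor_product K C C)"
    and counit_linear: "counit C \<in> linear_maps K C (ground_module K)"
    and coassoc: "c \<in> carrier C \<Longrightarrow>
      tensor_assoc K C C C (tensor_map K (tensor_product K C C) C (comult C) (\<lambda>x. x) (comult C c)) =
      tensor_map K C (tensor_product K C C) (\<lambda>x. x) (comult C) (comult C c)"
    and counit_left: "c \<in> carrier C \<Longrightarrow>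
      tensor_lift K C (\<lambda>x y. counit C x \<odot>\<^bsub>C\<^esub> y) (comult C c) = c"
    and counit_right: "c \<in> carrier C \<Longrightarrow>
      tensor_lift K C (\<lambda>x y. counit C y \<odot>\<^bsub>C\<^esub> x) (comult C c) = c"

locale bialgebra = unital_algebra K H + coalgebra K H
  for K (structure) and H :: "('k, 'h, 'z) coalgebra_scheme" (structure) +
  assumes comult_ring_hom: "comult H \<in> ring_hom H (tensor_algebra K H H)"
    and counit_ring_hom: "counit H \<in> ring_hom H K"

locale hopf_algebra = bialgebra K H
  for K (structure) and H :: "('k, 'h, 'z) hopf_algebra_scheme" (structure) +
  assumes antipode_linear: "antipode H \<in> linear_maps K H H"
    and antipode_left: "h \<in> carrier H \<Longrightarrow>
      tensor_lift K H (\<lambda>x y. antipode H x \<otimes>\<^bsub>H\<^esub> y) (comult H h) = counit H h \<odot>\<^bsub>H\<^esub> \<one>\<^bsub>H\<^esub>"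
    and antipode_right: "h \<in> carrier H \<Longrightarrow>
      tensor_lift K H (\<lambda>x y. x \<otimes>\<^bsub>H\<^esub> antipode H y) (comult H h) = counit H h \<odot>\<^bsub>H\<^esub> \<one>\<^bsub>H\<^esub>"

definition subcoalgebra ::
  "('k, 'r) ring_scheme \<Rightarrow> ('k, 'h, 'z) coalgebra_scheme \<Rightarrow> 'h set \<Rightarrow> bool"
  where "subcoalgebra K C D \<longleftrightarrow> submodule D K C \<and> comult C ` D \<subseteq> tensor_sub K C C D D"

definition simple_subcoalgebra ::
  "('k, 'r) ring_scheme \<Rightarrow> ('k, 'h, 'z) coalgebra_scheme \<Rightarrow> 'h set \<Rightarrow> bool"
  where "simple_subcoalgebra K C D \<longleftrightarrow> subcoalgebra K C D \<and> D \<noteq> {\<zero>\<^bsub>C\<^esub>} \<and>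
    (\<forall>E. subcoalgebra K C E \<and> E \<subseteq> D \<longrightarrow> E = {\<zero>\<^bsub>C\<^esub>} \<or> E = D)"

definition one_dimensional ::
  "('k, 'r) ring_scheme \<Rightarrow> ('k, 'm, 'z) module_scheme \<Rightarrow> 'm set \<Rightarrow> bool"
  where "one_dimensional K V D \<longleftrightarrow>
    (\<exists>v\<in>carrier V. v \<noteq> \<zero>\<^bsub>V\<^esub> \<and> D = {c \<odot>\<^bsub>V\<^esub> v |c. c \<in> carrier K})"

locale pointed_hopf_algebra = hopf_algebra K H
  for K (structure) and H :: "('k, 'h, 'z) hopf_algebra_scheme" (structure) +
  assumes pointed: "simple_subcoalgebra K H D \<Longrightarrow> one_dimensional K H D"

definition grouplike_group ::
  "('k, 'r) ring_scheme \<Rightarrow> ('k, 'h, 'z) coalgebra_scheme \<Rightarrow> 'h monoid"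
  where "grouplike_group K H =
    \<lparr>carrier = {g \<in> carrier H. comult H g = pure_tensor K H H g g \<and> counit H g = \<one>\<^bsub>K\<^esub>},
     monoid.mult = monoid.mult H, one = \<one>\<^bsub>H\<^esub>\<rparr>"

section \<open>Comodules and comodule algebras\<close>

record ('k, 'h, 'm) comodule = "('k, 'm) module" +
  coact :: "'m \<Rightarrow> ('k, 'h, 'm) tensor"

locale left_comodule = coalgebra K H + M?: module K M
  for K (structure) and H :: "('k, 'h, 'y) coalgebra_scheme" (structure)
    and M :: "('k, 'h, 'm, 'z) comodule_scheme" (structure) +
  assumes coact_linear: "coact M \<in> linear_maps K M (tensor_product K H M)"
    and coact_coassoc: "m \<in> carrier M \<Longrightarrow>
      tensor_assoc K H H M (tensor_map K (tensor_product K H H) M (comult H) (\<lambda>x. x) (coact M m)) =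
      tensor_map K H (tensor_product K H M) (\<lambda>h. h) (coact M) (coact M m)"
    and coact_counit: "m \<in> carrier M \<Longrightarrow>
      tensor_lift K M (\<lambda>h x. counit H h \<odot>\<^bsub>M\<^esub> x) (coact M m) = m"

definition subcomodule ::
  "('k, 'r) ring_scheme \<Rightarrow> ('k, 'h, 'y) module_scheme \<Rightarrow> ('k, 'h, 'm, 'z) comodule_scheme
    \<Rightarrow> 'm set \<Rightarrow> bool"
  where "subcomodule K H M N \<longleftrightarrow>
    submodule N K M \<and> coact M ` N \<subseteq> tensor_sub K H M (carrier H) N"

locale left_comodule_algebra = H?: bialgebra K H + left_comodule K H A + A?: unital_algebra K A
  for K (structure) and H :: "('k, 'h, 'y) coalgebra_scheme" (structure)
    and A :: "('k, 'h, 'a, 'z) comodule_scheme" (structure) +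
  assumes coact_ring_hom: "coact A \<in> ring_hom A (tensor_algebra K H A)"

definition right_ideal :: "('a, 'z) ring_scheme \<Rightarrow> 'a set \<Rightarrow> bool"
  where "right_ideal A I \<longleftrightarrow>
    additive_subgroup I A \<and> (\<forall>x\<in>I. \<forall>a\<in>carrier A. x \<otimes>\<^bsub>A\<^esub> a \<in> I)"

definition right_H_simple ::
  "('k, 'r) ring_scheme \<Rightarrow> ('k, 'h, 'y) module_scheme \<Rightarrow> ('k, 'h, 'a, 'z) comodule_scheme \<Rightarrow> bool"
  where "right_H_simple K H A \<longleftrightarrow> carrier A \<noteq> {\<zero>\<^bsub>A\<^esub>} \<and>
    (\<forall>I. right_ideal A I \<and> subcomodule K H A I \<longrightarrow> I = {\<zero>\<^bsub>A\<^esub>} \<or> I = carrier A)"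

definition grouplike_component ::
  "('k, 'r) ring_scheme \<Rightarrow> ('k, 'h, 'y) module_scheme \<Rightarrow> ('k, 'h, 'a, 'z) comodule_scheme
    \<Rightarrow> 'h \<Rightarrow> 'a set"
  where "grouplike_component K H A g = {a \<in> carrier A. coact A a = pure_tensor K H A g a}"

definition grouplike_support ::
  "('k, 'r) ring_scheme \<Rightarrow> ('k, 'h, 'y) coalgebra_scheme \<Rightarrow> ('k, 'h, 'a, 'z) comodule_scheme
    \<Rightarrow> 'h set"
  where "grouplike_support K H A =
    {g \<in> carrier (grouplike_group K H). grouplike_component K H A g \<noteq> {\<zero>\<^bsub>A\<^esub>}}"

section \<open>Relative Hopf modules\<close>

text \<open>
  Objects of the category of left H-comodules with compatible right A-action. The type
  \<open>'m\<close> plays the role of a universe: the carrier is an arbitrary subset of it, so that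
  isomorphism classes are sets. Over a field, subobjects are the sub-H-comodules that are stable
  under A, and simple objects are those without proper nonzero subobjects.
\<close>

record ('k, 'h, 'a, 'm) hopf_module = "('k, 'h, 'm) comodule" +
  act :: "'m \<Rightarrow> 'a \<Rightarrow> 'm"

locale hopf_module = A?: left_comodule_algebra K H A + M?: left_comodule K H M
  for K (structure) and H :: "('k, 'h, 'x) coalgebra_scheme" (structure)
    and A :: "('k, 'h, 'a, 'y) comodule_scheme" (structure)
    and M :: "('k, 'h, 'a, 'm, 'z) hopf_module_scheme" (structure) +
  assumes act_closed: "\<lbrakk>m \<in> carrier M; a \<in> carrier A\<rbrakk> \<Longrightarrow> act M m a \<in> carrier M"
    and act_add_left: "\<lbrakk>m \<in> carrier M; n \<in> carrier M; a \<in> carrier A\<rbrakk> \<Longrightarrow>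
      act M (m \<oplus>\<^bsub>M\<^esub> n) a = act M m a \<oplus>\<^bsub>M\<^esub> act M n a"
    and act_add_right: "\<lbrakk>m \<in> carrier M; a \<in> carrier A; b \<in> carrier A\<rbrakk> \<Longrightarrow>
      act M m (a \<oplus>\<^bsub>A\<^esub> b) = act M m a \<oplus>\<^bsub>M\<^esub> act M m b"
    and act_smult_left: "\<lbrakk>c \<in> carrier K; m \<in> carrier M; a \<in> carrier A\<rbrakk> \<Longrightarrow>
      act M (c \<odot>\<^bsub>M\<^esub> m) a = c \<odot>\<^bsub>M\<^esub> act M m a"
    and act_smult_right: "\<lbrakk>c \<in> carrier K; m \<in> carrier M; a \<in> carrier A\<rbrakk> \<Longrightarrow>
      act M m (c \<odot>\<^bsub>A\<^esub> a) = c \<odot>\<^bsub>M\<^esub> act M m a"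
    and act_mult: "\<lbrakk>m \<in> carrier M; a \<in> carrier A; b \<in> carrier A\<rbrakk> \<Longrightarrow>
      act M m (a \<otimes>\<^bsub>A\<^esub> b) = act M (act M m a) b"
    and act_one: "m \<in> carrier M \<Longrightarrow> act M m \<one>\<^bsub>A\<^esub> = m"
    and coact_act: "\<lbrakk>m \<in> carrier M; a \<in> carrier A\<rbrakk> \<Longrightarrow>
      coact M (act M m a) = tensor_pairing K H M (monoid.mult H) (act M) (coact M m) (coact A a)"

definition hopf_module_hom ::
  "('k, 'r) ring_scheme \<Rightarrow> ('k, 'h, 'w) module_scheme \<Rightarrow> ('a, 'x) ring_scheme
    \<Rightarrow> ('k, 'h, 'a, 'm, 'y) hopf_module_scheme \<Rightarrow> ('k, 'h, 'a, 'n, 'z) hopf_module_scheme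
    \<Rightarrow> ('m \<Rightarrow> 'n) set"
  where "hopf_module_hom K H A M N =
    {f \<in> linear_maps K M N.
      (\<forall>m\<in>carrier M. coact N (f m) = tensor_map K H N (\<lambda>h. h) f (coact M m)) \<and>
      (\<forall>m\<in>carrier M. \<forall>a\<in>carrier A. f (act M m a) = act N (f m) a)}"

definition hopf_module_iso ::
  "('k, 'r) ring_scheme \<Rightarrow> ('k, 'h, 'w) module_scheme \<Rightarrow> ('a, 'x) ring_scheme
    \<Rightarrow> ('k, 'h, 'a, 'm, 'y) hopf_module_scheme \<Rightarrow> ('k, 'h, 'a, 'n, 'z) hopf_module_scheme
    \<Rightarrow> bool"
  where "hopf_module_iso K H A M N \<longleftrightarrow>
    (\<exists>f\<in>hopf_module_hom K H A M N. \<exists>g\<in>hopf_module_hom K H A N M.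
      (\<forall>m\<in>carrier M. g (f m) = m) \<and> (\<forall>n\<in>carrier N. f (g n) = n))"

definition hopf_submodule ::
  "('k, 'r) ring_scheme \<Rightarrow> ('k, 'h, 'w) module_scheme \<Rightarrow> ('a, 'x) ring_scheme
    \<Rightarrow> ('k, 'h, 'a, 'm, 'y) hopf_module_scheme \<Rightarrow> 'm set \<Rightarrow> bool"
  where "hopf_submodule K H A M N \<longleftrightarrow>
    subcomodule K H M N \<and> (\<forall>m\<in>N. \<forall>a\<in>carrier A. act M m a \<in> N)"

definition simple_hopf_module ::
  "('k, 'r) ring_scheme \<Rightarrow> ('k, 'h, 'w) coalgebra_scheme \<Rightarrow> ('k, 'h, 'a, 'x) comodule_scheme
    \<Rightarrow> ('k, 'h, 'a, 'm, 'y) hopf_module_scheme \<Rightarrow> bool"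
  where "simple_hopf_module K H A M \<longleftrightarrow>
    hopf_module K H A M \<and> carrier M \<noteq> {\<zero>\<^bsub>M\<^esub>} \<and>
    (\<forall>N. hopf_submodule K H A M N \<longrightarrow> N = {\<zero>\<^bsub>M\<^esub>} \<or> N = carrier M)"

definition iso_class ::
  "('k, 'r) ring_scheme \<Rightarrow> ('k, 'h, 'w) coalgebra_scheme \<Rightarrow> ('k, 'h, 'a, 'x) comodule_scheme
    \<Rightarrow> ('k, 'h, 'a, 'm) hopf_module \<Rightarrow> ('k, 'h, 'a, 'm) hopf_module set"
  where "iso_class K H A M = {N. hopf_module K H A N \<and> hopf_module_iso K H A M N}"

definition Simp ::
  "('k, 'r) ring_scheme \<Rightarrow> ('k, 'h, 'w) coalgebra_scheme \<Rightarrow> ('k, 'h, 'a, 'x) comodule_scheme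
    \<Rightarrow> ('k, 'h, 'a, 'm) hopf_module set set"
  where "Simp K H A = {iso_class K H A M |M. simple_hopf_module K H A M}"

text \<open>The object given by A itself, with coaction \<open>a \<mapsto> g a\<^sub>(\<^sub>-\<^sub>1\<^sub>) \<otimes> a\<^sub>(\<^sub>0\<^sub>)\<close>.\<close>

definition twisted ::
  "('k, 'r) ring_scheme \<Rightarrow> ('k, 'h, 'y) module_scheme \<Rightarrow> ('k, 'h, 'a, 'z) comodule_scheme
    \<Rightarrow> 'h \<Rightarrow> ('k, 'h, 'a, 'a) hopf_module"
  where "twisted K H A g =
    \<lparr>carrier = carrier A, monoid.mult = monoid.mult A, one = one A, zero = zero A, add = add A, smult = smult A,
     coact = (\<lambda>a. tensor_map K H A (\<lambda>h. g \<otimes>\<^bsub>H\<^esub> h) (\<lambda>x. x) (coact A a)),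
     act = monoid.mult A\<rparr>"

end

theory Submission
  imports Defs
begin

text \<open>
  Linear functionals on \<open>H\<close> act on an \<open>H\<close>-comodule \<open>M\<close> by contracting the coaction. Over a field
  functionals separate points, so subcomodules, comodule maps and equations
  \<open>\<rho>(m) = g \<otimes> m\<close> can be read off from this action: the last one says that \<open>m\<close> is an eigenvector,
  \<open>m \<cdot> f = f(g) m\<close>.

  A vector \<open>m \<noteq> 0\<close> in a simple object \<open>M\<close> with \<open>\<rho>(m) = g \<otimes> m\<close> gives the nonzero morphism
  \<open>a \<mapsto> m a\<close> from the twist of \<open>A\<close> by \<open>g\<close> to \<open>M\<close>; both objects being simple, it is an isomorphism.
  Conversely an isomorphism sends \<open>1\<close> to such a vector. Applied to the twist by \<open>h\<close> in place of \<open>M\<close>,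
  this shows that the twists by \<open>g\<close> and \<open>h\<close> are isomorphic iff \<open>h\<^sup>-\<^sup>1 g \<in> F(A)\<close>.

  It remains to find an eigenvector in a nonzero comodule. Take a minimal nonzero subcomodule \<open>N\<close>; it
  is spanned by a finite set \<open>Y\<close>. The elements of \<open>H\<close> killed by the annihilator of \<open>N\<close> form a
  subcoalgebra spanned by finitely many elements, which contains a simple subcoalgebra, hence by
  pointedness a grouplike \<open>g\<close>. Now \<open>P = {f. f(g) = 0}\<close> contains the annihilator of \<open>Y\<close>. Remove
  elements \<open>x\<close> from \<open>Y\<close> until the annihilator \<open>J\<close> of the remaining ones is no longer contained in
  \<open>P\<close>. Then \<open>x (J \<inter> P)\<close> is a proper subcomodule of \<open>N\<close>, so it vanishes, and \<open>x j\<close> is an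
  eigenvector for every \<open>j \<in> J - P\<close>.
\<close>

section \<open>Linear and bilinear maps\<close>

text \<open>Elements of a tensor product are cosets of finitely supported functions and no bases are
  chosen, so tensors have no coordinates. Representations of minimal length take the place of bases:
  their factors are contractions of the tensor, which makes membership in \<open>tensor_sub\<close>
  and equality of tensors testable by functionals. The functionals themselves come from Zorn's
  lemma.

  Finite dimension never appears as a number. It is expressed as containment in the span of a finite
  set, and \<open>finite_span_minimal\<close> turns this into minimal members of families of
  subspaces.

  That minimal comodules over a pointed coalgebra are lines is often derived from simple coalgebras
  being dual to simple algebras. The descent through \<open>Y\<close> replaces that theory:
  evaluation at \<open>g\<close> is a character of the dual algebra, so \<open>P\<close> is an
  ideal, and minimality of \<open>N\<close> does the rest. A single grouplike element in the
  coefficient coalgebra is enough to start it.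

  The isomorphism criterion for twists also shows that F(A) is a subgroup, since F(A) consists of
  the \<open>g\<close> whose twist is isomorphic to the twist by 1.\<close>

lemma linI:
  assumes "\<And>x. x \<in> carrier M \<Longrightarrow> f x \<in> carrier N"
    and "\<And>x y. \<lbrakk>x \<in> carrier M; y \<in> carrier M\<rbrakk> \<Longrightarrow> f (x \<oplus>\<^bsub>M\<^esub> y) = f x \<oplus>\<^bsub>N\<^esub> f y"
    and "\<And>c x. \<lbrakk>c \<in> carrier K; x \<in> carrier M\<rbrakk> \<Longrightarrow> f (c \<odot>\<^bsub>M\<^esub> x) = c \<odot>\<^bsub>N\<^esub> f x"
  shows "f \<in> linear_maps K M N"
  using assms by (auto simp: linear_maps_def hom_def)

lemma lin_closed: "\<lbrakk>f \<in> linear_maps K M N; x \<in> carrier M\<rbrakk> \<Longrightarrow> f x \<in> carrier N"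
  by (auto simp: linear_maps_def hom_def)

lemma lin_add:
  "\<lbrakk>f \<in> linear_maps K M N; x \<in> carrier M; y \<in> carrier M\<rbrakk> \<Longrightarrow> f (x \<oplus>\<^bsub>M\<^esub> y) = f x \<oplus>\<^bsub>N\<^esub> f y"
  by (auto simp: linear_maps_def hom_def)

lemma lin_smult:
  "\<lbrakk>f \<in> linear_maps K M N; c \<in> carrier K; x \<in> carrier M\<rbrakk> \<Longrightarrow> f (c \<odot>\<^bsub>M\<^esub> x) = c \<odot>\<^bsub>N\<^esub> f x"
  by (auto simp: linear_maps_def)

lemma lin_comp:
  "\<lbrakk>f \<in> linear_maps K M N; g \<in> linear_maps K N P\<rbrakk> \<Longrightarrow> (\<lambda>x. g (f x)) \<in> linear_maps K M P"
  by (rule linI) (simp_all add: lin_closed lin_add lin_smult)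

lemma lin_id: "(\<lambda>x. x) \<in> linear_maps K M M"
  by (rule linI) auto

lemma module_abelian_group: "module K M \<Longrightarrow> abelian_group M"
  by (simp add: module_def)

lemma lin_zero:
  assumes "module K M" "module K N" "f \<in> linear_maps K M N"
  shows "f \<zero>\<^bsub>M\<^esub> = \<zero>\<^bsub>N\<^esub>"
proof -
  interpret M: module K M by fact
  interpret N: module K N by fact
  have "f (\<zero>\<^bsub>K\<^esub> \<odot>\<^bsub>M\<^esub> \<zero>\<^bsub>M\<^esub>) = \<zero>\<^bsub>K\<^esub> \<odot>\<^bsub>N\<^esub> f \<zero>\<^bsub>M\<^esub>"
    using assms(3) by (intro lin_smult) auto
  then show ?thesis using lin_closed[OF assms(3)] by simp
qed

lemma lin_uminus:
  assumes "module K M" "module K N" "f \<in> linear_maps K M N" "x \<in> carrier M"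
  shows "f (\<ominus>\<^bsub>M\<^esub> x) = \<ominus>\<^bsub>N\<^esub> f x"
proof -
  interpret M: module K M by fact
  interpret N: module K N by fact
  note c = lin_closed[OF assms(3)]
  have "f (\<ominus>\<^bsub>M\<^esub> x) \<oplus>\<^bsub>N\<^esub> f x = \<zero>\<^bsub>N\<^esub>"
    using assms lin_zero[OF assms(1-3)]
    by (simp add: lin_add[OF assms(3), symmetric] M.l_neg)
  then show ?thesis using c assms(4) by (simp add: N.minus_equality)
qed

lemma lin_minus:
  assumes "module K M" "module K N" "f \<in> linear_maps K M N" "x \<in> carrier M" "y \<in> carrier M"
  shows "f (x \<ominus>\<^bsub>M\<^esub> y) = f x \<ominus>\<^bsub>N\<^esub> f y"
proof -
  interpret M: module K M by fact
  interpret N: module K N by fact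
  show ?thesis using assms lin_uminus[OF assms(1-3)]
    by (simp add: M.minus_eq N.minus_eq lin_add[OF assms(3)])
qed

lemma lin_finsum:
  assumes "module K M" "module K N" "f \<in> linear_maps K M N" "finite I" "x \<in> I \<rightarrow> carrier M"
  shows "f (\<Oplus>\<^bsub>M\<^esub>i\<in>I. x i) = (\<Oplus>\<^bsub>N\<^esub>i\<in>I. f (x i))"
proof -
  interpret M: module K M by fact
  interpret N: module K N by fact
  note c = lin_closed[OF assms(3)]
  show ?thesis using assms(4,5)
  proof (induction I rule: finite_induct)
    case empty then show ?case using lin_zero[OF assms(1-3)] by simp
  next
    case (insert i I)
    have "(\<lambda>i. f (x i)) \<in> I \<rightarrow> carrier N" "x \<in> I \<rightarrow> carrier M" using insert.prems c by auto
    then show ?case using insert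
      by (simp add: lin_add[OF assms(3)] c)
  qed
qed

lemma lin_plus:
  assumes "module K M" "module K N" "f \<in> linear_maps K M N" "g \<in> linear_maps K M N"
  shows "(\<lambda>x. f x \<oplus>\<^bsub>N\<^esub> g x) \<in> linear_maps K M N"
proof -
  interpret M: module K M by fact
  interpret N: module K N by fact
  note c = lin_closed[OF assms(3)] lin_closed[OF assms(4)]
  show ?thesis
    by (rule linI)
      (simp_all add: c lin_add[OF assms(3)] lin_add[OF assms(4)]
        lin_smult[OF assms(3)] lin_smult[OF assms(4)] N.smult_r_distr
        N.a_assoc N.a_lcomm)
qed

lemma lin_scale:
  assumes "module K M" "module K N" "f \<in> linear_maps K M N" "c \<in> carrier K"
  shows "(\<lambda>x. c \<odot>\<^bsub>N\<^esub> f x) \<in> linear_maps K M N"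
proof -
  interpret M: module K M by fact
  interpret N: module K N by fact
  note cl = lin_closed[OF assms(3)]
  show ?thesis using assms(4)
    by (intro linI)
      (simp_all add: cl lin_add[OF assms(3)]
        lin_smult[OF assms(3)] N.smult_r_distr N.smult_assoc1[symmetric] M.R.m_comm)
qed

lemma lin_smult_fixed:
  assumes "module K N" "f \<in> linear_maps K M (ground_module K)" "y \<in> carrier N"
  shows "(\<lambda>x. f x \<odot>\<^bsub>N\<^esub> y) \<in> linear_maps K M N"
proof -
  interpret N: module K N by fact
  note cl = lin_closed[OF assms(2)]
  show ?thesis using assms(3)
    by (intro linI)
      (use cl in \<open>simp_all add: ground_module_def lin_add[OF assms(2)]
        lin_smult[OF assms(2)] N.smult_l_distr N.smult_assoc1\<close>)
qed

lemma lin_smult_const: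
  assumes "module K N" "c \<in> carrier K"
  shows "(\<lambda>x. c \<odot>\<^bsub>N\<^esub> x) \<in> linear_maps K N N"
  using lin_scale[OF assms(1,1) lin_id assms(2)] .

lemma ground_module_module: "cring K \<Longrightarrow> module K (ground_module K)"
proof -
  assume "cring K"
  then interpret cring K .
  have "abelian_group (ground_module K)"
    by (rule abelian_groupI)
      (auto simp: ground_module_def a_assoc a_comm a_lcomm intro: bexI[of _ "\<ominus>\<^bsub>K\<^esub> x" for x] l_neg)
  then show ?thesis
    by (intro moduleI \<open>cring K\<close>) (auto simp: ground_module_def l_distr r_distr m_assoc)
qed

lemma ground_module_simps [simp]:
  "carrier (ground_module K) = carrier K"
  "\<zero>\<^bsub>ground_module K\<^esub> = \<zero>\<^bsub>K\<^esub>"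
  "x \<oplus>\<^bsub>ground_module K\<^esub> y = x \<oplus>\<^bsub>K\<^esub> y"
  "x \<odot>\<^bsub>ground_module K\<^esub> y = x \<otimes>\<^bsub>K\<^esub> y"
  by (simp_all add: ground_module_def)

definition bilinear_maps ::
  "('k, 'r) ring_scheme \<Rightarrow> ('k, 'm, 'x) module_scheme \<Rightarrow> ('k, 'n, 'y) module_scheme
    \<Rightarrow> ('k, 'p, 'z) module_scheme \<Rightarrow> ('m \<Rightarrow> 'n \<Rightarrow> 'p) set"
  where "bilinear_maps K M N P =
    {f. (\<forall>x\<in>carrier M. f x \<in> linear_maps K N P) \<and> (\<forall>y\<in>carrier N. (\<lambda>x. f x y) \<in> linear_maps K M P)}"

lemma bilinI:
  assumes "\<And>x. x \<in> carrier M \<Longrightarrow> f x \<in> linear_maps K N P"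
    and "\<And>y. y \<in> carrier N \<Longrightarrow> (\<lambda>x. f x y) \<in> linear_maps K M P"
  shows "f \<in> bilinear_maps K M N P"
  using assms by (simp add: bilinear_maps_def)

lemma bilin_right: "\<lbrakk>f \<in> bilinear_maps K M N P; x \<in> carrier M\<rbrakk> \<Longrightarrow> f x \<in> linear_maps K N P"
  by (simp add: bilinear_maps_def)

lemma bilin_left:
  "\<lbrakk>f \<in> bilinear_maps K M N P; y \<in> carrier N\<rbrakk> \<Longrightarrow> (\<lambda>x. f x y) \<in> linear_maps K M P"
  by (simp add: bilinear_maps_def)

lemma bilin_closed:
  "\<lbrakk>f \<in> bilinear_maps K M N P; x \<in> carrier M; y \<in> carrier N\<rbrakk> \<Longrightarrow> f x y \<in> carrier P"
  by (meson bilin_right lin_closed)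

lemma bilin_precomp:
  assumes "f \<in> bilinear_maps K M N P" "g \<in> linear_maps K M' M" "h \<in> linear_maps K N' N"
  shows "(\<lambda>x y. f (g x) (h y)) \<in> bilinear_maps K M' N' P"
proof (rule bilinI)
  fix x assume "x \<in> carrier M'"
  then show "(\<lambda>y. f (g x) (h y)) \<in> linear_maps K N' P"
    using assms lin_closed[OF assms(2)]
    by (auto intro: lin_comp[of _ K _ N] bilin_right)
next
  fix y assume "y \<in> carrier N'"
  then show "(\<lambda>x. f (g x) (h y)) \<in> linear_maps K M' P"
    using assms lin_closed[OF assms(3)]
    by (auto intro: lin_comp[of _ K _ M, where g="\<lambda>x. f x z" for z] bilin_left)
qed

text \<open>Closure under negation follows from the multiple by \<open>\<ominus> \<one>\<close>, so
  sums and scalar multiples suffice.\<close>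

lemma submoduleI':
  assumes "module K V" "W \<subseteq> carrier V" "\<zero>\<^bsub>V\<^esub> \<in> W"
    and "\<And>a b. \<lbrakk>a \<in> W; b \<in> W\<rbrakk> \<Longrightarrow> a \<oplus>\<^bsub>V\<^esub> b \<in> W"
    and "\<And>c a. \<lbrakk>c \<in> carrier K; a \<in> W\<rbrakk> \<Longrightarrow> c \<odot>\<^bsub>V\<^esub> a \<in> W"
  shows "submodule W K V"
proof -
  interpret module K V by fact
  show ?thesis
  proof (rule submoduleI)
    fix a assume a: "a \<in> W"
    have "(\<ominus>\<^bsub>K\<^esub> \<one>\<^bsub>K\<^esub>) \<odot>\<^bsub>V\<^esub> a = \<ominus>\<^bsub>V\<^esub> a" using a assms(2) by (subst smult_l_minus) auto
    then show "\<ominus>\<^bsub>V\<^esub> a \<in> W" using assms(5)[of "\<ominus>\<^bsub>K\<^esub> \<one>\<^bsub>K\<^esub>" a] a by simp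
  qed (use assms in auto)
qed

lemma submodule_zero: "submodule W K V \<Longrightarrow> \<zero>\<^bsub>V\<^esub> \<in> W"
  using subgroup.one_closed[OF submodule.axioms(1)] by fastforce

lemma submodule_subset: "submodule W K V \<Longrightarrow> W \<subseteq> carrier V"
  using subgroup.subset[OF submodule.axioms(1)] by fastforce

lemma submodule_add: "\<lbrakk>submodule W K V; a \<in> W; b \<in> W\<rbrakk> \<Longrightarrow> a \<oplus>\<^bsub>V\<^esub> b \<in> W"
  using subgroup.m_closed[OF submodule.axioms(1)] by fastforce

lemma submodule_smult: "\<lbrakk>submodule W K V; c \<in> carrier K; a \<in> W\<rbrakk> \<Longrightarrow> c \<odot>\<^bsub>V\<^esub> a \<in> W"
  by (rule submodule.smult_closed)

lemma submodule_minus: "\<lbrakk>module K V; submodule W K V; a \<in> W; b \<in> W\<rbrakk> \<Longrightarrow> a \<ominus>\<^bsub>V\<^esub> b \<in> W"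
  unfolding a_minus_def using module.submoduleE(3) submodule_add by metis

lemma submodule_finsum:
  assumes "module K V" "submodule W K V" "finite I" "x \<in> I \<rightarrow> W"
  shows "(\<Oplus>\<^bsub>V\<^esub>i\<in>I. x i) \<in> W"
  using assms(3,4)
proof (induction I rule: finite_induct)
  interpret module K V by fact
  case empty then show ?case using submodule_zero[OF assms(2)] by simp
next
  interpret module K V by fact
  case (insert i I)
  then have "x \<in> I \<rightarrow> carrier V" "x i \<in> carrier V" using submodule_subset[OF assms(2)] by auto
  then show ?case using insert submodule_add[OF assms(2)] by auto
qed

lemma kernel_submodule:
  assumes "module K V" "module K P" "f \<in> linear_maps K V P"
  shows "submodule {x \<in> carrier V. f x = \<zero>\<^bsub>P\<^esub>} K V"
proof -
  interpret V: module K V by fact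
  interpret P: module K P by fact
  show ?thesis
    by (rule submoduleI')
      (auto simp: assms lin_zero[OF assms] lin_add[OF assms(3)] lin_smult[OF assms(3)])
qed

section \<open>Free modules, quotients and tensor products\<close>

lemma free_module_module:
  assumes "cring K" shows "module K (free_module K S)"
proof -
  interpret cring K by fact
  have sub: "finite {s. f s \<noteq> \<zero>\<^bsub>K\<^esub>} \<Longrightarrow> finite {s. g s \<noteq> \<zero>\<^bsub>K\<^esub>} \<Longrightarrow> range f \<subseteq> carrier K \<Longrightarrow> range g \<subseteq> carrier K
     \<Longrightarrow> finite {s. f s \<oplus>\<^bsub>K\<^esub> g s \<noteq> \<zero>\<^bsub>K\<^esub>}" for f g :: "'c \<Rightarrow> 'a"
    by (rule finite_subset[of _ "{s. f s \<noteq> \<zero>\<^bsub>K\<^esub>} \<union> {s. g s \<noteq> \<zero>\<^bsub>K\<^esub>}"]) auto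
  have sub2: "finite {s. f s \<noteq> \<zero>\<^bsub>K\<^esub>} \<Longrightarrow> c \<in> carrier K
     \<Longrightarrow> finite {s. c \<otimes>\<^bsub>K\<^esub> f s \<noteq> \<zero>\<^bsub>K\<^esub>}" for c and f :: "'c \<Rightarrow> 'a"
    by (rule finite_subset[of _ "{s. f s \<noteq> \<zero>\<^bsub>K\<^esub>}"]) auto
  have ab: "abelian_group (free_module K S)"
  proof (rule abelian_groupI)
    fix f assume f: "f \<in> carrier (free_module K S)"
    then have r: "f s \<in> carrier K" for s by (auto simp: free_module_def)
    have "(\<lambda>s. \<ominus>\<^bsub>K\<^esub> f s) \<in> carrier (free_module K S)"
      using f r unfolding free_module_def by (auto elim!: rev_finite_subset)
    moreover have "(\<lambda>s. \<ominus>\<^bsub>K\<^esub> f s) \<oplus>\<^bsub>free_module K S\<^esub> f = \<zero>\<^bsub>free_module K S\<^esub>"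
      using r by (auto simp: free_module_def l_neg)
    ultimately show "\<exists>g\<in>carrier (free_module K S). g \<oplus>\<^bsub>free_module K S\<^esub> f = \<zero>\<^bsub>free_module K S\<^esub>" by blast
  next
    fix f g assume "f \<in> carrier (free_module K S)" "g \<in> carrier (free_module K S)"
    then show "f \<oplus>\<^bsub>free_module K S\<^esub> g \<in> carrier (free_module K S)"
      by (auto simp: free_module_def sub image_subset_iff subset_iff) (metis l_zero zero_closed)
  qed (auto simp: free_module_def fun_eq_iff a_assoc a_comm a_lcomm image_subset_iff)
  show ?thesis
  proof (rule moduleI)
    fix c f assume "c \<in> carrier K" "f \<in> carrier (free_module K S)"
    then show "c \<odot>\<^bsub>free_module K S\<^esub> f \<in> carrier (free_module K S)"
      by (auto simp: free_module_def sub2 image_subset_iff subset_iff) (metis r_null rangeI)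
  qed (use ab assms in \<open>auto simp: free_module_def fun_eq_iff l_distr r_distr m_assoc image_subset_iff\<close>)
qed

section \<open>Quotients by submodules\<close>

lemma submodule_abelian_subgroup:
  assumes "module K V" "submodule W K V" shows "abelian_subgroup W V"
  using assms
  by (intro abelian_subgroupI3 additive_subgroup.intro) (auto simp: module_def submodule_def)

text \<open>The scalar multiple of a coset is defined as a union of cosets, one for each
  representative. Two representatives differ by some \<open>w \<in> W\<close>, and
  \<open>c \<odot> w \<in> W\<close>, so all these cosets coincide.\<close>

lemma quot_smult:
  fixes V (structure)
  assumes "module K V" "submodule W K V" "c \<in> carrier K" "x \<in> carrier V"
  shows "c \<odot>\<^bsub>quot_module V W\<^esub> (W +> x) = W +> (c \<odot> x)"
proof -
  interpret module K V by fact
  interpret W: abelian_subgroup W V using assms submodule_abelian_subgroup by blast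
  have "W +> (c \<odot> y) = W +> (c \<odot> x)" if y: "y \<in> W +> x" for y
  proof -
    obtain w where w: "w \<in> W" "y = w \<oplus> x" using y by (auto simp: a_r_coset_def')
    have "w \<in> carrier V" using w submodule_subset[OF assms(2)] by auto
    then have "c \<odot> y = c \<odot> w \<oplus> c \<odot> x" using w assms by (simp add: smult_r_distr)
    moreover have "c \<odot> w \<in> W" using submodule_smult[OF assms(2,3)] w by simp
    ultimately have "c \<odot> y \<in> W +> (c \<odot> x)" by (auto simp: a_r_coset_def')
    then show ?thesis by (rule W.a_repr_independence'[symmetric]) (use assms in simp)
  qed
  moreover have "x \<in> W +> x" using assms W.a_rcos_self by blast
  ultimately have "(\<Union>y\<in>W +> x. W +> (c \<odot> y)) = W +> (c \<odot> x)" by blast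
  then show ?thesis by (simp add: quot_module_def)
qed

lemma quot_module_module:
  fixes V (structure)
  assumes "module K V" "submodule W K V"
  shows "module K (quot_module V W)"
proof -
  let ?Q = "quot_module V W"
  interpret module K V by fact
  interpret W: abelian_subgroup W V using assms submodule_abelian_subgroup by blast
  have carr: "X \<in> carrier ?Q \<Longrightarrow> \<exists>x\<in>carrier V. X = W +> x" for X
    by (auto simp: quot_module_def A_RCOSETS_def')
  have carr': "x \<in> carrier V \<Longrightarrow> W +> x \<in> carrier ?Q" for x
    by (auto simp: quot_module_def A_RCOSETS_def')
  have add: "x \<in> carrier V \<Longrightarrow> y \<in> carrier V \<Longrightarrow>
     (W +> x) \<oplus>\<^bsub>?Q\<^esub> (W +> y) = W +> (x \<oplus> y)" for x y
    by (simp add: quot_module_def W.a_rcos_sum)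
  \<comment> \<open>Coset addition is the multiplication of the factor group, so the additive axioms
    are taken from there; the scalar laws are checked on representatives.\<close>
  interpret Q: comm_group "V A_Mod W" by (rule W.a_factorgroup_is_comm_group)
  have ops: "carrier ?Q = carrier (V A_Mod W)" "\<zero>\<^bsub>?Q\<^esub> = \<one>\<^bsub>V A_Mod W\<^esub>"
    "\<And>X Y. X \<oplus>\<^bsub>?Q\<^esub> Y = X \<otimes>\<^bsub>V A_Mod W\<^esub> Y"
    by (simp_all add: quot_module_def A_FactGroup_def')
  have ab: "abelian_group ?Q"
    by (rule abelian_groupI) (simp_all add: ops Q.m_assoc Q.l_inv_ex Q.m_comm Q.m_lcomm del: add_A_FactGroup)
  note sm = quot_smult[OF assms]
  show ?thesis
  proof (rule moduleI)
    fix c X assume c: "c \<in> carrier K" and "X \<in> carrier ?Q"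
    then obtain x where x: "x \<in> carrier V" "X = W +> x" using carr by blast
    show "c \<odot>\<^bsub>?Q\<^esub> X \<in> carrier ?Q" using c x carr' by (simp add: sm)
    {
      fix d assume d: "d \<in> carrier K"
      show "(c \<oplus>\<^bsub>K\<^esub> d) \<odot>\<^bsub>?Q\<^esub> X =
          c \<odot>\<^bsub>?Q\<^esub> X \<oplus>\<^bsub>?Q\<^esub> d \<odot>\<^bsub>?Q\<^esub> X"
        using c d x by (simp add: sm add smult_l_distr)
      show "(c \<otimes>\<^bsub>K\<^esub> d) \<odot>\<^bsub>?Q\<^esub> X = c \<odot>\<^bsub>?Q\<^esub> (d \<odot>\<^bsub>?Q\<^esub> X)"
        using c d x by (simp add: sm smult_assoc1)
    }
    fix Y assume "Y \<in> carrier ?Q"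
    then obtain y where "y \<in> carrier V" "Y = W +> y" using carr by blast
    then show "c \<odot>\<^bsub>?Q\<^esub> (X \<oplus>\<^bsub>?Q\<^esub> Y) =
        c \<odot>\<^bsub>?Q\<^esub> X \<oplus>\<^bsub>?Q\<^esub> c \<odot>\<^bsub>?Q\<^esub> Y"
      using c x by (simp add: sm add smult_r_distr)
  next
    fix X assume "X \<in> carrier ?Q"
    then obtain x where "x \<in> carrier V" "X = W +> x" using carr by blast
    then show "\<one>\<^bsub>K\<^esub> \<odot>\<^bsub>?Q\<^esub> X = X" by (simp add: sm)
  qed (rule R.is_cring, rule ab)
qed

section \<open>The tensor product as a quotient of the free module on pairs\<close>

locale two_modules = M: module K M + N: module K N
  for K :: "('k, 'r) ring_scheme" (structure)
    and M :: "('k, 'm, 'x) module_scheme"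
    and N :: "('k, 'n, 'y) module_scheme"
begin

abbreviation F where "F \<equiv> free_module K (carrier M \<times> carrier N)"
abbreviation Z where "Z \<equiv> tensor_null K M N"
abbreviation T where "T \<equiv> tensor_product K M N"

sublocale F: module K F by (rule free_module_module) (rule M.R.is_cring)

lemmas modM = M.module_axioms and modN = N.module_axioms and modF = F.module_axioms

lemma free_gen_closed: "\<lbrakk>x \<in> carrier M; y \<in> carrier N\<rbrakk> \<Longrightarrow> free_gen K (x, y) \<in> carrier F"
  by (auto simp: free_gen_def free_module_def)

lemma tensor_relations_subset: "tensor_relations K M N \<subseteq> carrier F"
  unfolding tensor_relations_def Let_def
  by (auto simp: free_gen_closed)

lemma tensor_null_submodule: "submodule Z K F"
  unfolding tensor_null_def
proof (rule submoduleI'[OF modF])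
  show "\<Inter> {W. submodule W K F \<and> tensor_relations K M N \<subseteq> W} \<subseteq> carrier F"
    using F.carrier_is_submodule tensor_relations_subset by blast
qed (auto simp: submodule_zero submodule_add submodule_smult)

lemma tensor_relations_null: "tensor_relations K M N \<subseteq> Z"
  unfolding tensor_null_def by auto

lemma tensor_null_least: "\<lbrakk>submodule W K F; tensor_relations K M N \<subseteq> W\<rbrakk> \<Longrightarrow> Z \<subseteq> W"
  unfolding tensor_null_def by auto

sublocale T: module K T
  unfolding tensor_product_def by (rule quot_module_module[OF modF tensor_null_submodule])

lemmas modT = T.module_axioms

sublocale Z: abelian_subgroup Z F
  by (rule submodule_abelian_subgroup[OF modF tensor_null_submodule])

lemma coset_closed: "f \<in> carrier F \<Longrightarrow> Z +>\<^bsub>F\<^esub> f \<in> carrier T"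
  by (auto simp: tensor_product_def quot_module_def A_RCOSETS_def')

lemma coset_cases: "t \<in> carrier T \<Longrightarrow> \<exists>f\<in>carrier F. t = Z +>\<^bsub>F\<^esub> f"
  by (auto simp: tensor_product_def quot_module_def A_RCOSETS_def')

lemma coset_add:
  "\<lbrakk>f \<in> carrier F; g \<in> carrier F\<rbrakk> \<Longrightarrow> (Z +>\<^bsub>F\<^esub> f) \<oplus>\<^bsub>T\<^esub> (Z +>\<^bsub>F\<^esub> g) = Z +>\<^bsub>F\<^esub> (f \<oplus>\<^bsub>F\<^esub> g)"
  by (simp add: tensor_product_def quot_module_def Z.a_rcos_sum)

lemma coset_smult:
  "\<lbrakk>c \<in> carrier K; f \<in> carrier F\<rbrakk> \<Longrightarrow> c \<odot>\<^bsub>T\<^esub> (Z +>\<^bsub>F\<^esub> f) = Z +>\<^bsub>F\<^esub> (c \<odot>\<^bsub>F\<^esub> f)"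
  unfolding tensor_product_def by (rule quot_smult[OF modF tensor_null_submodule])

lemma coset_eqI:
  assumes "f \<in> carrier F" "g \<in> carrier F" "f \<ominus>\<^bsub>F\<^esub> g \<in> Z"
  shows "Z +>\<^bsub>F\<^esub> f = Z +>\<^bsub>F\<^esub> g"
proof -
  have "f = (f \<ominus>\<^bsub>F\<^esub> g) \<oplus>\<^bsub>F\<^esub> g" using assms by (simp add: F.minus_eq F.a_assoc F.l_neg)
  then have "f \<in> Z +>\<^bsub>F\<^esub> g" using assms(3) unfolding a_r_coset_def' by blast
  then show ?thesis by (rule Z.a_repr_independence'[symmetric]) (rule assms)
qed

lemma pure_tensor_closed: "\<lbrakk>x \<in> carrier M; y \<in> carrier N\<rbrakk> \<Longrightarrow> pure_tensor K M N x y \<in> carrier T"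
  by (simp add: pure_tensor_def coset_closed free_gen_closed)

lemma pure_tensor_bilinear: "pure_tensor K M N \<in> bilinear_maps K M N T"
proof (intro bilinI linI)
  note rel = subsetD[OF tensor_relations_null]
  note c = free_gen_closed
  fix x y assume x: "x \<in> carrier M" and y: "y \<in> carrier N"
  {
    fix y' assume y': "y' \<in> carrier N"
    have "free_gen K (x, y \<oplus>\<^bsub>N\<^esub> y') \<ominus>\<^bsub>F\<^esub> (free_gen K (x, y) \<oplus>\<^bsub>F\<^esub> free_gen K (x, y')) \<in> Z"
      by (rule rel) (use x y y' in \<open>auto simp: tensor_relations_def Let_def\<close>)
    then show "pure_tensor K M N x (y \<oplus>\<^bsub>N\<^esub> y') = pure_tensor K M N x y \<oplus>\<^bsub>T\<^esub> pure_tensor K M N x y'"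
      using x y y' by (simp add: pure_tensor_def coset_add c coset_eqI)
  }
  {
    fix x' assume x': "x' \<in> carrier M"
    have "free_gen K (x \<oplus>\<^bsub>M\<^esub> x', y) \<ominus>\<^bsub>F\<^esub> (free_gen K (x, y) \<oplus>\<^bsub>F\<^esub> free_gen K (x', y)) \<in> Z"
      by (rule rel) (use x y x' in \<open>auto simp: tensor_relations_def Let_def\<close>)
    then show "pure_tensor K M N (x \<oplus>\<^bsub>M\<^esub> x') y = pure_tensor K M N x y \<oplus>\<^bsub>T\<^esub> pure_tensor K M N x' y"
      using x y x' by (simp add: pure_tensor_def coset_add c coset_eqI)
  }
  fix a assume a: "a \<in> carrier K"
  have "free_gen K (x, a \<odot>\<^bsub>N\<^esub> y) \<ominus>\<^bsub>F\<^esub> (a \<odot>\<^bsub>F\<^esub> free_gen K (x, y)) \<in> Z"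
    by (rule rel) (use x y a in \<open>auto simp: tensor_relations_def Let_def\<close>)
  then show "pure_tensor K M N x (a \<odot>\<^bsub>N\<^esub> y) = a \<odot>\<^bsub>T\<^esub> pure_tensor K M N x y"
    using x y a by (simp add: pure_tensor_def coset_smult c coset_eqI)
  have "free_gen K (a \<odot>\<^bsub>M\<^esub> x, y) \<ominus>\<^bsub>F\<^esub> (a \<odot>\<^bsub>F\<^esub> free_gen K (x, y)) \<in> Z"
    by (rule rel) (use x y a in \<open>auto simp: tensor_relations_def Let_def\<close>)
  then show "pure_tensor K M N (a \<odot>\<^bsub>M\<^esub> x) y = a \<odot>\<^bsub>T\<^esub> pure_tensor K M N x y"
    using x y a by (simp add: pure_tensor_def coset_smult c coset_eqI)
qed (simp_all add: pure_tensor_closed)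

text \<open>A scalar multiple of a generator is again pure, since the coefficient can be moved into
  the left factor. Hence every tensor is a sum of pure tensors, and zero is pure as well.\<close>

lemma tensor_induct [consumes 1, case_names pure add]:
  assumes "t \<in> carrier T"
    and pure: "\<And>x y. \<lbrakk>x \<in> carrier M; y \<in> carrier N\<rbrakk> \<Longrightarrow> P (pure_tensor K M N x y)"
    and add: "\<And>t u. \<lbrakk>t \<in> carrier T; u \<in> carrier T; P t; P u\<rbrakk> \<Longrightarrow> P (t \<oplus>\<^bsub>T\<^esub> u)"
  shows "P t"
proof -
  have P0: "P \<zero>\<^bsub>T\<^esub>"
    using pure[of "\<zero>\<^bsub>M\<^esub>" "\<zero>\<^bsub>N\<^esub>"]
      lin_zero[OF modN modT bilin_right[OF pure_tensor_bilinear], of "\<zero>\<^bsub>M\<^esub>"]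
    by simp
  \<comment> \<open>\<open>S\<close> merely contains the support: once the value at \<open>s\<close>
    is set to zero, what remains has its support in the smaller set.\<close>
  have "P (Z +>\<^bsub>F\<^esub> f)" if "finite S" "f \<in> carrier F" "{s. f s \<noteq> \<zero>} \<subseteq> S" for S f
    using that
  proof (induction S arbitrary: f rule: finite_induct)
    case empty
    then have "f = \<zero>\<^bsub>F\<^esub>" by (auto simp: free_module_def)
    moreover have "Z +>\<^bsub>F\<^esub> \<zero>\<^bsub>F\<^esub> = \<zero>\<^bsub>T\<^esub>"
      using coset_smult[of \<zero> "\<zero>\<^bsub>F\<^esub>"] coset_closed[of "\<zero>\<^bsub>F\<^esub>"] by simp
    ultimately show ?case using P0 by simp
  next
    case (insert s S)
    show ?case
    proof (cases "f s = \<zero>")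
      case True
      then show ?thesis using insert.prems by (intro insert.IH) auto
    next
      case False
      then have s: "s \<in> carrier M \<times> carrier N" using insert.prems by (auto simp: free_module_def)
      obtain x y where xy: "s = (x, y)" "x \<in> carrier M" "y \<in> carrier N" using s by auto
      have fc: "f u \<in> carrier K" for u using insert.prems by (auto simp: free_module_def)
      define g where "g = f(s := \<zero>)"
      have g: "g \<in> carrier F"
        using insert.prems(1) unfolding g_def free_module_def by (auto elim!: rev_finite_subset)
      have sm: "f s \<odot>\<^bsub>F\<^esub> free_gen K s \<in> carrier F" using fc xy free_gen_closed by auto
      have "f = f s \<odot>\<^bsub>F\<^esub> free_gen K s \<oplus>\<^bsub>F\<^esub> g"
        using fc by (auto simp: g_def free_module_def free_gen_def fun_eq_iff)
      then have "Z +>\<^bsub>F\<^esub> f = (Z +>\<^bsub>F\<^esub> (f s \<odot>\<^bsub>F\<^esub> free_gen K s)) \<oplus>\<^bsub>T\<^esub> (Z +>\<^bsub>F\<^esub> g)"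
        using coset_add[OF sm g] by simp
      moreover have "Z +>\<^bsub>F\<^esub> (f s \<odot>\<^bsub>F\<^esub> free_gen K s) = pure_tensor K M N (f s \<odot>\<^bsub>M\<^esub> x) y"
        using xy fc lin_smult[OF bilin_left[OF pure_tensor_bilinear]]
        by (simp add: coset_smult[symmetric] free_gen_closed pure_tensor_def)
      moreover have "P (Z +>\<^bsub>F\<^esub> g)"
        using insert.prems by (intro insert.IH g) (auto simp: g_def)
      ultimately show ?thesis
        using add[OF pure_tensor_closed coset_closed[OF g] pure, of "f s \<odot>\<^bsub>M\<^esub> x" y] xy fc by simp
    qed
  qed
  moreover obtain f where "f \<in> carrier F" "t = Z +>\<^bsub>F\<^esub> f" using coset_cases assms(1) by blast
  moreover have "f \<in> carrier F \<Longrightarrow> finite {s. f s \<noteq> \<zero>}" for f by (auto simp: free_module_def)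
  ultimately show ?thesis by blast
qed

end

text \<open>The substitute for Sweedler notation: identities between maps on a tensor product, such
  as naturality of contractions or associativity of products, are checked on pure tensors.\<close>

lemma tensor_linear_eqI:
  assumes "module K M" "module K N" "module K P"
    and "f \<in> linear_maps K (tensor_product K M N) P" "g \<in> linear_maps K (tensor_product K M N) P"
    and "\<And>x y. \<lbrakk>x \<in> carrier M; y \<in> carrier N\<rbrakk> \<Longrightarrow> f (pure_tensor K M N x y) = g (pure_tensor K M N x y)"
    and "t \<in> carrier (tensor_product K M N)"
  shows "f t = g t"
proof -
  interpret two_modules K M N using assms(1,2) by (simp add: two_modules_def)
  show ?thesis using assms(7)
    by (induction t rule: tensor_induct)
      (simp_all add: assms(6) lin_add[OF assms(4)] lin_add[OF assms(5)])
qed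

section \<open>The universal property of the tensor product\<close>

locale tensor_bilinear = two_modules K M N + P: module K P
  for K :: "('k, 'r) ring_scheme" (structure)
    and M :: "('k, 'm, 'x) module_scheme"
    and N :: "('k, 'n, 'y) module_scheme"
    and P :: "('k, 'p, 'z) module_scheme" +
  fixes b assumes b: "b \<in> bilinear_maps K M N P"
begin

text \<open>The linear extension of \<open>b\<close> to the free module. It is the sum inside
  \<open>tensor_lift\<close>, taken at a single representative of the coset.\<close>

definition ev where "ev f = (\<Oplus>\<^bsub>P\<^esub>s\<in>{s. f s \<noteq> \<zero>}. f s \<odot>\<^bsub>P\<^esub> b (fst s) (snd s))"

text \<open>Two functions have different supports, so their sums can be added only after both are
  written over a common finite index set; the extra terms have coefficient zero.\<close>

lemma ev_superset:
  assumes "f \<in> carrier F" "finite S" "{s. f s \<noteq> \<zero>} \<subseteq> S" "S \<subseteq> carrier M \<times> carrier N"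
  shows "ev f = (\<Oplus>\<^bsub>P\<^esub>s\<in>S. f s \<odot>\<^bsub>P\<^esub> b (fst s) (snd s))"
proof -
  have fc: "f s \<in> carrier K" for s using assms(1) by (auto simp: free_module_def)
  have bc: "b (fst s) (snd s) \<in> carrier P" if "s \<in> S" for s
    using bilin_closed[OF b] assms(4) that by auto
  show ?thesis unfolding ev_def
    by (rule P.add.finprod_mono_neutral_cong_left) (use assms(2,3) fc bc in auto)
qed

lemma supp: "f \<in> carrier F \<Longrightarrow> finite {s. f s \<noteq> \<zero>} \<and> {s. f s \<noteq> \<zero>} \<subseteq> carrier M \<times> carrier N"
  by (auto simp: free_module_def)

lemma ev_linear: "ev \<in> linear_maps K F P"
proof (rule linI)
  have fc: "f \<in> carrier F \<Longrightarrow> f s \<in> carrier K" for f s by (auto simp: free_module_def)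
  have bc: "b (fst s) (snd s) \<in> carrier P" if "s \<in> carrier M \<times> carrier N" for s
    using bilin_closed[OF b] that by auto
  fix f assume f: "f \<in> carrier F"
  note sf = supp[OF f]
  show "ev f \<in> carrier P" unfolding ev_def
    using bc sf by (intro P.finsum_closed) (auto intro!: P.smult_closed fc f)
  {
    fix g assume g: "g \<in> carrier F"
    note sg = supp[OF g]
    let ?S = "{s. f s \<noteq> \<zero>} \<union> {s. g s \<noteq> \<zero>}"
    have S: "finite ?S" "?S \<subseteq> carrier M \<times> carrier N" using sf sg by auto
    have bS: "b (fst s) (snd s) \<in> carrier P" if "s \<in> ?S" for s using bc S that by blast
    have ap: "(f \<oplus>\<^bsub>F\<^esub> g) s = f s \<oplus> g s" for s by (simp add: free_module_def)
    have "ev (f \<oplus>\<^bsub>F\<^esub> g) = (\<Oplus>\<^bsub>P\<^esub>s\<in>?S. (f \<oplus>\<^bsub>F\<^esub> g) s \<odot>\<^bsub>P\<^esub> b (fst s) (snd s))"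
      by (rule ev_superset[OF F.a_closed[OF f g] S(1) _ S(2)]) (auto simp: free_module_def)
    also have "\<dots> = (\<Oplus>\<^bsub>P\<^esub>s\<in>?S. f s \<odot>\<^bsub>P\<^esub> b (fst s) (snd s) \<oplus>\<^bsub>P\<^esub> g s \<odot>\<^bsub>P\<^esub> b (fst s) (snd s))"
      by (rule P.finsum_cong') (use f g fc bS in \<open>auto simp: ap P.smult_l_distr\<close>)
    also have "\<dots> = (\<Oplus>\<^bsub>P\<^esub>s\<in>?S. f s \<odot>\<^bsub>P\<^esub> b (fst s) (snd s)) \<oplus>\<^bsub>P\<^esub> (\<Oplus>\<^bsub>P\<^esub>s\<in>?S. g s \<odot>\<^bsub>P\<^esub> b (fst s) (snd s))"
      using bS f g fc by (intro P.finsum_addf) auto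
    also have "\<dots> = ev f \<oplus>\<^bsub>P\<^esub> ev g"
      using ev_superset[OF f S(1) _ S(2)] ev_superset[OF g S(1) _ S(2)] by simp
    finally show "ev (f \<oplus>\<^bsub>F\<^esub> g) = ev f \<oplus>\<^bsub>P\<^esub> ev g" .
  }
  fix c assume c: "c \<in> carrier K"
  let ?S = "{s. f s \<noteq> \<zero>}"
  have bS: "b (fst s) (snd s) \<in> carrier P" if "s \<in> ?S" for s using bc sf that by blast
  have ap: "(c \<odot>\<^bsub>F\<^esub> f) s = c \<otimes> f s" for s by (simp add: free_module_def)
  have "ev (c \<odot>\<^bsub>F\<^esub> f) = (\<Oplus>\<^bsub>P\<^esub>s\<in>?S. (c \<odot>\<^bsub>F\<^esub> f) s \<odot>\<^bsub>P\<^esub> b (fst s) (snd s))"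
    by (rule ev_superset) (use f c sf in \<open>auto simp: ap\<close>)
  also have "\<dots> = (\<Oplus>\<^bsub>P\<^esub>s\<in>?S. c \<odot>\<^bsub>P\<^esub> (f s \<odot>\<^bsub>P\<^esub> b (fst s) (snd s)))"
    by (rule P.finsum_cong') (use f c fc bS in \<open>auto simp: ap P.smult_assoc1\<close>)
  also have "\<dots> = c \<odot>\<^bsub>P\<^esub> ev f"
    unfolding ev_def using sf c fc[OF f] bS by (intro P.finsum_smult_ldistr[symmetric]) auto
  finally show "ev (c \<odot>\<^bsub>F\<^esub> f) = c \<odot>\<^bsub>P\<^esub> ev f" .
qed

lemma ev_free_gen:
  assumes "x \<in> carrier M" "y \<in> carrier N" shows "ev (free_gen K (x, y)) = b x y"
proof -
  have "ev (free_gen K (x, y)) = (\<Oplus>\<^bsub>P\<^esub>s\<in>{(x, y)}. free_gen K (x, y) s \<odot>\<^bsub>P\<^esub> b (fst s) (snd s))"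
    by (rule ev_superset) (use assms free_gen_closed in \<open>auto simp: free_gen_def\<close>)
  also have "\<dots> = b x y" using assms bilin_closed[OF b] by (simp add: free_gen_def)
  finally show ?thesis .
qed

text \<open>The kernel of \<open>ev\<close> is a submodule, and bilinearity of \<open>b\<close> puts
  each of the four families of relations into it; \<open>Z\<close> is the least such
  submodule.\<close>

lemma ev_null: "f \<in> Z \<Longrightarrow> ev f = \<zero>\<^bsub>P\<^esub>"
proof -
  note ker = kernel_submodule[OF modF P.module_axioms ev_linear]
  note lin = lin_minus[OF modF P.module_axioms ev_linear]
    lin_add[OF ev_linear] lin_smult[OF ev_linear]
  note br = bilin_right[OF b] and bl = bilin_left[OF b]
  have eq: "p = q \<Longrightarrow> q \<in> carrier P \<Longrightarrow> p \<ominus>\<^bsub>P\<^esub> q = \<zero>\<^bsub>P\<^esub>" for p q by (simp add: P.minus_eq P.r_neg)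
  have "tensor_relations K M N \<subseteq> {f \<in> carrier F. ev f = \<zero>\<^bsub>P\<^esub>}"
    unfolding tensor_relations_def Let_def
    by (auto intro!: eq simp: bilin_closed[OF b] lin free_gen_closed ev_free_gen lin_add[OF br] lin_add[OF bl]
        lin_smult[OF br] lin_smult[OF bl])
  then show "f \<in> Z \<Longrightarrow> ev f = \<zero>\<^bsub>P\<^esub>" using tensor_null_least[OF ker] by blast
qed

text \<open>\<open>ev\<close> is constant on a coset, so the image of the coset is a singleton and
  \<open>the_elem\<close> returns that value.\<close>

lemma lift_coset: "f \<in> carrier F \<Longrightarrow> tensor_lift K P b (Z +>\<^bsub>F\<^esub> f) = ev f"
proof -
  assume f: "f \<in> carrier F"
  have ec: "ev f \<in> carrier P" using lin_closed[OF ev_linear f] .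
  have "ev g = ev f" if g: "g \<in> Z +>\<^bsub>F\<^esub> f" for g
  proof -
    obtain z where "z \<in> Z" "g = z \<oplus>\<^bsub>F\<^esub> f" using g by (auto simp: a_r_coset_def')
    then show ?thesis using ev_null ec f Z.a_subset by (auto simp: lin_add[OF ev_linear])
  qed
  moreover have "f \<in> Z +>\<^bsub>F\<^esub> f" using f by (rule Z.a_rcos_self)
  ultimately have "ev ` (Z +>\<^bsub>F\<^esub> f) = {ev f}" by blast
  then show ?thesis unfolding tensor_lift_def ev_def[abs_def] by simp
qed

lemma lift_linear: "tensor_lift K P b \<in> linear_maps K T P"
proof (rule linI)
  note cl = lin_closed[OF ev_linear]
  fix t assume t: "t \<in> carrier T"
  obtain f where f: "f \<in> carrier F" "t = Z +>\<^bsub>F\<^esub> f" using coset_cases t by blast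
  show "tensor_lift K P b t \<in> carrier P" using f cl lift_coset by simp
  show "tensor_lift K P b (t \<oplus>\<^bsub>T\<^esub> u) = tensor_lift K P b t \<oplus>\<^bsub>P\<^esub> tensor_lift K P b u"
    if u: "u \<in> carrier T" for u
  proof -
    obtain g where g: "g \<in> carrier F" "u = Z +>\<^bsub>F\<^esub> g" using coset_cases u by blast
    show ?thesis using f g by (simp add: coset_add lift_coset lin_add[OF ev_linear])
  qed
  show "tensor_lift K P b (c \<odot>\<^bsub>T\<^esub> t) = c \<odot>\<^bsub>P\<^esub> tensor_lift K P b t" if c: "c \<in> carrier K" for c
    using f c by (simp add: coset_smult lift_coset lin_smult[OF ev_linear])
qed

lemma lift_pure:
  "\<lbrakk>x \<in> carrier M; y \<in> carrier N\<rbrakk> \<Longrightarrow> tensor_lift K P b (pure_tensor K M N x y) = b x y"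
  by (simp add: pure_tensor_def lift_coset free_gen_closed ev_free_gen)

end

lemma tensor_lift_linear:
  assumes "module K M" "module K N" "module K P" "b \<in> bilinear_maps K M N P"
  shows "tensor_lift K P b \<in> linear_maps K (tensor_product K M N) P"
  using assms tensor_bilinear.lift_linear
  by (metis tensor_bilinear.intro two_modules.intro tensor_bilinear_axioms.intro)

lemma tensor_lift_pure:
  assumes "module K M" "module K N" "module K P" "b \<in> bilinear_maps K M N P"
    "x \<in> carrier M" "y \<in> carrier N"
  shows "tensor_lift K P b (pure_tensor K M N x y) = b x y"
  using assms tensor_bilinear.lift_pure
  by (metis tensor_bilinear.intro two_modules.intro tensor_bilinear_axioms.intro)

section \<open>Linear algebra over a field\<close>

abbreviation dual where "dual K V \<equiv> linear_maps K V (ground_module K)"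

lemma field_inverse:
  assumes "field K" "a \<in> carrier K" "a \<noteq> \<zero>\<^bsub>K\<^esub>"
  shows "inv\<^bsub>K\<^esub> a \<in> carrier K" "inv\<^bsub>K\<^esub> a \<otimes>\<^bsub>K\<^esub> a = \<one>\<^bsub>K\<^esub>"
proof -
  interpret field K by fact
  show "inv\<^bsub>K\<^esub> a \<in> carrier K" "inv\<^bsub>K\<^esub> a \<otimes>\<^bsub>K\<^esub> a = \<one>\<^bsub>K\<^esub>" using assms(2,3) field_Units by auto
qed

lemma minus_zero_imp_eq:
  assumes "abelian_group G" "x \<in> carrier G" "y \<in> carrier G" "x \<ominus>\<^bsub>G\<^esub> y = \<zero>\<^bsub>G\<^esub>"
  shows "x = y"
proof -
  interpret abelian_group G by fact
  have "x = (x \<ominus>\<^bsub>G\<^esub> y) \<oplus>\<^bsub>G\<^esub> y" using assms(2,3) by (simp add: minus_eq a_assoc l_neg)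
  then show ?thesis using assms by simp
qed

lemma smult_eq_zero:
  assumes "field K" "module K V" "a \<in> carrier K" "v \<in> carrier V" "a \<odot>\<^bsub>V\<^esub> v = \<zero>\<^bsub>V\<^esub>" "v \<noteq> \<zero>\<^bsub>V\<^esub>"
  shows "a = \<zero>\<^bsub>K\<^esub>"
proof (rule ccontr)
  interpret V: module K V by fact
  assume "a \<noteq> \<zero>\<^bsub>K\<^esub>"
  note i = field_inverse[OF assms(1,3) this]
  have "v = inv\<^bsub>K\<^esub> a \<odot>\<^bsub>V\<^esub> (a \<odot>\<^bsub>V\<^esub> v)" using i assms(3,4) by (simp add: V.smult_assoc1[symmetric])
  then show False using assms(5,6) i by simp
qed

section \<open>Separating vectors from subspaces by functionals\<close>

definition adjoin ::
  "('k, 'r) ring_scheme \<Rightarrow> ('k, 'm, 'z) module_scheme \<Rightarrow> 'm set \<Rightarrow> 'm \<Rightarrow> 'm set"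
  where "adjoin K V U x = {u \<oplus>\<^bsub>V\<^esub> a \<odot>\<^bsub>V\<^esub> x |u a. u \<in> U \<and> a \<in> carrier K}"

lemma submodule_extend:
  fixes V (structure)
  assumes "module K V" "submodule U K V" "x \<in> carrier V"
  shows "submodule (adjoin K V U x) K V"
    and "U \<subseteq> adjoin K V U x"
    and "x \<in> adjoin K V U x"
proof -
  interpret module K V by fact
  note Uc = subsetD[OF submodule_subset[OF assms(2)]]
  show UE: "U \<subseteq> adjoin K V U x"
  proof
    fix u assume "u \<in> U"
    then have "u = u \<oplus> \<zero>\<^bsub>K\<^esub> \<odot> x" using Uc assms(3) by simp
    then show "u \<in> adjoin K V U x" using \<open>u \<in> U\<close> unfolding adjoin_def by blast
  qed
  have "x = \<zero> \<oplus> \<one>\<^bsub>K\<^esub> \<odot> x" using assms(3) by simp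
  then show "x \<in> adjoin K V U x" using submodule_zero[OF assms(2)] unfolding adjoin_def by blast
  show "submodule (adjoin K V U x) K V"
  proof (rule submoduleI'[OF assms(1)])
    show "adjoin K V U x \<subseteq> carrier V" using Uc assms(3) by (auto simp: adjoin_def)
    show "\<zero> \<in> adjoin K V U x" using UE submodule_zero[OF assms(2)] unfolding adjoin_def by blast
    fix p assume "p \<in> adjoin K V U x"
    then obtain u a where p: "u \<in> U" "a \<in> carrier K" "p = u \<oplus> a \<odot> x" unfolding adjoin_def by blast
    show "p \<oplus> q \<in> adjoin K V U x" if "q \<in> adjoin K V U x" for q
    proof -
      obtain w b where q: "w \<in> U" "b \<in> carrier K" "q = w \<oplus> b \<odot> x" using \<open>q \<in> adjoin K V U x\<close> unfolding adjoin_def by blast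
      have "p \<oplus> q = (u \<oplus> w) \<oplus> (a \<oplus>\<^bsub>K\<^esub> b) \<odot> x"
        using p q Uc assms(3) by (simp add: smult_l_distr M.a_assoc M.a_lcomm)
      then show ?thesis using p q submodule_add[OF assms(2)] unfolding adjoin_def by blast
    qed
    show "c \<odot> p \<in> adjoin K V U x" if c: "c \<in> carrier K" for c
    proof -
      have "c \<odot> p = (c \<odot> u) \<oplus> (c \<otimes>\<^bsub>K\<^esub> a) \<odot> x"
        using p c Uc assms(3) by (simp add: smult_r_distr smult_assoc1)
      then show ?thesis using p c submodule_smult[OF assms(2)] unfolding adjoin_def by blast
    qed
  qed
qed

text \<open>A submodule \<open>U\<close> that is maximal among those containing \<open>W\<close> and
  missing \<open>v\<close> is a complement of the line through \<open>v\<close>. The functional is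
  the coefficient of \<open>v\<close> in this decomposition, so it vanishes on \<open>U\<close> and
  hence on \<open>W\<close>.\<close>

lemma dual_separates:
  fixes V (structure)
  assumes "field K" "module K V" "submodule W K V" "v \<in> carrier V" "v \<notin> W"
  obtains f where "f \<in> dual K V" "\<And>w. w \<in> W \<Longrightarrow> f w = \<zero>\<^bsub>K\<^esub>" "f v = \<one>\<^bsub>K\<^esub>"
proof -
  interpret K: field K by fact
  interpret module K V by fact
  define A where "A = {U. submodule U K V \<and> W \<subseteq> U \<and> v \<notin> U}"
  have "\<exists>U\<in>A. \<forall>X\<in>A. U \<subseteq> X \<longrightarrow> X = U"
  proof (rule subset_Zorn_nonempty)
    show "A \<noteq> {}" using assms A_def by auto
    fix C assume C: "C \<noteq> {}" "subset.chain A C"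
    have CA: "C \<subseteq> A" and lin: "\<And>X Y. X \<in> C \<Longrightarrow> Y \<in> C \<Longrightarrow> X \<subseteq> Y \<or> Y \<subseteq> X"
      using C(2) by (auto simp: subset_chain_def)
    have CS: "\<And>X. X \<in> C \<Longrightarrow> submodule X K V" using CA by (auto simp: A_def)
    have "submodule (\<Union>C) K V"
    proof (rule submoduleI'[OF assms(2)])
      show "\<Union>C \<subseteq> carrier V" using submodule_subset[OF CS] by blast
      show "\<zero> \<in> \<Union>C" using C(1) submodule_zero[OF CS] by blast
      fix a b assume "a \<in> \<Union>C" "b \<in> \<Union>C"
      then obtain X where "X \<in> C" "a \<in> X" "b \<in> X" using lin by blast
      then show "a \<oplus> b \<in> \<Union>C" using submodule_add[OF CS] by blast
    next
      fix c a assume "c \<in> carrier K" "a \<in> \<Union>C"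
      then show "c \<odot> a \<in> \<Union>C" using submodule_smult[OF CS] by blast
    qed
    then show "\<Union>C \<in> A" using C(1) CA by (auto simp: A_def)
  qed
  then obtain U where UA: "U \<in> A" and "\<forall>X\<in>A. U \<subseteq> X \<longrightarrow> X = U" by (rule bexE)
  note max = this(2)[rule_format]
  have U: "submodule U K V" "W \<subseteq> U" "v \<notin> U" using UA by (auto simp: A_def)
  note Uc = subsetD[OF submodule_subset[OF U(1)]]
  \<comment> \<open>\<open>R x c\<close> says that \<open>c\<close> is the coefficient of
    \<open>v\<close> in \<open>x\<close> modulo \<open>U\<close>. It starts as a relation because
    existence and uniqueness have separate reasons: maximality of \<open>U\<close>, and
    \<open>v \<notin> U\<close>.\<close>
  define R where "R x c \<longleftrightarrow> c \<in> carrier K \<and> (\<exists>u\<in>U. x = u \<oplus> c \<odot> v)" for x c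
  have ex: "\<exists>c. R x c" if x: "x \<in> carrier V" for x
  proof (cases "x \<in> U")
    case True
    then have "x = x \<oplus> \<zero>\<^bsub>K\<^esub> \<odot> v" using x assms(4) by simp
    then show ?thesis unfolding R_def using True by blast
  next
    case False
    note ext = submodule_extend[OF assms(2) U(1) x]
    \<comment> \<open>Enlarging \<open>U\<close> by \<open>x\<close> must capture \<open>v\<close>,
      or \<open>U\<close> would not be maximal. The coefficient of \<open>x\<close> is then nonzero,
      and the equation for \<open>v\<close> can be solved for \<open>x\<close>.\<close>
    have "v \<in> adjoin K V U x"
    proof (rule ccontr)
      assume n: "v \<notin> adjoin K V U x"
      have "adjoin K V U x = U"
        by (rule max[OF _ ext(2)]) (use ext(1,2) n U(2) in \<open>simp add: A_def\<close>)
      then show False using ext(3) False by blast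
    qed
    then obtain u a where ua: "u \<in> U" "a \<in> carrier K" "v = u \<oplus> a \<odot> x" unfolding adjoin_def by blast
    have "a \<noteq> \<zero>\<^bsub>K\<^esub>" using ua U(3) Uc x by auto
    note ia = field_inverse[OF assms(1) ua(2) this]
    define w where "w = \<ominus> (inv\<^bsub>K\<^esub> a \<odot> u)"
    have w: "w \<in> U" unfolding w_def using U(1) ia ua by (simp add: submoduleE(3)[OF U(1)] submodule_smult[OF U(1)])
    have "inv\<^bsub>K\<^esub> a \<odot> v = inv\<^bsub>K\<^esub> a \<odot> u \<oplus> x"
      using ua ia x Uc by (simp add: smult_r_distr smult_assoc1[symmetric])
    then have "x = w \<oplus> inv\<^bsub>K\<^esub> a \<odot> v"
      unfolding w_def using ua ia x Uc by (simp add: M.a_assoc[symmetric] M.l_neg)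
    then show ?thesis unfolding R_def using w ia by blast
  qed
  have un: "c = d" if R: "R x c" "R x d" for x c d
  proof (rule ccontr)
    assume "c \<noteq> d"
    obtain u w where uw: "c \<in> carrier K" "d \<in> carrier K" "u \<in> U" "w \<in> U"
      "u \<oplus> c \<odot> v = w \<oplus> d \<odot> v" using R unfolding R_def by auto
    \<comment> \<open>Cancelling \<open>d \<odot> v\<close> leaves
      \<open>e \<odot> v \<in> U\<close> with \<open>e\<close> invertible, which would put
      \<open>v\<close> into \<open>U\<close>.\<close>
    define e where "e = c \<ominus>\<^bsub>K\<^esub> d"
    have e: "e \<in> carrier K" "e \<noteq> \<zero>\<^bsub>K\<^esub>"
      using uw \<open>c \<noteq> d\<close> minus_zero_imp_eq[OF K.is_abelian_group, of c d] by (auto simp: e_def)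
    note ie = field_inverse[OF assms(1) e]
    have "c = e \<oplus>\<^bsub>K\<^esub> d" using uw by (simp add: e_def K.minus_eq K.a_assoc K.l_neg)
    then have "(u \<oplus> e \<odot> v) \<oplus> d \<odot> v = w \<oplus> d \<odot> v"
      using uw(5) e uw(1-4) assms(4) Uc by (simp add: smult_l_distr M.a_assoc)
    then have "u \<oplus> e \<odot> v = w" using e uw(1-4) assms(4) Uc by simp
    then have "e \<odot> v = w \<ominus> u"
      using e uw(1-4) assms(4) Uc by (metis M.add.inv_solve_left M.add.m_comm M.minus_eq M.a_inv_closed smult_closed)
    then have "e \<odot> v \<in> U" using submodule_minus[OF assms(2) U(1)] uw by simp
    then have "inv\<^bsub>K\<^esub> e \<odot> (e \<odot> v) \<in> U" using submodule_smult[OF U(1)] ie by simp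
    then show False using U(3) ie e assms(4) by (simp add: smult_assoc1[symmetric])
  qed
  define f where "f x = (THE c. R x c)" for x
  have f: "f x = c" if "R x c" for x c unfolding f_def using that un by blast
  have Rf: "R x (f x)" if "x \<in> carrier V" for x using ex[OF that] f by force
  have lin: "f \<in> dual K V"
  proof (rule linI)
    fix x assume x: "x \<in> carrier V"
    show "f x \<in> carrier (ground_module K)" using Rf[OF x] by (simp add: R_def)
    obtain u where u: "u \<in> U" "f x \<in> carrier K" "x = u \<oplus> f x \<odot> v"
      using Rf[OF x] unfolding R_def by blast
    show "f (x \<oplus> y) = f x \<oplus>\<^bsub>ground_module K\<^esub> f y" if y: "y \<in> carrier V" for y
    proof -
      obtain w where w: "w \<in> U" "f y \<in> carrier K" "y = w \<oplus> f y \<odot> v"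
        using Rf[OF y] unfolding R_def by blast
      have "x \<oplus> y = (u \<oplus> f x \<odot> v) \<oplus> (w \<oplus> f y \<odot> v)" using u(3) w(3) by simp
      also have "\<dots> = (u \<oplus> w) \<oplus> (f x \<oplus>\<^bsub>K\<^esub> f y) \<odot> v"
        using u(1,2) w(1,2) Uc assms(4) by (simp add: smult_l_distr M.a_assoc M.a_lcomm)
      finally have "R (x \<oplus> y) (f x \<oplus>\<^bsub>K\<^esub> f y)"
        unfolding R_def using u w submodule_add[OF U(1)] by blast
      then show ?thesis using f by simp
    qed
    show "f (c \<odot> x) = c \<odot>\<^bsub>ground_module K\<^esub> f x" if c: "c \<in> carrier K" for c
    proof -
      have "c \<odot> x = c \<odot> (u \<oplus> f x \<odot> v)" using u(3) by simp
      also have "\<dots> = c \<odot> u \<oplus> (c \<otimes>\<^bsub>K\<^esub> f x) \<odot> v"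
        using u(1,2) Uc assms(4) c by (simp add: smult_r_distr smult_assoc1)
      finally have "R (c \<odot> x) (c \<otimes>\<^bsub>K\<^esub> f x)"
        unfolding R_def using u c submodule_smult[OF U(1)] by blast
      then show ?thesis using f by simp
    qed
  qed
  have "R w \<zero>\<^bsub>K\<^esub>" if "w \<in> W" for w
  proof -
    have "w = w \<oplus> \<zero>\<^bsub>K\<^esub> \<odot> v" "w \<in> U" using that U Uc assms(4) by auto
    then show ?thesis unfolding R_def by blast
  qed
  moreover have "R v \<one>\<^bsub>K\<^esub>"
    unfolding R_def using assms(4) submodule_zero[OF U(1)] by (auto intro!: bexI[of _ "\<zero>"])
  ultimately show thesis using that lin f by blast
qed

section \<open>Spans and minimal members of families of subspaces\<close>

definition lin_span ::
  "('k, 'r) ring_scheme \<Rightarrow> ('k, 'm, 'z) module_scheme \<Rightarrow> 'm set \<Rightarrow> 'm set"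
  where "lin_span K V X = \<Inter>{W. submodule W K V \<and> X \<subseteq> W}"

lemma lin_span_submodule:
  assumes "module K V" "X \<subseteq> carrier V" shows "submodule (lin_span K V X) K V"
  unfolding lin_span_def
proof (rule submoduleI'[OF assms(1)])
  show "\<Inter> {W. submodule W K V \<and> X \<subseteq> W} \<subseteq> carrier V"
    using module.carrier_is_submodule[OF assms(1)] assms(2) by blast
qed (auto simp: submodule_zero submodule_add submodule_smult)

lemma lin_span_incl: "X \<subseteq> lin_span K V X"
  unfolding lin_span_def by blast

lemma lin_span_least: "\<lbrakk>submodule W K V; X \<subseteq> W\<rbrakk> \<Longrightarrow> lin_span K V X \<subseteq> W"
  unfolding lin_span_def by blast

lemma lin_span_insert:
  assumes "module K V" "X \<subseteq> carrier V" "x \<in> carrier V" "v \<in> lin_span K V (insert x X)"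
  shows "\<exists>u\<in>lin_span K V X. \<exists>a\<in>carrier K. v = u \<oplus>\<^bsub>V\<^esub> a \<odot>\<^bsub>V\<^esub> x"
proof -
  note ext = submodule_extend[OF assms(1) lin_span_submodule[OF assms(1,2)] assms(3)]
  have "lin_span K V (insert x X) \<subseteq> adjoin K V (lin_span K V X) x"
    using ext lin_span_incl[of X K V] by (intro lin_span_least) blast+
  then show ?thesis using assms(4) unfolding adjoin_def by blast
qed

text \<open>Subspaces of a finite-dimensional space satisfy the minimum condition. The proof is an
  induction on the spanning set instead of a count of dimensions. Subcomodules and subcoalgebras are
  both treated with it.\<close>

lemma finite_span_minimal:
  fixes V (structure)
  assumes "field K" "module K V" "finite X" "X \<subseteq> carrier V"
    and "\<F> \<noteq> {}" "\<And>W. W \<in> \<F> \<Longrightarrow> submodule W K V \<and> W \<subseteq> lin_span K V X"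
  shows "\<exists>W\<in>\<F>. \<forall>W'\<in>\<F>. W' \<subseteq> W \<longrightarrow> W' = W"
  using assms(3-)
proof (induction X arbitrary: \<F> rule: finite_induct)
  case empty
  interpret module K V by fact
  have "submodule {\<zero>} K V" by (rule submoduleI'[OF assms(2)]) auto
  then have "lin_span K V {} \<subseteq> {\<zero>}" by (rule lin_span_least) simp
  then have "W = {\<zero>}" if "W \<in> \<F>" for W using empty(3)[OF that] submodule_zero[of W K V] by blast
  then show ?case using empty(2) by blast
next
  case (insert x X)
  interpret K: field K by fact
  interpret module K V by fact
  let ?S = "lin_span K V X"
  have xX: "x \<in> carrier V" "X \<subseteq> carrier V" using insert.prems by auto
  have S: "submodule ?S K V" using lin_span_submodule assms(2) xX by blast
  note Sc = subsetD[OF submodule_subset[OF S]]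
  \<comment> \<open>The trace on the span of \<open>X\<close> is minimised first; beyond its trace a
    member can contain at most one further dimension, in the direction of \<open>x\<close>.\<close>
  have "\<exists>W\<in>(\<lambda>W. W \<inter> ?S) ` \<F>. \<forall>W'\<in>(\<lambda>W. W \<inter> ?S) ` \<F>. W' \<subseteq> W \<longrightarrow> W' = W"
  proof (rule insert.IH[OF xX(2)])
    fix U assume "U \<in> (\<lambda>W. W \<inter> ?S) ` \<F>"
    then obtain W where W: "submodule W K V" "U = W \<inter> ?S" using insert.prems by blast
    have "submodule U K V" unfolding W(2)
      by (rule submoduleI'[OF assms(2)])
        (use submodule_subset[OF W(1)] in \<open>auto simp: submodule_zero[OF W(1)] submodule_zero[OF S]
          submodule_add[OF W(1)] submodule_add[OF S] submodule_smult[OF W(1)] submodule_smult[OF S]\<close>)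
    then show "submodule U K V \<and> U \<subseteq> ?S" using W by blast
  qed (use insert.prems in auto)
  then have "\<exists>W\<in>\<F>. \<forall>W'\<in>\<F>. W' \<inter> ?S \<subseteq> W \<inter> ?S \<longrightarrow> W' \<inter> ?S = W \<inter> ?S"
    by (simp only: bex_simps ball_simps)
  then obtain W1 where W1: "W1 \<in> \<F>"
    and "\<forall>W'\<in>\<F>. W' \<inter> ?S \<subseteq> W1 \<inter> ?S \<longrightarrow> W' \<inter> ?S = W1 \<inter> ?S" by (rule bexE)
  note min = this(2)[rule_format]
  \<comment> \<open>If some member with the minimal trace lies inside \<open>?S\<close>, it equals
    its trace and is minimal. Otherwise every member with this trace has a vector outside
    \<open>?S\<close>, and then \<open>W1\<close> itself is minimal.\<close>
  show ?case
  proof (cases "\<exists>W\<in>\<F>. W \<inter> ?S = W1 \<inter> ?S \<and> W \<subseteq> ?S")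
    case True
    then obtain W where W: "W \<in> \<F>" "W \<inter> ?S = W1 \<inter> ?S" "W \<subseteq> ?S" by blast
    have "W' = W" if W': "W' \<in> \<F>" "W' \<subseteq> W" for W'
    proof -
      have "W' \<inter> ?S = W1 \<inter> ?S" using W' W by (intro min) auto
      then show ?thesis using W' W by auto
    qed
    then show ?thesis by (intro bexI[OF _ W(1)] ballI impI)
  next
    case False
    have "W' = W1" if W': "W' \<in> \<F>" "W' \<subseteq> W1" for W'
    proof
      have eq: "W' \<inter> ?S = W1 \<inter> ?S" using W' by (intro min) auto
      then obtain z where z: "z \<in> W'" "z \<notin> ?S" using False W' by blast
      have sW: "submodule W' K V" "submodule W1 K V" using insert.prems W' W1 by auto
      note cW = subsetD[OF submodule_subset[OF sW(1)]] subsetD[OF submodule_subset[OF sW(2)]]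
      obtain u a where ua: "u \<in> ?S" "a \<in> carrier K" "z = u \<oplus> a \<odot> x"
        using lin_span_insert[OF assms(2) xX(2,1)] z insert.prems W' by blast
      have "a \<noteq> \<zero>\<^bsub>K\<^esub>" using ua z Sc xX by auto
      note ia = field_inverse[OF assms(1) ua(2) this]
      show "W1 \<subseteq> W'"
      proof
        fix y assume y: "y \<in> W1"
        obtain w b where wb: "w \<in> ?S" "b \<in> carrier K" "y = w \<oplus> b \<odot> x"
          using lin_span_insert[OF assms(2) xX(2,1)] y insert.prems W1 by blast
        \<comment> \<open>\<open>c\<close> is chosen so that \<open>y\<close> and
          \<open>c \<odot> z\<close> have the same \<open>x\<close>-coefficient \<open>b\<close>.
          Their difference lies in \<open>?S\<close> and in \<open>W1\<close>, hence in
          \<open>W'\<close>, because the two traces agree.\<close>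
        define c where "c = b \<otimes>\<^bsub>K\<^esub> inv\<^bsub>K\<^esub> a"
        have c: "c \<in> carrier K" "c \<otimes>\<^bsub>K\<^esub> a = b" using ia wb ua by (auto simp: c_def K.m_assoc)
        have cz: "c \<odot> z = c \<odot> u \<oplus> b \<odot> x"
          using ua c Sc xX by (simp add: smult_r_distr smult_assoc1[symmetric])
        have d: "y = (w \<ominus> c \<odot> u) \<oplus> c \<odot> z"
          unfolding cz using wb ua c Sc xX
          by (simp add: M.minus_eq M.a_assoc M.a_lcomm[of "\<ominus> (c \<odot> u)"] M.r_neg1 M.r_neg2)
        have wS: "w \<ominus> c \<odot> u \<in> ?S"
          using submodule_minus[OF assms(2) S] submodule_smult[OF S] wb ua c by blast
        have czW: "c \<odot> z \<in> W'" using submodule_smult[OF sW(1)] c z by blast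
        then have czW1: "c \<odot> z \<in> W1" using W' by blast
        have "w \<ominus> c \<odot> u = y \<ominus> c \<odot> z"
          using d Sc[OF wS] cW(2)[OF czW1] by (simp add: M.minus_eq M.a_assoc M.r_neg)
        then have "w \<ominus> c \<odot> u \<in> W1"
          using submodule_minus[OF assms(2) sW(2) y czW1] by simp
        then have "w \<ominus> c \<odot> u \<in> W'" using eq wS by blast
        then show "y \<in> W'" by (subst d) (rule submodule_add[OF sW(1) _ czW])
      qed
    qed fact
    then show ?thesis by (intro bexI[OF _ W1] ballI impI)
  qed
qed


section \<open>Contractions and minimal representations of tensors\<close>

text \<open>The map f \<otimes> id, followed by the identification of K \<otimes> N with N.\<close>

definition contract_left ::
  "('k, 'r) ring_scheme \<Rightarrow> ('k, 'n, 'z) module_scheme \<Rightarrow> ('m \<Rightarrow> 'k) \<Rightarrow> ('k, 'm, 'n) tensor \<Rightarrow> 'n"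
  where "contract_left K N f = tensor_lift K N (\<lambda>x y. f x \<odot>\<^bsub>N\<^esub> y)"

definition contract_right ::
  "('k, 'r) ring_scheme \<Rightarrow> ('k, 'm, 'z) module_scheme \<Rightarrow> ('n \<Rightarrow> 'k) \<Rightarrow> ('k, 'm, 'n) tensor \<Rightarrow> 'm"
  where "contract_right K M f = tensor_lift K M (\<lambda>x y. f y \<odot>\<^bsub>M\<^esub> x)"

lemma contract_left_bilinear:
  assumes "module K N" "f \<in> dual K M"
  shows "(\<lambda>x y. f x \<odot>\<^bsub>N\<^esub> y) \<in> bilinear_maps K M N N"
  using assms lin_closed[OF assms(2)]
  by (intro bilinI lin_smult_const lin_smult_fixed) auto

lemma contract_right_bilinear:
  assumes "module K M" "f \<in> dual K N"
  shows "(\<lambda>x y. f y \<odot>\<^bsub>M\<^esub> x) \<in> bilinear_maps K M N M"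
  using assms lin_closed[OF assms(2)]
  by (intro bilinI lin_smult_const lin_smult_fixed) auto

lemma contract_left_linear:
  assumes "module K M" "module K N" "f \<in> dual K M"
  shows "contract_left K N f \<in> linear_maps K (tensor_product K M N) N"
  unfolding contract_left_def using assms by (intro tensor_lift_linear contract_left_bilinear)

lemma contract_right_linear:
  assumes "module K M" "module K N" "f \<in> dual K N"
  shows "contract_right K M f \<in> linear_maps K (tensor_product K M N) M"
  unfolding contract_right_def using assms by (intro tensor_lift_linear contract_right_bilinear)

lemma contract_left_pure:
  assumes "module K M" "module K N" "f \<in> dual K M" "x \<in> carrier M" "y \<in> carrier N"
  shows "contract_left K N f (pure_tensor K M N x y) = f x \<odot>\<^bsub>N\<^esub> y"
  unfolding contract_left_def using assms by (intro tensor_lift_pure contract_left_bilinear)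

lemma contract_right_pure:
  assumes "module K M" "module K N" "f \<in> dual K N" "x \<in> carrier M" "y \<in> carrier N"
  shows "contract_right K M f (pure_tensor K M N x y) = f y \<odot>\<^bsub>M\<^esub> x"
  unfolding contract_right_def using assms by (intro tensor_lift_pure contract_right_bilinear)

section \<open>Tensors as finite sums of pure tensors\<close>

abbreviation (in two_modules) pure_sum where
  "pure_sum I x y \<equiv> \<Oplus>\<^bsub>T\<^esub>i\<in>I. pure_tensor K M N (x i) (y i)"

lemma (in two_modules) tensor_sum_exists:
  assumes "t \<in> carrier T"
  shows "\<exists>(I :: nat set) x y. finite I \<and> x \<in> I \<rightarrow> carrier M \<and> y \<in> I \<rightarrow> carrier N \<and>
    t = pure_sum I x y"
proof -
  define rep where "rep t \<longleftrightarrow> (\<exists>(I :: nat set) x y. finite I \<and> x \<in> I \<rightarrow> carrier M \<and> y \<in> I \<rightarrow> carrier N \<and>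
    t = pure_sum I x y)" for t
  \<comment> \<open>The claim concerns adding \<open>t\<close> to an already represented
    \<open>u\<close>. A pure tensor then costs one fresh index, and the sum case is associativity,
    so no index sets have to be made disjoint.\<close>
  have "\<forall>u\<in>carrier T. rep u \<longrightarrow> rep (t \<oplus>\<^bsub>T\<^esub> u)"
    using assms
  proof (induction t rule: tensor_induct)
    case (pure p q)
    show ?case
    proof (intro ballI impI)
      fix u assume u: "u \<in> carrier T" "rep u"
      then obtain I :: "nat set" and x y where I: "finite I" "x \<in> I \<rightarrow> carrier M" "y \<in> I \<rightarrow> carrier N"
        "u = pure_sum I x y" unfolding rep_def by blast
      obtain k where k: "k \<notin> I" using I(1) ex_new_if_finite infinite_UNIV_nat by blast
      let ?x = "x(k := p)" and ?y = "y(k := q)"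
      have "pure_sum I ?x ?y = u"
        unfolding I(4) by (rule T.finsum_cong') (use I k pure_tensor_closed in \<open>auto simp: Pi_iff\<close>)
      moreover have "(\<lambda>i. pure_tensor K M N (?x i) (?y i)) \<in> I \<rightarrow> carrier T"
        using I(2,3) pure pure_tensor_closed by (auto simp: Pi_iff)
      ultimately have "pure_tensor K M N p q \<oplus>\<^bsub>T\<^esub> u = pure_sum (insert k I) ?x ?y"
        using I(1) k pure pure_tensor_closed by (subst T.finsum_insert) (auto simp: Pi_iff)
      moreover have "finite (insert k I)" "?x \<in> insert k I \<rightarrow> carrier M" "?y \<in> insert k I \<rightarrow> carrier N"
        using I pure by auto
      ultimately show "rep (pure_tensor K M N p q \<oplus>\<^bsub>T\<^esub> u)" unfolding rep_def by blast
    qed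
  next
    case (add t v)
    then show ?case by (simp add: T.a_assoc)
  qed
  moreover have "rep \<zero>\<^bsub>T\<^esub>" unfolding rep_def by (rule exI[of _ "{}"]) simp
  ultimately have "rep t" using assms by (metis T.r_zero T.zero_closed)
  then show ?thesis by (simp only: rep_def)
qed

text \<open>If \<open>x j\<close> depends on the other \<open>x i\<close>, its term can be
  distributed over theirs by changing their right factors. The bilinear map \<open>b\<close> is
  arbitrary so that the argument also applies with the two factors exchanged.\<close>

lemma redundant_summand:
  fixes T (structure)
  assumes "module K M" "module K N" "module K T" "b \<in> bilinear_maps K M N T"
    and I: "finite I" "x \<in> I \<rightarrow> carrier M" "y \<in> I \<rightarrow> carrier N" "j \<in> I"
    and dep: "x j \<in> lin_span K M (x ` (I - {j}))"
  shows "\<exists>z\<in>I - {j} \<rightarrow> carrier N. (\<Oplus>i\<in>I. b (x i) (y i)) = (\<Oplus>i\<in>I - {j}. b (x i) (z i))"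
proof -
  interpret M: module K M by fact
  interpret N: module K N by fact
  interpret T: module K T by fact
  let ?J = "I - {j}"
  let ?S = "\<lambda>z. \<Oplus>i\<in>?J. b (x i) (z i)"
  note br = bilin_right[OF assms(4)] and bl = bilin_left[OF assms(4)]
  note bc = bilin_closed[OF assms(4)]
  have xJ: "i \<in> ?J \<Longrightarrow> x i \<in> carrier M" for i using I(2) by auto
  have fJ: "finite ?J" using I(1) by simp
  \<comment> \<open>The vectors whose product with any \<open>v\<close> can be absorbed by the
    remaining terms. They form a submodule containing the other \<open>x k\<close>, hence also
    \<open>x j\<close>; the coefficients of a linear combination never have to be named.\<close>
  define S where "S = {w \<in> carrier M. \<forall>v\<in>carrier N. \<exists>z\<in>?J \<rightarrow> carrier N. b w v = ?S z}"
  have "submodule S K M"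
  proof (rule submoduleI'[OF assms(1)])
    show "S \<subseteq> carrier M" by (auto simp: S_def)
    have z: "b w \<zero>\<^bsub>N\<^esub> = \<zero>" if "w \<in> carrier M" for w
      using lin_zero[OF assms(2,3) br[OF that]] .
    have "b \<zero>\<^bsub>M\<^esub> v = (\<Oplus>i\<in>?J. b (x i) \<zero>\<^bsub>N\<^esub>)" if "v \<in> carrier N" for v
    proof -
      have "(\<Oplus>i\<in>?J. b (x i) \<zero>\<^bsub>N\<^esub>) = (\<Oplus>i\<in>?J. \<zero>)"
        by (rule T.finsum_cong') (use xJ z in auto)
      then show ?thesis using lin_zero[OF assms(1,3) bl[OF that]] by simp
    qed
    then show "\<zero>\<^bsub>M\<^esub> \<in> S" unfolding S_def by (auto intro!: bexI[of _ "\<lambda>_. \<zero>\<^bsub>N\<^esub>"])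
    fix w assume w: "w \<in> S"
    show "w \<oplus>\<^bsub>M\<^esub> w' \<in> S" if w': "w' \<in> S" for w'
      unfolding S_def
    proof (intro CollectI conjI ballI)
      show "w \<oplus>\<^bsub>M\<^esub> w' \<in> carrier M" using w w' by (auto simp: S_def)
      fix v assume v: "v \<in> carrier N"
      obtain z z' where z: "z \<in> ?J \<rightarrow> carrier N" "b w v = ?S z"
        "z' \<in> ?J \<rightarrow> carrier N" "b w' v = (\<Oplus>i\<in>?J. b (x i) (z' i))"
        using w w' v unfolding S_def by blast
      have "b (w \<oplus>\<^bsub>M\<^esub> w') v = b w v \<oplus> b w' v"
        using lin_add[OF bl[OF v]] w w' by (auto simp: S_def)
      also have "\<dots> = (\<Oplus>i\<in>?J. b (x i) (z i) \<oplus> b (x i) (z' i))"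
        unfolding z(2,4) using z(1,3) xJ bc by (intro T.finsum_addf[symmetric]) (auto simp: Pi_iff)
      also have "\<dots> = (\<Oplus>i\<in>?J. b (x i) (z i \<oplus>\<^bsub>N\<^esub> z' i))"
        by (rule T.finsum_cong') (use z(1,3) xJ bc lin_add[OF br[OF xJ]] in \<open>auto simp: Pi_iff\<close>)
      finally show "\<exists>z\<in>?J \<rightarrow> carrier N. b (w \<oplus>\<^bsub>M\<^esub> w') v = ?S z"
        using z(1,3) by (intro bexI[of _ "\<lambda>i. z i \<oplus>\<^bsub>N\<^esub> z' i"]) (auto simp: Pi_iff)
    qed
    show "c \<odot>\<^bsub>M\<^esub> w \<in> S" if c: "c \<in> carrier K" for c
      unfolding S_def
    proof (intro CollectI conjI ballI)
      show "c \<odot>\<^bsub>M\<^esub> w \<in> carrier M" using w c by (auto simp: S_def)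
      fix v assume v: "v \<in> carrier N"
      obtain z where z: "z \<in> ?J \<rightarrow> carrier N" "b w v = ?S z"
        using w v unfolding S_def by blast
      have "b (c \<odot>\<^bsub>M\<^esub> w) v = c \<odot> b w v"
        using lin_smult[OF bl[OF v]] w c by (auto simp: S_def)
      also have "\<dots> = (\<Oplus>i\<in>?J. c \<odot> b (x i) (z i))"
        unfolding z(2) using z(1) xJ bc fJ c by (intro T.finsum_smult_ldistr) (auto simp: Pi_iff)
      also have "\<dots> = (\<Oplus>i\<in>?J. b (x i) (c \<odot>\<^bsub>N\<^esub> z i))"
        by (rule T.finsum_cong') (use z(1) xJ bc c lin_smult[OF br[OF xJ]] in \<open>auto simp: Pi_iff\<close>)
      finally show "\<exists>z\<in>?J \<rightarrow> carrier N. b (c \<odot>\<^bsub>M\<^esub> w) v = ?S z"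
        using z(1) c by (intro bexI[of _ "\<lambda>i. c \<odot>\<^bsub>N\<^esub> z i"]) (auto simp: Pi_iff)
    qed
  qed
  moreover have "x k \<in> S" if k: "k \<in> ?J" for k
    unfolding S_def
  proof (intro CollectI conjI ballI)
    show "x k \<in> carrier M" using xJ k .
    fix v assume v: "v \<in> carrier N"
    have "(\<Oplus>i\<in>?J. b (x i) (if k = i then v else \<zero>\<^bsub>N\<^esub>)) = (\<Oplus>i\<in>?J. if k = i then b (x i) v else \<zero>)"
      by (rule T.finsum_cong') (use xJ v bc lin_zero[OF assms(2,3) br[OF xJ]] in auto)
    also have "\<dots> = b (x k) v" using k fJ xJ v bc by (intro T.add.finprod_singleton) auto
    finally show "\<exists>z\<in>?J \<rightarrow> carrier N. b (x k) v = ?S z"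
      using v by (intro bexI[of _ "\<lambda>i. if k = i then v else \<zero>\<^bsub>N\<^esub>"]) auto
  qed
  ultimately have "lin_span K M (x ` ?J) \<subseteq> S" by (intro lin_span_least) auto
  then have "x j \<in> S" "y j \<in> carrier N" using dep I by auto
  then obtain z where z: "z \<in> ?J \<rightarrow> carrier N" "b (x j) (y j) = ?S z"
    unfolding S_def by blast
  have yJ: "y \<in> ?J \<rightarrow> carrier N" using I(3) by auto
  have "(\<Oplus>i\<in>insert j ?J. b (x i) (y i)) = b (x j) (y j) \<oplus> (\<Oplus>i\<in>?J. b (x i) (y i))"
    using I fJ bc by (intro T.finsum_insert) (auto simp: Pi_iff)
  also have "\<dots> = (\<Oplus>i\<in>?J. b (x i) (z i) \<oplus> b (x i) (y i))"
    unfolding z(2) using z(1) yJ xJ bc by (intro T.finsum_addf[symmetric]) (auto simp: Pi_iff)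
  also have "\<dots> = (\<Oplus>i\<in>?J. b (x i) (z i \<oplus>\<^bsub>N\<^esub> y i))"
    by (rule T.finsum_cong') (use z(1) yJ xJ bc lin_add[OF br[OF xJ]] in \<open>auto simp: Pi_iff\<close>)
  finally have "(\<Oplus>i\<in>I. b (x i) (y i)) = (\<Oplus>i\<in>?J. b (x i) (z i \<oplus>\<^bsub>N\<^esub> y i))"
    using I(4) by (simp add: insert_absorb)
  then show ?thesis using z(1) yJ by (intro bexI[of _ "\<lambda>i. z i \<oplus>\<^bsub>N\<^esub> y i"]) (auto simp: Pi_iff)
qed


lemma (in two_modules) contract_left_sum:
  assumes "f \<in> dual K M" "finite I" "x \<in> I \<rightarrow> carrier M" "y \<in> I \<rightarrow> carrier N"
  shows "contract_left K N f (pure_sum I x y) = (\<Oplus>\<^bsub>N\<^esub>i\<in>I. f (x i) \<odot>\<^bsub>N\<^esub> y i)"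
proof -
  note lin = contract_left_linear[OF modM modN assms(1)]
  have "contract_left K N f (pure_sum I x y) =
      (\<Oplus>\<^bsub>N\<^esub>i\<in>I. contract_left K N f (pure_tensor K M N (x i) (y i)))"
    by (rule lin_finsum[OF modT modN lin])
      (use assms pure_tensor_closed in \<open>auto simp: Pi_iff\<close>)
  also have "\<dots> = (\<Oplus>\<^bsub>N\<^esub>i\<in>I. f (x i) \<odot>\<^bsub>N\<^esub> y i)"
    by (rule N.finsum_cong')
      (use assms lin_closed[OF assms(1)] in
        \<open>auto simp: Pi_iff contract_left_pure[OF modM modN assms(1)]\<close>)
  finally show ?thesis .
qed

lemma (in two_modules) contract_right_sum:
  assumes "g \<in> dual K N" "finite I" "x \<in> I \<rightarrow> carrier M" "y \<in> I \<rightarrow> carrier N"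
  shows "contract_right K M g (pure_sum I x y) = (\<Oplus>\<^bsub>M\<^esub>i\<in>I. g (y i) \<odot>\<^bsub>M\<^esub> x i)"
proof -
  note lin = contract_right_linear[OF modM modN assms(1)]
  have "contract_right K M g (pure_sum I x y) =
      (\<Oplus>\<^bsub>M\<^esub>i\<in>I. contract_right K M g (pure_tensor K M N (x i) (y i)))"
    by (rule lin_finsum[OF modT modM lin])
      (use assms pure_tensor_closed in \<open>auto simp: Pi_iff\<close>)
  also have "\<dots> = (\<Oplus>\<^bsub>M\<^esub>i\<in>I. g (y i) \<odot>\<^bsub>M\<^esub> x i)"
    by (rule M.finsum_cong')
      (use assms lin_closed[OF assms(1)] in
        \<open>auto simp: Pi_iff contract_right_pure[OF modM modN assms(1)]\<close>)
  finally show ?thesis .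
qed

text \<open>Independence of \<open>x j\<close> from the others gives a functional that is 1 at
  \<open>x j\<close> and 0 at the other \<open>x i\<close>; it picks out one summand.\<close>

lemma dual_basis_sum:
  assumes "field K" "module K M" "module K N" "finite I" "x \<in> I \<rightarrow> carrier M" "y \<in> I \<rightarrow> carrier N"
    and "j \<in> I" "x j \<notin> lin_span K M (x ` (I - {j}))"
  shows "\<exists>f\<in>dual K M. (\<Oplus>\<^bsub>N\<^esub>i\<in>I. f (x i) \<odot>\<^bsub>N\<^esub> y i) = y j"
proof -
  interpret M: module K M by fact
  interpret N: module K N by fact
  have "x ` (I - {j}) \<subseteq> carrier M" "x j \<in> carrier M" using assms by auto
  then obtain f where f: "f \<in> dual K M" "\<And>w. w \<in> lin_span K M (x ` (I - {j})) \<Longrightarrow> f w = \<zero>\<^bsub>K\<^esub>" "f (x j) = \<one>\<^bsub>K\<^esub>"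
    using dual_separates[OF assms(1,2) lin_span_submodule[OF assms(2)] _ assms(8)] by metis
  have f0: "f (x i) = \<zero>\<^bsub>K\<^esub>" if "i \<in> I" "i \<noteq> j" for i
    using that lin_span_incl[of "x ` (I - {j})" K M] by (intro f(2)) auto
  have "(\<Oplus>\<^bsub>N\<^esub>i\<in>I. f (x i) \<odot>\<^bsub>N\<^esub> y i) = (\<Oplus>\<^bsub>N\<^esub>i\<in>I. if j = i then y i else \<zero>\<^bsub>N\<^esub>)"
    by (rule N.finsum_cong') (use assms f(3) f0 in \<open>auto simp: Pi_iff\<close>)
  also have "\<dots> = y j" using assms by (intro N.add.finprod_singleton) auto
  finally show ?thesis using f(1) by blast
qed

text \<open>In a representation of minimal length both families of factors are linearly independent, so
  dual functionals recover each factor from the tensor.\<close>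

lemma (in two_modules) tensor_minimal_sum:
  assumes K: "field K" and t: "t \<in> carrier T"
  obtains I :: "nat set" and x y
  where "finite I" "x \<in> I \<rightarrow> carrier M" "y \<in> I \<rightarrow> carrier N"
    "t = pure_sum I x y"
    "\<forall>i\<in>I. \<exists>g\<in>dual K N. x i = contract_right K M g t"
    "\<forall>i\<in>I. \<exists>f\<in>dual K M. y i = contract_left K N f t"
proof -
  define rep where "rep I x y \<longleftrightarrow> finite I \<and> x \<in> I \<rightarrow> carrier M \<and> y \<in> I \<rightarrow> carrier N \<and>
    t = pure_sum I x y" for I :: "nat set" and x y
  define len where "len n \<longleftrightarrow> (\<exists>I x y. rep I x y \<and> card I = n)" for n
  have "\<exists>n. len n" using tensor_sum_exists[OF t] by (auto simp: len_def rep_def)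
  then obtain n where n: "len n" "\<And>m. m < n \<Longrightarrow> \<not> len m" using exists_least_iff[of len] by blast
  then obtain I x y where r: "rep I x y" "card I = n" by (auto simp: len_def)
  have I: "finite I" "x \<in> I \<rightarrow> carrier M" "y \<in> I \<rightarrow> carrier N"
    "t = pure_sum I x y" using r(1) by (auto simp: rep_def)
  have short: "False" if "rep (I - {j}) x' y'" "j \<in> I" for j x' y'
  proof -
    have "card (I - {j}) < n" using that(2) r(2) I(1) by (metis card_Diff1_less)
    then show False using n(2) that(1) by (auto simp: len_def)
  qed
  \<comment> \<open>With the factors exchanged, \<open>redundant_summand\<close> removes dependent
    right factors too. Dependence on either side would give a representation with fewer than
    \<open>n\<close> indices.\<close>
  have flip: "(\<lambda>y x. pure_tensor K M N x y) \<in> bilinear_maps K N M T"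
  proof (rule bilinI)
    show "(\<lambda>x. pure_tensor K M N x y) \<in> linear_maps K M T" if "y \<in> carrier N" for y
      by (rule bilin_left[OF pure_tensor_bilinear that])
    show "(\<lambda>y. pure_tensor K M N x y) \<in> linear_maps K N T" if "x \<in> carrier M" for x
      by (rule bilin_right[OF pure_tensor_bilinear that])
  qed
  have ix: "x j \<notin> lin_span K M (x ` (I - {j}))" if j: "j \<in> I" for j
  proof
    assume "x j \<in> lin_span K M (x ` (I - {j}))"
    from redundant_summand[OF modM modN modT pure_tensor_bilinear I(1,2,3) j this]
    obtain z where "z \<in> I - {j} \<rightarrow> carrier N" "t = pure_sum (I - {j}) x z"
      by (elim bexE) (rule that, assumption, subst I(4), assumption)
    then have "rep (I - {j}) x z" using I by (auto simp: rep_def)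
    then show False using short j by blast
  qed
  have iy: "y j \<notin> lin_span K N (y ` (I - {j}))" if j: "j \<in> I" for j
  proof
    assume "y j \<in> lin_span K N (y ` (I - {j}))"
    from redundant_summand[OF modN modM modT flip I(1,3,2) j this]
    obtain z where "z \<in> I - {j} \<rightarrow> carrier M" "t = pure_sum (I - {j}) z y"
      by (elim bexE) (rule that, assumption, subst I(4), assumption)
    then have "rep (I - {j}) z y" using I by (auto simp: rep_def)
    then show False using short j by blast
  qed
  have cr: "\<exists>g\<in>dual K N. x i = contract_right K M g t" if i: "i \<in> I" for i
  proof -
    obtain g where g: "g \<in> dual K N" "(\<Oplus>\<^bsub>M\<^esub>k\<in>I. g (y k) \<odot>\<^bsub>M\<^esub> x k) = x i"
      using dual_basis_sum[OF K modN modM I(1,3,2) i iy[OF i]] by blast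
    have "contract_right K M g t = (\<Oplus>\<^bsub>M\<^esub>k\<in>I. g (y k) \<odot>\<^bsub>M\<^esub> x k)"
      by (subst I(4)) (rule contract_right_sum[OF g(1) I(1-3)])
    then show ?thesis using g by (intro bexI[of _ g]) simp_all
  qed
  have cl: "\<exists>f\<in>dual K M. y i = contract_left K N f t" if i: "i \<in> I" for i
  proof -
    obtain f where f: "f \<in> dual K M" "(\<Oplus>\<^bsub>N\<^esub>k\<in>I. f (x k) \<odot>\<^bsub>N\<^esub> y k) = y i"
      using dual_basis_sum[OF K modM modN I(1-3) i ix[OF i]] by blast
    have "contract_left K N f t = (\<Oplus>\<^bsub>N\<^esub>k\<in>I. f (x k) \<odot>\<^bsub>N\<^esub> y k)"
      by (subst I(4)) (rule contract_left_sum[OF f(1) I(1-3)])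
    then show ?thesis using f by (intro bexI[of _ f]) simp_all
  qed
  show thesis by (rule that[OF I]) (rule ballI, erule cr cl)+
qed

section \<open>Membership and equality of tensors tested by contractions\<close>

lemma (in two_modules) tensor_sub_finsum:
  assumes "finite I" "x \<in> I \<rightarrow> X" "y \<in> I \<rightarrow> Y" "X \<subseteq> carrier M" "Y \<subseteq> carrier N"
  shows "pure_sum I x y \<in> tensor_sub K M N X Y"
  using assms(1-3)
proof (induction I rule: finite_induct)
  case empty
  show ?case unfolding tensor_sub_def using generate.one[of "add_monoid T"] by simp
next
  case (insert i I)
  have "pure_tensor K M N (x i) (y i) \<in> tensor_sub K M N X Y"
    unfolding tensor_sub_def by (rule generate.incl) (use insert.prems in auto)
  moreover have "pure_sum I x y \<in> tensor_sub K M N X Y"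
    using insert by auto
  moreover have "pure_sum (insert i I) x y =
      pure_tensor K M N (x i) (y i) \<oplus>\<^bsub>T\<^esub> pure_sum I x y"
    using insert assms(4,5) by (intro T.finsum_insert) (auto simp: Pi_iff subset_iff intro!: pure_tensor_closed)
  ultimately show ?case unfolding tensor_sub_def using generate.eng[of _ "add_monoid T"] by simp
qed

text \<open>In a representation of minimal length the factors are themselves contractions of
  \<open>t\<close>, so the hypotheses place them in \<open>X\<close> and \<open>Y\<close> at
  once.\<close>

lemma (in two_modules) tensor_subI:
  assumes K: "field K" and t: "t \<in> carrier T" and "X \<subseteq> carrier M" "Y \<subseteq> carrier N"
    and "\<And>g. g \<in> dual K N \<Longrightarrow> contract_right K M g t \<in> X"
    and "\<And>f. f \<in> dual K M \<Longrightarrow> contract_left K N f t \<in> Y"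
  shows "t \<in> tensor_sub K M N X Y"
proof -
  obtain I :: "nat set" and x y where I: "finite I" "x \<in> I \<rightarrow> carrier M" "y \<in> I \<rightarrow> carrier N"
    "t = pure_sum I x y"
    "\<forall>i\<in>I. \<exists>g\<in>dual K N. x i = contract_right K M g t"
    "\<forall>i\<in>I. \<exists>f\<in>dual K M. y i = contract_left K N f t"
    by (rule tensor_minimal_sum[OF K t])
  have "x i \<in> X" if "i \<in> I" for i using bspec[OF I(5) that] assms(5) by (elim bexE) simp
  moreover have "y i \<in> Y" if "i \<in> I" for i using bspec[OF I(6) that] assms(6) by (elim bexE) simp
  ultimately show ?thesis by (subst I(4)) (rule tensor_sub_finsum[OF I(1) _ _ assms(3,4)]; simp)
qed

lemma (in two_modules) tensor_subD:
  assumes X: "submodule X K M" and Y: "submodule Y K N" and t: "t \<in> tensor_sub K M N X Y"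
  shows "t \<in> carrier T"
    and "f \<in> dual K M \<Longrightarrow> contract_left K N f t \<in> Y"
    and "g \<in> dual K N \<Longrightarrow> contract_right K M g t \<in> X"
proof -
  note Xc = subsetD[OF submodule_subset[OF X]] and Yc = subsetD[OF submodule_subset[OF Y]]
  have "t \<in> carrier T \<and> (\<forall>f\<in>dual K M. contract_left K N f t \<in> Y) \<and> (\<forall>g\<in>dual K N. contract_right K M g t \<in> X)"
    using t unfolding tensor_sub_def
  proof (induction t rule: generate.induct)
    note lm = modM modN
    have P: "pure_tensor K M N x y \<in> carrier T \<and> (\<forall>f\<in>dual K M. contract_left K N f (pure_tensor K M N x y) \<in> Y) \<and>
      (\<forall>g\<in>dual K N. contract_right K M g (pure_tensor K M N x y) \<in> X)" if "x \<in> X" "y \<in> Y" for x y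
    proof (intro conjI ballI)
      show "pure_tensor K M N x y \<in> carrier T" using that Xc Yc pure_tensor_closed by blast
      fix f assume f: "f \<in> dual K M"
      show "contract_left K N f (pure_tensor K M N x y) \<in> Y"
        using that Xc Yc lin_closed[OF f]
        by (simp add: contract_left_pure[OF lm f] submodule_smult[OF Y])
    next
      fix g assume g: "g \<in> dual K N"
      show "contract_right K M g (pure_tensor K M N x y) \<in> X"
        using that Xc Yc lin_closed[OF g]
        by (simp add: contract_right_pure[OF lm g] submodule_smult[OF X])
    qed
    {
      case one
      then show ?case
        using lin_zero[OF modT modN contract_left_linear[OF lm]]
          lin_zero[OF modT modM contract_right_linear[OF lm]]
        by (simp add: submodule_zero[OF X] submodule_zero[OF Y])
    next
      case (incl h)
      then show ?case using P by auto
    next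
      case (inv h)
      then obtain x y where h: "x \<in> X" "y \<in> Y" "h = pure_tensor K M N x y" by blast
      \<comment> \<open>\<open>generate\<close> is closed under inverses; the sign is moved into the
        left factor, which stays in \<open>X\<close>.\<close>
      have "inv\<^bsub>add_monoid T\<^esub> h = pure_tensor K M N (\<ominus>\<^bsub>M\<^esub> x) y"
        using lin_uminus[OF modM modT bilin_left[OF pure_tensor_bilinear]] h Xc Yc
        by (simp add: a_inv_def)
      then show ?case using P[of "\<ominus>\<^bsub>M\<^esub> x" y] h M.submoduleE(3)[OF X] by simp
    next
      case (eng h1 h2)
      then show ?case
        using lin_add[OF contract_left_linear[OF lm]] lin_add[OF contract_right_linear[OF lm]]
        by (simp add: submodule_add[OF X] submodule_add[OF Y])
    }
  qed
  then show "t \<in> carrier T"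
    and "f \<in> dual K M \<Longrightarrow> contract_left K N f t \<in> Y"
    and "g \<in> dual K N \<Longrightarrow> contract_right K M g t \<in> X" by blast+
qed

text \<open>In a minimal representation of the difference, the right factors are left contractions
  and hence zero. Contracting on one side is thus enough to separate tensors.\<close>

lemma (in two_modules) tensor_eqI:
  assumes K: "field K" and tu: "t \<in> carrier T" "u \<in> carrier T"
    and eq: "\<And>f. f \<in> dual K M \<Longrightarrow> contract_left K N f t = contract_left K N f u"
  shows "t = u"
proof -
  have d: "t \<ominus>\<^bsub>T\<^esub> u \<in> carrier T" using tu by simp
  have z: "contract_left K N f (t \<ominus>\<^bsub>T\<^esub> u) = \<zero>\<^bsub>N\<^esub>" if f: "f \<in> dual K M" for f
    using tu eq[OF f] lin_closed[OF contract_left_linear[OF modM modN f]]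
      lin_minus[OF modT modN contract_left_linear[OF modM modN f]]
    by (simp add: N.minus_eq N.r_neg)
  obtain I :: "nat set" and x y where I: "finite I" "x \<in> I \<rightarrow> carrier M" "y \<in> I \<rightarrow> carrier N"
    "(t \<ominus>\<^bsub>T\<^esub> u) = pure_sum I x y"
    "\<forall>i\<in>I. \<exists>g\<in>dual K N. x i = contract_right K M g (t \<ominus>\<^bsub>T\<^esub> u)"
    "\<forall>i\<in>I. \<exists>f\<in>dual K M. y i = contract_left K N f (t \<ominus>\<^bsub>T\<^esub> u)"
    by (rule tensor_minimal_sum[OF K d])
  have "pure_tensor K M N (x i) (y i) = \<zero>\<^bsub>T\<^esub>" if i: "i \<in> I" for i
  proof -
    have "y i = \<zero>\<^bsub>N\<^esub>" using bspec[OF I(6) i] z by (elim bexE) simp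
    then show ?thesis
      using lin_zero[OF modN modT bilin_right[OF pure_tensor_bilinear]] I(2) i by auto
  qed
  then have "t \<ominus>\<^bsub>T\<^esub> u = (\<Oplus>\<^bsub>T\<^esub>i\<in>I. \<zero>\<^bsub>T\<^esub>)" by (subst I(4)) (intro T.finsum_cong', auto)
  then have "t \<ominus>\<^bsub>T\<^esub> u = \<zero>\<^bsub>T\<^esub>" by simp
  then show ?thesis using tu minus_zero_imp_eq[OF T.abelian_group_axioms] by blast
qed

text \<open>The source of local finiteness of comodules. Applied to a coaction, \<open>Y\<close>
  spans the orbit of a vector, and \<open>X\<close> bounds what a functional has to see: if it
  vanishes on \<open>X\<close>, it kills the vector.\<close>

lemma (in two_modules) contract_finite:
  assumes K: "field K" and t: "t \<in> carrier T"
  shows "\<exists>X Y. finite X \<and> X \<subseteq> carrier M \<and> finite Y \<and> Y \<subseteq> carrier N \<and>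
    (\<forall>f\<in>dual K M. contract_left K N f t \<in> lin_span K N Y) \<and>
    (\<forall>f\<in>dual K M. (\<forall>x\<in>X. f x = \<zero>) \<longrightarrow> contract_left K N f t = \<zero>\<^bsub>N\<^esub>) \<and>
    (\<forall>y\<in>Y. \<exists>f\<in>dual K M. y = contract_left K N f t)"
proof -
  obtain I :: "nat set" and x y where I: "finite I" "x \<in> I \<rightarrow> carrier M" "y \<in> I \<rightarrow> carrier N"
    "t = pure_sum I x y"
    "\<forall>i\<in>I. \<exists>g\<in>dual K N. x i = contract_right K M g t"
    "\<forall>i\<in>I. \<exists>f\<in>dual K M. y i = contract_left K N f t"
    by (rule tensor_minimal_sum[OF K t])
  have sum: "contract_left K N f t = (\<Oplus>\<^bsub>N\<^esub>i\<in>I. f (x i) \<odot>\<^bsub>N\<^esub> y i)" if "f \<in> dual K M" for f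
    using contract_left_sum[OF that I(1-3)] I(4) by simp
  have Y: "y ` I \<subseteq> carrier N" using I by auto
  note S = lin_span_submodule[OF modN Y]
  have "contract_left K N f t \<in> lin_span K N (y ` I)" if f: "f \<in> dual K M" for f
    unfolding sum[OF f]
  proof (rule submodule_finsum[OF modN S I(1)])
    show "(\<lambda>i. f (x i) \<odot>\<^bsub>N\<^esub> y i) \<in> I \<rightarrow> lin_span K N (y ` I)"
      using lin_closed[OF f] I(2) lin_span_incl[of "y ` I" K N]
      by (auto intro!: submodule_smult[OF S])
  qed
  moreover have "contract_left K N f t = \<zero>\<^bsub>N\<^esub>" if f: "f \<in> dual K M" "\<forall>x\<in>x ` I. f x = \<zero>" for f
  proof -
    have "contract_left K N f t = (\<Oplus>\<^bsub>N\<^esub>i\<in>I. \<zero>\<^bsub>N\<^esub>)"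
      unfolding sum[OF f(1)] by (rule N.finsum_cong') (use f(2) I(3) in \<open>auto simp: Pi_iff\<close>)
    then show ?thesis by simp
  qed
  ultimately show ?thesis using I(1,2,6) Y by (intro exI[of _ "x ` I"] exI[of _ "y ` I"] conjI) auto
qed

section \<open>Maps between tensor products\<close>

lemma tensor_module: "\<lbrakk>module K M; module K N\<rbrakk> \<Longrightarrow> module K (tensor_product K M N)"
  by (rule two_modules.modT) (simp add: two_modules_def)

lemma pure_closed:
  "\<lbrakk>module K M; module K N; x \<in> carrier M; y \<in> carrier N\<rbrakk>
    \<Longrightarrow> pure_tensor K M N x y \<in> carrier (tensor_product K M N)"
  by (rule two_modules.pure_tensor_closed) (simp_all add: two_modules_def)

lemma pure_bilinear:
  "\<lbrakk>module K M; module K N\<rbrakk> \<Longrightarrow> pure_tensor K M N \<in> bilinear_maps K M N (tensor_product K M N)"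
  by (rule two_modules.pure_tensor_bilinear) (simp add: two_modules_def)

text \<open>Membership in \<open>linear_maps\<close> depends on the values on the carrier, and that
  is where lifts are known.\<close>

lemma lin_cong:
  assumes "module K M" "g \<in> linear_maps K M N" "\<And>x. x \<in> carrier M \<Longrightarrow> f x = g x"
  shows "f \<in> linear_maps K M N"
proof -
  interpret module K M by fact
  show ?thesis
    by (rule linI)
      (simp_all add: assms(3) lin_closed[OF assms(2)] lin_add[OF assms(2)]
        lin_smult[OF assms(2)])
qed

text \<open>\<open>tensor_assoc\<close> and \<open>tensor_pairing\<close> nest one lift inside
  another. The outer lift requires a bilinear map, hence linearity of the inner lift in the
  variables that it treats as parameters.\<close>

lemma tensor_lift_param:
  assumes "module K X" "module K M" "module K N" "module K P"
    and b: "\<And>x. x \<in> carrier X \<Longrightarrow> b x \<in> bilinear_maps K M N P"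
    and l: "\<And>y z. \<lbrakk>y \<in> carrier M; z \<in> carrier N\<rbrakk> \<Longrightarrow> (\<lambda>x. b x y z) \<in> linear_maps K X P"
    and u: "u \<in> carrier (tensor_product K M N)"
  shows "(\<lambda>x. tensor_lift K P (b x) u) \<in> linear_maps K X P"
proof -
  interpret two_modules K M N using assms by (simp add: two_modules_def)
  from u show ?thesis
  proof (induction u rule: tensor_induct)
    case (pure y z)
    show ?case
      by (rule lin_cong[OF assms(1) l[OF pure]]) (rule tensor_lift_pure[OF assms(2-4) b pure])
  next
    case (add t u)
    show ?case
      by (rule lin_cong[OF assms(1) lin_plus[OF assms(1,4) add.IH]])
        (rule lin_add[OF tensor_lift_linear[OF assms(2-4) b] add.hyps])
  qed
qed

lemma tensor_map_bilinear:
  assumes "module K P" "module K Q" "f \<in> linear_maps K M P" "g \<in> linear_maps K N Q"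
  shows "(\<lambda>x y. pure_tensor K P Q (f x) (g y)) \<in> bilinear_maps K M N (tensor_product K P Q)"
  by (rule bilin_precomp[OF pure_bilinear[OF assms(1,2)] assms(3,4)])

lemma tensor_map_linear:
  assumes "module K M" "module K N" "module K P" "module K Q"
    "f \<in> linear_maps K M P" "g \<in> linear_maps K N Q"
  shows "tensor_map K P Q f g \<in> linear_maps K (tensor_product K M N) (tensor_product K P Q)"
  unfolding tensor_map_def
  by (rule tensor_lift_linear[OF assms(1,2) tensor_module[OF assms(3,4)] tensor_map_bilinear[OF assms(3-6)]])

lemma tensor_map_pure:
  assumes "module K M" "module K N" "module K P" "module K Q"
    "f \<in> linear_maps K M P" "g \<in> linear_maps K N Q" "x \<in> carrier M" "y \<in> carrier N"
  shows "tensor_map K P Q f g (pure_tensor K M N x y) = pure_tensor K P Q (f x) (g y)"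
  unfolding tensor_map_def
  by (rule tensor_lift_pure[OF assms(1,2) tensor_module[OF assms(3,4)] tensor_map_bilinear[OF assms(3-6)] assms(7,8)])

lemma tensor_map_comp:
  assumes "module K M" "module K N" "module K P" "module K Q" "module K R" "module K S"
    and "f \<in> linear_maps K M P" "g \<in> linear_maps K N Q"
    and "f' \<in> linear_maps K P R" "g' \<in> linear_maps K Q S"
    and "t \<in> carrier (tensor_product K M N)"
  shows "tensor_map K R S f' g' (tensor_map K P Q f g t) = tensor_map K R S (\<lambda>x. f' (f x)) (\<lambda>y. g' (g y)) t"
proof (rule tensor_linear_eqI[OF assms(1,2) tensor_module[OF assms(5,6)] _ _ _ assms(11)])
  note c = lin_comp[OF assms(7,9)] lin_comp[OF assms(8,10)]
  note m1 = tensor_map_linear[OF assms(1-4,7,8)] and m2 = tensor_map_linear[OF assms(3-6,9,10)]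
  show "(\<lambda>t. tensor_map K R S f' g' (tensor_map K P Q f g t)) \<in> linear_maps K (tensor_product K M N) (tensor_product K R S)"
    by (rule lin_comp[OF m1 m2])
  show "tensor_map K R S (\<lambda>x. f' (f x)) (\<lambda>y. g' (g y)) \<in> linear_maps K (tensor_product K M N) (tensor_product K R S)"
    by (rule tensor_map_linear[OF assms(1,2,5,6) c])
  fix x y assume xy: "x \<in> carrier M" "y \<in> carrier N"
  have fg: "f x \<in> carrier P" "g y \<in> carrier Q"
    using lin_closed[OF assms(7) xy(1)] lin_closed[OF assms(8) xy(2)] .
  show "tensor_map K R S f' g' (tensor_map K P Q f g (pure_tensor K M N x y)) =
      tensor_map K R S (\<lambda>x. f' (f x)) (\<lambda>y. g' (g y)) (pure_tensor K M N x y)"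
    by (simp only: tensor_map_pure[OF assms(1-4,7,8) xy] tensor_map_pure[OF assms(3-6,9,10) fg]
        tensor_map_pure[OF assms(1,2,5,6) c xy])
qed

text \<open>\<open>f\<close> and \<open>g\<close> agree with the identity on the carrier, though
  perhaps not outside it; an instance is multiplication by a grouplike element followed by
  multiplication by its inverse.\<close>

lemma tensor_map_id:
  assumes "module K M" "module K N" "f \<in> linear_maps K M M" "g \<in> linear_maps K N N"
    and "\<And>x. x \<in> carrier M \<Longrightarrow> f x = x" "\<And>y. y \<in> carrier N \<Longrightarrow> g y = y"
    and "t \<in> carrier (tensor_product K M N)"
  shows "tensor_map K M N f g t = t"
proof (rule tensor_linear_eqI[OF assms(1,2) tensor_module[OF assms(1,2)] _ lin_id _ assms(7)])
  show "tensor_map K M N f g \<in> linear_maps K (tensor_product K M N) (tensor_product K M N)"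
    by (rule tensor_map_linear[OF assms(1,2,1,2,3,4)])
  fix x y assume xy: "x \<in> carrier M" "y \<in> carrier N"
  show "tensor_map K M N f g (pure_tensor K M N x y) = pure_tensor K M N x y"
    using tensor_map_pure[OF assms(1,2,1,2,3,4) xy] assms(5,6) xy by simp
qed

text \<open>Naturality: \<open>f\<close> moves into the functional and \<open>g\<close> comes out.
  For coactions this turns comodule maps into maps commuting with the dual action, and a twisted
  coaction into a translated functional.\<close>

lemma contract_left_tensor_map:
  assumes "module K M" "module K N" "module K P" "module K Q"
    and "f \<in> linear_maps K M P" "g \<in> linear_maps K N Q" "\<phi> \<in> dual K P"
    and "t \<in> carrier (tensor_product K M N)"
  shows "contract_left K Q \<phi> (tensor_map K P Q f g t) = g (contract_left K N (\<lambda>x. \<phi> (f x)) t)"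
proof (rule tensor_linear_eqI[OF assms(1,2,4) _ _ _ assms(8)])
  note pf = lin_comp[OF assms(5,7)]
  note m = tensor_map_linear[OF assms(1-6)]
  show "(\<lambda>t. contract_left K Q \<phi> (tensor_map K P Q f g t)) \<in> linear_maps K (tensor_product K M N) Q"
    by (rule lin_comp[OF m contract_left_linear[OF assms(3,4,7)]])
  show "(\<lambda>t. g (contract_left K N (\<lambda>x. \<phi> (f x)) t)) \<in> linear_maps K (tensor_product K M N) Q"
    by (rule lin_comp[OF contract_left_linear[OF assms(1,2) pf] assms(6)])
  fix x y assume xy: "x \<in> carrier M" "y \<in> carrier N"
  have fg: "f x \<in> carrier P" "g y \<in> carrier Q" "\<phi> (f x) \<in> carrier K"
    using lin_closed[OF assms(5) xy(1)] lin_closed[OF assms(6) xy(2)] lin_closed[OF pf xy(1)] by simp_all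
  show "contract_left K Q \<phi> (tensor_map K P Q f g (pure_tensor K M N x y)) =
      g (contract_left K N (\<lambda>x. \<phi> (f x)) (pure_tensor K M N x y))"
    by (simp only: tensor_map_pure[OF assms(1-6) xy] contract_left_pure[OF assms(3,4,7) fg(1,2)]
        contract_left_pure[OF assms(1,2) pf xy] lin_smult[OF assms(6) fg(3) xy(2)])
qed

text \<open>Both sides are the value of f \<otimes> g at \<open>t\<close>. This links left with
  right contractions, and so matrix coefficients of a comodule with its orbits.\<close>

lemma contract_swap:
  assumes "module K M" "module K N" "f \<in> dual K M" "g \<in> dual K N" "t \<in> carrier (tensor_product K M N)"
  shows "f (contract_right K M g t) = g (contract_left K N f t)"
proof -
  interpret M: module K M by fact
  note ground_mod = ground_module_module[OF M.R.is_cring]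
  show ?thesis
  proof (rule tensor_linear_eqI[OF assms(1,2) ground_mod _ _ _ assms(5)])
    show "(\<lambda>t. f (contract_right K M g t)) \<in> linear_maps K (tensor_product K M N) (ground_module K)"
      by (rule lin_comp[OF contract_right_linear[OF assms(1,2,4)] assms(3)])
    show "(\<lambda>t. g (contract_left K N f t)) \<in> linear_maps K (tensor_product K M N) (ground_module K)"
      by (rule lin_comp[OF contract_left_linear[OF assms(1,2,3)] assms(4)])
    fix x y assume xy: "x \<in> carrier M" "y \<in> carrier N"
    have "f x \<in> carrier K" "g y \<in> carrier K"
      using lin_closed[OF assms(3) xy(1)] lin_closed[OF assms(4) xy(2)] by simp_all
    then show "f (contract_right K M g (pure_tensor K M N x y)) = g (contract_left K N f (pure_tensor K M N x y))"
      using lin_smult[OF assms(3) _ xy(1)] lin_smult[OF assms(4) _ xy(2)]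
      by (simp add: contract_left_pure[OF assms(1-3) xy] contract_right_pure[OF assms(1,2,4) xy] M.R.m_comm)
  qed
qed

text \<open>The single form f + c g yields sums, multiples and differences of functionals, so one
  formula serves for all of them.\<close>

lemma contract_left_combination:
  assumes "module K M" "module K N" "f \<in> dual K M" "g \<in> dual K M" "c \<in> carrier K"
    and "t \<in> carrier (tensor_product K M N)"
  shows "(\<lambda>x. f x \<oplus>\<^bsub>K\<^esub> c \<otimes>\<^bsub>K\<^esub> g x) \<in> dual K M"
    and "contract_left K N (\<lambda>x. f x \<oplus>\<^bsub>K\<^esub> c \<otimes>\<^bsub>K\<^esub> g x) t =
      contract_left K N f t \<oplus>\<^bsub>N\<^esub> c \<odot>\<^bsub>N\<^esub> contract_left K N g t"
proof -
  interpret M: module K M by fact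
  interpret N: module K N by fact
  note ground_mod = ground_module_module[OF M.R.is_cring]
  show fg: "(\<lambda>x. f x \<oplus>\<^bsub>K\<^esub> c \<otimes>\<^bsub>K\<^esub> g x) \<in> dual K M"
    using lin_plus[OF assms(1) ground_mod assms(3) lin_scale[OF assms(1) ground_mod assms(4,5)]] by simp
  note lin = contract_left_linear[OF assms(1,2)]
  show "contract_left K N (\<lambda>x. f x \<oplus>\<^bsub>K\<^esub> c \<otimes>\<^bsub>K\<^esub> g x) t =
      contract_left K N f t \<oplus>\<^bsub>N\<^esub> c \<odot>\<^bsub>N\<^esub> contract_left K N g t"
  proof (rule tensor_linear_eqI[OF assms(1,2,2) lin[OF fg] _ _ assms(6)])
    note T = tensor_module[OF assms(1,2)]
    show "(\<lambda>t. contract_left K N f t \<oplus>\<^bsub>N\<^esub> c \<odot>\<^bsub>N\<^esub> contract_left K N g t) \<in> linear_maps K (tensor_product K M N) N"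
      by (rule lin_plus[OF T assms(2) lin[OF assms(3)] lin_scale[OF T assms(2) lin[OF assms(4)] assms(5)]])
    fix x y assume xy: "x \<in> carrier M" "y \<in> carrier N"
    then show "contract_left K N (\<lambda>x. f x \<oplus>\<^bsub>K\<^esub> c \<otimes>\<^bsub>K\<^esub> g x) (pure_tensor K M N x y) =
        contract_left K N f (pure_tensor K M N x y) \<oplus>\<^bsub>N\<^esub> c \<odot>\<^bsub>N\<^esub> contract_left K N g (pure_tensor K M N x y)"
      using lin_closed[OF assms(3) xy(1)] lin_closed[OF assms(4) xy(1)] assms(5)
      by (simp add: contract_left_pure[OF assms(1,2)] fg assms(3,4) N.smult_l_distr N.smult_assoc1)
  qed
qed

lemma
  assumes "module K L" "module K M" "module K N"
  shows tensor_assoc_linear: "tensor_assoc K L M N \<in>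
      linear_maps K (tensor_product K (tensor_product K L M) N) (tensor_product K L (tensor_product K M N))"
    and tensor_assoc_pure: "\<lbrakk>x \<in> carrier L; y \<in> carrier M; z \<in> carrier N\<rbrakk> \<Longrightarrow>
      tensor_assoc K L M N (pure_tensor K (tensor_product K L M) N (pure_tensor K L M x y) z) =
      pure_tensor K L (tensor_product K M N) x (pure_tensor K M N y z)"
proof -
  let ?LM = "tensor_product K L M" and ?MN = "tensor_product K M N"
  let ?T = "tensor_product K L ?MN"
  note LM = tensor_module[OF assms(1,2)] and MN = tensor_module[OF assms(2,3)]
  note T = tensor_module[OF assms(1) MN]
  let ?b = "\<lambda>z x y. pure_tensor K L ?MN x (pure_tensor K M N y z)"
  have b: "?b z \<in> bilinear_maps K L M ?T" if "z \<in> carrier N" for z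
    by (rule bilin_precomp[OF pure_bilinear[OF assms(1) MN] lin_id
          bilin_left[OF pure_bilinear[OF assms(2,3)] that]])
  have l: "(\<lambda>z. ?b z x y) \<in> linear_maps K N ?T" if "x \<in> carrier L" "y \<in> carrier M" for x y
    by (rule lin_comp[OF bilin_right[OF pure_bilinear[OF assms(2,3)] that(2)]
          bilin_right[OF pure_bilinear[OF assms(1) MN] that(1)]])
  have B: "(\<lambda>t z. tensor_lift K ?T (?b z) t) \<in> bilinear_maps K ?LM N ?T"
  proof (rule bilinI)
    show "(\<lambda>z. tensor_lift K ?T (?b z) t) \<in> linear_maps K N ?T" if "t \<in> carrier ?LM" for t
      by (rule tensor_lift_param[OF assms(3,1,2) T b l that])
    show "(\<lambda>t. tensor_lift K ?T (?b z) t) \<in> linear_maps K ?LM ?T" if "z \<in> carrier N" for z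
      by (rule tensor_lift_linear[OF assms(1,2) T b[OF that]])
  qed
  show "tensor_assoc K L M N \<in> linear_maps K (tensor_product K ?LM N) ?T"
    unfolding tensor_assoc_def Let_def by (rule tensor_lift_linear[OF LM assms(3) T B])
  assume xyz: "x \<in> carrier L" "y \<in> carrier M" "z \<in> carrier N"
  show "tensor_assoc K L M N (pure_tensor K ?LM N (pure_tensor K L M x y) z) =
      pure_tensor K L ?MN x (pure_tensor K M N y z)"
    unfolding tensor_assoc_def Let_def
    using tensor_lift_pure[OF LM assms(3) T B pure_closed[OF assms(1,2) xyz(1,2)] xyz(3)]
      tensor_lift_pure[OF assms(1,2) T b[OF xyz(3)] xyz(1,2)] by simp
qed

lemma
  assumes "module K A" "module K B" "module K C" "module K D" "module K P" "module K Q"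
    and p: "p \<in> bilinear_maps K A B P" and q: "q \<in> bilinear_maps K C D Q"
  shows tensor_pairing_bilinear: "tensor_pairing K P Q p q \<in>
      bilinear_maps K (tensor_product K A C) (tensor_product K B D) (tensor_product K P Q)"
    and tensor_pairing_pure: "\<lbrakk>a \<in> carrier A; b \<in> carrier B; c \<in> carrier C; d \<in> carrier D\<rbrakk> \<Longrightarrow>
      tensor_pairing K P Q p q (pure_tensor K A C a c) (pure_tensor K B D b d) =
      pure_tensor K P Q (p a b) (q c d)"
proof -
  let ?AC = "tensor_product K A C" and ?BD = "tensor_product K B D" and ?T = "tensor_product K P Q"
  note T = tensor_module[OF assms(5,6)] and AC = tensor_module[OF assms(1,3)] and BD = tensor_module[OF assms(2,4)]
  note P = pure_bilinear[OF assms(5,6)]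
  let ?b = "\<lambda>x x' y y'. pure_tensor K P Q (p x y) (q x' y')"
  have b: "?b x x' \<in> bilinear_maps K B D ?T" if "x \<in> carrier A" "x' \<in> carrier C" for x x'
    by (rule bilin_precomp[OF P bilin_right[OF p that(1)] bilin_right[OF q that(2)]])
  have b': "(\<lambda>x x'. ?b x x' y y') \<in> bilinear_maps K A C ?T" if "y \<in> carrier B" "y' \<in> carrier D" for y y'
    by (rule bilin_precomp[OF P bilin_left[OF p that(1)] bilin_left[OF q that(2)]])
  have L: "(\<lambda>x x'. tensor_lift K ?T (?b x x') u) \<in> bilinear_maps K A C ?T" if u: "u \<in> carrier ?BD" for u
  proof (rule bilinI)
    show "(\<lambda>x'. tensor_lift K ?T (?b x x') u) \<in> linear_maps K C ?T" if x: "x \<in> carrier A" for x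
      by (rule tensor_lift_param[OF assms(3,2,4) T b[OF x] bilin_right[OF b' x] u])
    show "(\<lambda>x. tensor_lift K ?T (?b x x') u) \<in> linear_maps K A ?T" if x': "x' \<in> carrier C" for x'
      by (rule tensor_lift_param[OF assms(1,2,4) T b[OF _ x'] bilin_left[OF b' x'] u])
  qed
  show "tensor_pairing K P Q p q \<in> bilinear_maps K ?AC ?BD ?T"
    unfolding tensor_pairing_def Let_def
  proof (rule bilinI)
    show "(\<lambda>t. tensor_lift K ?T (\<lambda>x x'. tensor_lift K ?T (?b x x') u) t) \<in> linear_maps K ?AC ?T"
      if "u \<in> carrier ?BD" for u
      by (rule tensor_lift_linear[OF assms(1,3) T L[OF that]])
    show "(\<lambda>u. tensor_lift K ?T (\<lambda>x x'. tensor_lift K ?T (?b x x') u) t) \<in> linear_maps K ?BD ?T"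
      if "t \<in> carrier ?AC" for t
      by (rule tensor_lift_param[OF BD assms(1,3) T L tensor_lift_linear[OF assms(2,4) T b] that])
  qed
  assume abcd: "a \<in> carrier A" "b \<in> carrier B" "c \<in> carrier C" "d \<in> carrier D"
  show "tensor_pairing K P Q p q (pure_tensor K A C a c) (pure_tensor K B D b d) = pure_tensor K P Q (p a b) (q c d)"
    unfolding tensor_pairing_def Let_def
    using tensor_lift_pure[OF assms(1,3) T L[OF pure_closed[OF assms(2,4) abcd(2,4)]] abcd(1,3)]
      tensor_lift_pure[OF assms(2,4) T b[OF abcd(1,3)] abcd(2,4)] by simp
qed

section \<open>The action of the dual algebra on a comodule\<close>

text \<open>In Sweedler notation this is f(m_(-1)) m_(0). It makes a left comodule a right module
  over the dual algebra.\<close>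

definition dual_act ::
  "('k, 'r) ring_scheme \<Rightarrow> ('k, 'h, 'm, 'z) comodule_scheme \<Rightarrow> 'm \<Rightarrow> ('h \<Rightarrow> 'k) \<Rightarrow> 'm"
  where "dual_act K M m f = contract_left K M f (coact M m)"

text \<open>The product f(h_(1)) g(h_(2)) of the dual algebra, in this order because the action is
  from the right.\<close>

definition convolution ::
  "('k, 'r) ring_scheme \<Rightarrow> ('k, 'h, 'z) coalgebra_scheme \<Rightarrow> ('h \<Rightarrow> 'k) \<Rightarrow> ('h \<Rightarrow> 'k) \<Rightarrow> 'h \<Rightarrow> 'k"
  where "convolution K C f g h = g (contract_left K C f (comult C h))"

context coalgebra
begin

lemma modC: "module K C" by (rule module_axioms)

lemma ground_mod: "module K (ground_module K)"
  by (rule ground_module_module) (rule is_cring)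

lemma comult_closed: "h \<in> carrier C \<Longrightarrow> comult C h \<in> carrier (tensor_product K C C)"
  by (rule lin_closed[OF comult_linear])

lemma convolution_dual:
  assumes "f \<in> dual K C" "g \<in> dual K C" shows "convolution K C f g \<in> dual K C"
  unfolding convolution_def
  by (rule lin_comp[OF lin_comp[OF comult_linear contract_left_linear[OF modC modC assms(1)]] assms(2)])

lemma convolution_eq:
  assumes "f \<in> dual K C" "g \<in> dual K C" "h \<in> carrier C"
  shows "convolution K C f g h = f (contract_right K C g (comult C h))"
  unfolding convolution_def by (rule contract_swap[OF modC modC assms(1,2) comult_closed[OF assms(3)], symmetric])

text \<open>Both tensor factors of the comultiplication must lie in \<open>D\<close>, so both
  contractions are tested: subcoalgebras are the subspaces stable under the dual algebra from either
  side.\<close>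

lemma subcoalgebra_iff:
  assumes D: "submodule D K C"
  shows "subcoalgebra K C D \<longleftrightarrow> (\<forall>d\<in>D. \<forall>f\<in>dual K C.
    contract_left K C f (comult C d) \<in> D \<and> contract_right K C f (comult C d) \<in> D)"
proof -
  interpret CC: two_modules K C C by (simp add: two_modules_def modC)
  note Dc = submodule_subset[OF D]
  show ?thesis
  proof
    assume "subcoalgebra K C D"
    then have "comult C d \<in> tensor_sub K C C D D" if "d \<in> D" for d using that by (auto simp: subcoalgebra_def)
    then show "\<forall>d\<in>D. \<forall>f\<in>dual K C. contract_left K C f (comult C d) \<in> D \<and> contract_right K C f (comult C d) \<in> D"
      using CC.tensor_subD[OF D D] by blast
  next
    assume *: "\<forall>d\<in>D. \<forall>f\<in>dual K C. contract_left K C f (comult C d) \<in> D \<and> contract_right K C f (comult C d) \<in> D"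
    have "comult C d \<in> tensor_sub K C C D D" if d: "d \<in> D" for d
      by (rule CC.tensor_subI[OF field_axioms comult_closed Dc Dc]) (use d Dc * in auto)
    then show "subcoalgebra K C D" using D by (auto simp: subcoalgebra_def)
  qed
qed

text \<open>Functionals separate points, so coassociativity of a coaction says that the dual algebra acts.\<close>

lemma coassoc_iff:
  fixes M :: "('k, 'h, 'm, 'y) comodule_scheme"
  assumes M: "module K M" and co: "coact M \<in> linear_maps K M (tensor_product K C M)" and m: "m \<in> carrier M"
  shows "tensor_assoc K C C M (tensor_map K (tensor_product K C C) M (comult C) (\<lambda>x. x) (coact M m)) =
      tensor_map K C (tensor_product K C M) (\<lambda>h. h) (coact M) (coact M m) \<longleftrightarrow>
    (\<forall>f\<in>dual K C. \<forall>g\<in>dual K C.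
      dual_act K M m (convolution K C f g) = dual_act K M (dual_act K M m f) g)"
    (is "?l = ?r \<longleftrightarrow> _")
proof -
  interpret M: module K M by (rule M)
  let ?CC = "tensor_product K C C" and ?CM = "tensor_product K C M"
  note CC = tensor_module[OF modC modC] and CM = tensor_module[OF modC M]
  have tm: "two_modules K C M" "two_modules K C ?CM"
    by (simp_all add: two_modules_def modC M CM)
  note cm = lin_closed[OF co m]
  note as = tensor_assoc_linear[OF modC modC M] and asp = tensor_assoc_pure[OF modC modC M]
  note di = tensor_map_linear[OF modC M CC M comult_linear lin_id]
  \<comment> \<open>Contracting with \<open>f\<close> and then with \<open>g\<close> separates the
    points of C \<otimes> (C \<otimes> M), by two applications of \<open>tensor_eqI\<close>. The two
    sides of coassociativity are compared through these maps.\<close>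
  let ?\<Phi> = "\<lambda>f g w. contract_left K M g (contract_left K ?CM f w)"
  have \<Phi>: "?\<Phi> f g ?l = dual_act K M m (convolution K C f g)" "?\<Phi> f g ?r = dual_act K M (dual_act K M m f) g"
    if f: "f \<in> dual K C" and g: "g \<in> dual K C" for f g
  proof -
    note \<Phi>l = lin_comp[OF contract_left_linear[OF modC CM f] contract_left_linear[OF modC M g]]
    have u: "?\<Phi> f g (tensor_assoc K C C M (pure_tensor K ?CC M u x)) = g (contract_left K C f u) \<odot>\<^bsub>M\<^esub> x"
      if u: "u \<in> carrier ?CC" and x: "x \<in> carrier M" for u x
    proof (rule tensor_linear_eqI[OF modC modC M _ _ _ u])
      show "(\<lambda>u. ?\<Phi> f g (tensor_assoc K C C M (pure_tensor K ?CC M u x))) \<in> linear_maps K ?CC M"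
        by (rule lin_comp[OF lin_comp[OF bilin_left[OF pure_bilinear[OF CC M] x] as] \<Phi>l])
      show "(\<lambda>u. g (contract_left K C f u) \<odot>\<^bsub>M\<^esub> x) \<in> linear_maps K ?CC M"
        by (rule lin_smult_fixed[OF M lin_comp[OF contract_left_linear[OF modC modC f] g] x])
      fix a b assume ab: "a \<in> carrier C" "b \<in> carrier C"
      have k: "f a \<in> carrier K" "g b \<in> carrier K"
        using lin_closed[OF f ab(1)] lin_closed[OF g ab(2)] by simp_all
      note bx = pure_closed[OF modC M ab(2) x]
      show "?\<Phi> f g (tensor_assoc K C C M (pure_tensor K ?CC M (pure_tensor K C C a b) x)) =
          g (contract_left K C f (pure_tensor K C C a b)) \<odot>\<^bsub>M\<^esub> x"
        using k x by (simp add: asp[OF ab x] contract_left_pure[OF modC CM f ab(1) bx]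
          lin_smult[OF contract_left_linear[OF modC M g] k(1) bx]
          contract_left_pure[OF modC M g ab(2) x] contract_left_pure[OF modC modC f ab]
          lin_smult[OF g k(1) ab(2)] M.smult_assoc1)
    qed
    note fg = convolution_dual[OF f g]
    show "?\<Phi> f g ?l = dual_act K M m (convolution K C f g)"
      unfolding dual_act_def
    proof (rule tensor_linear_eqI[OF modC M M _ contract_left_linear[OF modC M fg] _ cm])
      show "(\<lambda>t. ?\<Phi> f g (tensor_assoc K C C M (tensor_map K ?CC M (comult C) (\<lambda>x. x) t))) \<in> linear_maps K ?CM M"
        by (rule lin_comp[OF lin_comp[OF di as] \<Phi>l])
      fix h x assume hx: "h \<in> carrier C" "x \<in> carrier M"
      show "?\<Phi> f g (tensor_assoc K C C M (tensor_map K ?CC M (comult C) (\<lambda>x. x) (pure_tensor K C M h x))) =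
          contract_left K M (convolution K C f g) (pure_tensor K C M h x)"
        by (simp add: tensor_map_pure[OF modC M CC M comult_linear lin_id hx]
            u[OF comult_closed[OF hx(1)] hx(2)] contract_left_pure[OF modC M fg hx] convolution_def)
    qed
    show "?\<Phi> f g ?r = dual_act K M (dual_act K M m f) g"
      unfolding dual_act_def by (subst contract_left_tensor_map[OF modC M modC CM lin_id co f cm]) simp
  qed
  have lr: "?l \<in> carrier (tensor_product K C ?CM)" "?r \<in> carrier (tensor_product K C ?CM)"
    by (rule lin_closed[OF lin_comp[OF di as] cm])
      (rule lin_closed[OF tensor_map_linear[OF modC M modC CM lin_id co] cm])
  show ?thesis
  proof
    assume "?l = ?r"
    then show "\<forall>f\<in>dual K C. \<forall>g\<in>dual K C. dual_act K M m (convolution K C f g) = dual_act K M (dual_act K M m f) g"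
      using \<Phi> by simp
  next
    assume *: "\<forall>f\<in>dual K C. \<forall>g\<in>dual K C. dual_act K M m (convolution K C f g) = dual_act K M (dual_act K M m f) g"
    show "?l = ?r"
    proof (rule two_modules.tensor_eqI[OF tm(2) field_axioms lr])
      fix f assume f: "f \<in> dual K C"
      note c = lin_closed[OF contract_left_linear[OF modC CM f]]
      show "contract_left K ?CM f ?l = contract_left K ?CM f ?r"
        by (rule two_modules.tensor_eqI[OF tm(1) field_axioms c[OF lr(1)] c[OF lr(2)]]) (simp add: \<Phi> f *)
    qed
  qed
qed

end

context left_comodule
begin

abbreviation dual_action (infixl "\<cdot>" 75)
  where "m \<cdot> f \<equiv> dual_act K M m f"

lemma modM: "module K M" by (rule M.module_axioms)

lemma two_modules_HM: "two_modules K H M" by (simp add: two_modules_def modC modM)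

lemma coact_closed: "m \<in> carrier M \<Longrightarrow> coact M m \<in> carrier (tensor_product K H M)"
  by (rule lin_closed[OF coact_linear])

lemma dual_act_linear: "f \<in> dual K H \<Longrightarrow> (\<lambda>m. m \<cdot> f) \<in> linear_maps K M M"
  unfolding dual_act_def by (rule lin_comp[OF coact_linear contract_left_linear[OF modC modM]])

lemma dual_act_closed: "\<lbrakk>f \<in> dual K H; m \<in> carrier M\<rbrakk> \<Longrightarrow> m \<cdot> f \<in> carrier M"
  by (rule lin_closed[OF dual_act_linear])

lemma dual_act_counit: "m \<in> carrier M \<Longrightarrow> m \<cdot> (counit H) = m"
  using coact_counit by (simp add: dual_act_def contract_left_def)

lemma dual_act_convolution:
  assumes "f \<in> dual K H" "g \<in> dual K H" "m \<in> carrier M"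
  shows "m \<cdot> (convolution K H f g) = (m \<cdot> f) \<cdot> g"
  using coassoc_iff[OF modM coact_linear assms(3)] coact_coassoc[OF assms(3)] assms(1,2) by simp

lemma coact_eqI:
  assumes "t \<in> carrier (tensor_product K H M)" "m \<in> carrier M"
    and "\<And>f. f \<in> dual K H \<Longrightarrow> m \<cdot> f = contract_left K M f t"
  shows "coact M m = t"
  by (rule two_modules.tensor_eqI[OF two_modules_HM field_axioms coact_closed[OF assms(2)] assms(1)])
    (simp add: assms(3)[symmetric] dual_act_def)

text \<open>The left factor ranges over all of \<open>H\<close>, so the condition lies entirely in
  the left contractions.\<close>

lemma subcomodule_iff:
  assumes N: "submodule N K M"
  shows "subcomodule K H M N \<longleftrightarrow> (\<forall>n\<in>N. \<forall>f\<in>dual K H. n \<cdot> f \<in> N)"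
proof -
  interpret T: two_modules K H M by (rule two_modules_HM)
  note Nc = submodule_subset[OF N]
  show ?thesis
  proof
    assume "subcomodule K H M N"
    then have "coact M n \<in> tensor_sub K H M (carrier H) N" if "n \<in> N" for n
      using that by (auto simp: subcomodule_def)
    then show "\<forall>n\<in>N. \<forall>f\<in>dual K H. n \<cdot> f \<in> N"
      using T.tensor_subD(2)[OF module.carrier_is_submodule[OF modC] N] unfolding dual_act_def by blast
  next
    assume *: "\<forall>n\<in>N. \<forall>f\<in>dual K H. n \<cdot> f \<in> N"
    have "coact M n \<in> tensor_sub K H M (carrier H) N" if n: "n \<in> N" for n
    proof (rule T.tensor_subI[OF field_axioms coact_closed _ Nc])
      show "n \<in> carrier M" using n Nc by blast
      then show "contract_right K H g (coact M n) \<in> carrier H" if "g \<in> dual K M" for g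
        by (rule lin_closed[OF contract_right_linear[OF modC modM that] coact_closed])
      show "contract_left K M f (coact M n) \<in> N" if "f \<in> dual K H" for f
        using * n that by (simp add: dual_act_def)
    qed simp
    then show "subcomodule K H M N" using N by (auto simp: subcomodule_def)
  qed
qed

lemma dual_act_grouplike:
  assumes "m \<in> carrier M" "g \<in> carrier H"
  shows "coact M m = pure_tensor K H M g m \<longleftrightarrow> (\<forall>f\<in>dual K H. m \<cdot> f = f g \<odot>\<^bsub>M\<^esub> m)"
  using coact_eqI[OF pure_closed[OF modC modM assms(2,1)] assms(1)]
  by (auto simp: dual_act_def contract_left_pure[OF modC modM _ assms(2,1)])

end

section \<open>Grouplike vectors in comodules over a pointed coalgebra\<close>

lemma zero_submodule: "module K V \<Longrightarrow> submodule {\<zero>\<^bsub>V\<^esub>} K V"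
proof -
  assume "module K V"
  then interpret module K V .
  show "submodule {\<zero>\<^bsub>V\<^esub>} K V" by (rule submoduleI'[OF \<open>module K V\<close>]) auto
qed

abbreviation grouplikes where "grouplikes K H \<equiv> carrier (grouplike_group K H)"

context coalgebra
begin

lemma K_abelian_group: "abelian_group K"
  by (rule ring.is_abelian_group[OF cring.axioms(1)[OF module.axioms(1)[OF modC]]])

text \<open>Evaluation at a grouplike element is multiplicative on the dual algebra, so the
  functionals vanishing there form a two-sided ideal.\<close>

lemma convolution_grouplike:
  assumes "f \<in> dual K C" "h \<in> dual K C" "g \<in> carrier C" "comult C g = pure_tensor K C C g g"
  shows "convolution K C f h g = f g \<otimes>\<^bsub>K\<^esub> h g"
  using lin_closed[OF assms(1,3)] lin_smult[OF assms(2) _ assms(3)]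
  by (simp add: convolution_def assms(4) contract_left_pure[OF modC modC assms(1,3,3)])

text \<open>If \<open>D\<close> is the line through \<open>v\<close>, then \<Delta>(v) = c v
  \<otimes> v for a scalar \<open>c\<close>, and the counit axiom forces c \<epsilon>(v) = 1.
  Rescaling \<open>v\<close> by \<open>c\<close> makes both grouplike conditions hold.\<close>

lemma one_dimensional_subcoalgebra:
  assumes D: "subcoalgebra K C D" and "one_dimensional K C D"
  shows "\<exists>g\<in>D. g \<in> grouplikes K C"
proof -
  let ?T = "tensor_product K C C" and ?p = "pure_tensor K C C"
  interpret T: module K ?T by (rule tensor_module[OF modC modC])
  note Tm = T.module_axioms
  obtain v where v: "v \<in> carrier C" "v \<noteq> \<zero>\<^bsub>C\<^esub>" and Dv: "D = {c \<odot>\<^bsub>C\<^esub> v |c. c \<in> carrier K}"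
    using assms(2) by (auto simp: one_dimensional_def)
  have "v = \<one>\<^bsub>K\<^esub> \<odot>\<^bsub>C\<^esub> v" using v by simp
  then have vD: "v \<in> D" unfolding Dv by blast
  note vv = pure_closed[OF modC modC v(1,1)]
  note br = bilin_right[OF pure_bilinear[OF modC modC]]
    and bl = bilin_left[OF pure_bilinear[OF modC modC]]
  have pp: "?p (a \<odot>\<^bsub>C\<^esub> v) (b \<odot>\<^bsub>C\<^esub> v) = (a \<otimes>\<^bsub>K\<^esub> b) \<odot>\<^bsub>?T\<^esub> ?p v v"
    if ab: "a \<in> carrier K" "b \<in> carrier K" for a b
  proof -
    have "?p (a \<odot>\<^bsub>C\<^esub> v) (b \<odot>\<^bsub>C\<^esub> v) = a \<odot>\<^bsub>?T\<^esub> ?p v (b \<odot>\<^bsub>C\<^esub> v)"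
      using ab v by (intro lin_smult[OF bl]) auto
    also have "?p v (b \<odot>\<^bsub>C\<^esub> v) = b \<odot>\<^bsub>?T\<^esub> ?p v v"
      using ab v by (intro lin_smult[OF br]) auto
    finally show ?thesis using ab vv by (simp add: T.smult_assoc1)
  qed
  have D': "contract_left K C f (comult C v) \<in> D" "contract_right K C f (comult C v) \<in> D"
    if "f \<in> dual K C" for f
    using D vD that subcoalgebra_iff[of D] by (auto simp: subcoalgebra_def)
  obtain h where h: "h \<in> dual K C" "h v = \<one>\<^bsub>K\<^esub>"
    using dual_separates[OF field_axioms modC zero_submodule[OF modC] v(1)] v(2) by blast
  \<comment> \<open>The scalar is read off from the right contraction with a functional that is 1 at
    \<open>v\<close>.\<close>
  obtain c where c1: "c \<in> carrier K" "contract_right K C h (comult C v) = c \<odot>\<^bsub>C\<^esub> v"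
    using D'(2)[OF h(1)] unfolding Dv by blast
  have "comult C v = c \<odot>\<^bsub>?T\<^esub> ?p v v"
  proof (rule two_modules.tensor_eqI[OF _ field_axioms comult_closed[OF v(1)] T.smult_closed[OF c1(1) vv]])
    show "two_modules K C C" by (simp add: two_modules_def modC)
    fix f assume f: "f \<in> dual K C"
    have fv: "f v \<in> carrier K" using lin_closed[OF f v(1)] by simp
    obtain a where a: "a \<in> carrier K" "contract_left K C f (comult C v) = a \<odot>\<^bsub>C\<^esub> v"
      using D'(1)[OF f] unfolding Dv by blast
    \<comment> \<open>Evaluating f \<otimes> h at \<Delta>(v) in both orders gives c f(v) on one
      side and a h(v) = a on the other.\<close>
    have "c \<otimes>\<^bsub>K\<^esub> f v = a"
      using contract_swap[OF modC modC f h(1) comult_closed[OF v(1)]] a h(2)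
        lin_smult[OF f c1(1) v(1)] lin_smult[OF h(1) a(1) v(1)] by (simp add: c1(2))
    then show "contract_left K C f (comult C v) = contract_left K C f (c \<odot>\<^bsub>?T\<^esub> ?p v v)"
      using lin_smult[OF contract_left_linear[OF modC modC f] c1(1) vv] fv c1(1) v(1)
      by (simp add: a(2) contract_left_pure[OF modC modC f v(1,1)] smult_assoc1[symmetric])
  qed
  note c = c1(1) this
  have e: "counit C v \<in> carrier K" using lin_closed[OF counit_linear v(1)] by simp
  have "v = contract_left K C (counit C) (comult C v)"
    using counit_left[OF v(1)] by (simp add: contract_left_def)
  also have "\<dots> = c \<odot>\<^bsub>C\<^esub> (counit C v \<odot>\<^bsub>C\<^esub> v)"
    unfolding c(2) using lin_smult[OF contract_left_linear[OF modC modC counit_linear] c(1) vv]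
    by (simp add: contract_left_pure[OF modC modC counit_linear v(1,1)])
  also have "\<dots> = (c \<otimes>\<^bsub>K\<^esub> counit C v) \<odot>\<^bsub>C\<^esub> v" using c e v by (simp add: smult_assoc1)
  finally have "(c \<otimes>\<^bsub>K\<^esub> counit C v) \<odot>\<^bsub>C\<^esub> v = v" by simp
  then have "(c \<otimes>\<^bsub>K\<^esub> counit C v \<ominus>\<^bsub>K\<^esub> \<one>\<^bsub>K\<^esub>) \<odot>\<^bsub>C\<^esub> v = \<zero>\<^bsub>C\<^esub>"
    using c e v abelian_group.r_neg[OF module_abelian_group[OF modC]]
    by (simp add: a_minus_def smult_l_distr smult_l_minus)
  then have d: "c \<otimes>\<^bsub>K\<^esub> counit C v \<ominus>\<^bsub>K\<^esub> \<one>\<^bsub>K\<^esub> = \<zero>\<^bsub>K\<^esub>"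
    by (rule smult_eq_zero[OF field_axioms modC _ v(1) _ v(2), rotated]) (use c e in simp)
  have ce: "c \<otimes>\<^bsub>K\<^esub> counit C v = \<one>\<^bsub>K\<^esub>"
    by (rule minus_zero_imp_eq[OF K_abelian_group _ _ d]) (use c e in simp_all)
  let ?g = "c \<odot>\<^bsub>C\<^esub> v"
  have "comult C ?g = c \<odot>\<^bsub>?T\<^esub> (c \<odot>\<^bsub>?T\<^esub> ?p v v)"
    using lin_smult[OF comult_linear c(1) v(1)] c(2) by simp
  also have "\<dots> = ?p ?g ?g" using pp[OF c(1,1)] c vv by (simp add: T.smult_assoc1)
  finally have "comult C ?g = ?p ?g ?g" .
  moreover have "counit C ?g = \<one>\<^bsub>K\<^esub>" using lin_smult[OF counit_linear c(1) v(1)] ce by simp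
  ultimately have "?g \<in> grouplikes K C" using c v by (simp add: grouplike_group_def)
  moreover have "?g \<in> D" using c unfolding Dv by blast
  ultimately show ?thesis by blast
qed

end

section \<open>Minimal subcomodules and their eigenvectors\<close>

context left_comodule
begin

text \<open>By \<open>subcomodule_iff\<close> these are the subcomodules, in the form that suits the
  dual action.\<close>

abbreviation stable where
  "stable N \<equiv> submodule N K M \<and> (\<forall>n\<in>N. \<forall>f\<in>dual K H. n \<cdot> f \<in> N)"

lemma dual_combination:
  assumes "f \<in> dual K H" "h \<in> dual K H" "c \<in> carrier K" "m \<in> carrier M"
  shows "(\<lambda>x. f x \<oplus> c \<otimes> h x) \<in> dual K H"
    and "m \<cdot> (\<lambda>x. f x \<oplus> c \<otimes> h x) = m \<cdot> f \<oplus>\<^bsub>M\<^esub> c \<odot>\<^bsub>M\<^esub> m \<cdot> h"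
  unfolding dual_act_def
  by (rule contract_left_combination[OF modC modM assms(1-3) coact_closed[OF assms(4)]])+

lemma dual_act_zero: "f \<in> dual K H \<Longrightarrow> \<zero>\<^bsub>M\<^esub> \<cdot> f = \<zero>\<^bsub>M\<^esub>"
  by (rule lin_zero[OF modM modM dual_act_linear])

text \<open>\<open>J\<close> behaves like a right ideal of the dual algebra, and x J is a
  subcomodule because (x f) h = x (f h). The element \<open>z\<close> stands in for zero: multiples
  are formed as z + c f, and z kills \<open>x\<close>.\<close>

lemma annihilated_submodule:
  assumes x: "x \<in> carrier M" and J: "\<And>f. f \<in> J \<Longrightarrow> f \<in> dual K H" and J0: "z \<in> J" "x \<cdot> z = \<zero>\<^bsub>M\<^esub>"
    and Jc: "\<And>f h c. \<lbrakk>f \<in> J; h \<in> J; c \<in> carrier K\<rbrakk> \<Longrightarrow> (\<lambda>x. f x \<oplus> c \<otimes> h x) \<in> J"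
    and Jr: "\<And>f h. \<lbrakk>f \<in> J; h \<in> dual K H\<rbrakk> \<Longrightarrow> convolution K H f h \<in> J"
  shows "stable {x \<cdot> f |f. f \<in> J}" (is "stable ?U")
proof (intro conjI ballI)
  note ac = dual_act_closed[OF J x]
  show "submodule ?U K M"
  proof (rule submoduleI'[OF modM])
    show "?U \<subseteq> carrier M" using ac by blast
    show "\<zero>\<^bsub>M\<^esub> \<in> ?U" using J0 by force
    fix a b assume "a \<in> ?U" "b \<in> ?U"
    then obtain f h where fh: "f \<in> J" "h \<in> J" "a = x \<cdot> f" "b = x \<cdot> h" by blast
    have "a \<oplus>\<^bsub>M\<^esub> b = x \<cdot> (\<lambda>x. f x \<oplus> \<one> \<otimes> h x)"
      using fh dual_combination(2)[OF J J, of f h \<one> x] x ac by simp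
    then show "a \<oplus>\<^bsub>M\<^esub> b \<in> ?U" using Jc[OF fh(1,2), of \<one>] by blast
  next
    fix c a assume c: "c \<in> carrier K" and "a \<in> ?U"
    then obtain f where f: "f \<in> J" "a = x \<cdot> f" by blast
    have "c \<odot>\<^bsub>M\<^esub> a = x \<cdot> (\<lambda>x. z x \<oplus> c \<otimes> f x)"
      using f c dual_combination(2)[OF J J, of z f c x] x J0 ac by simp
    then show "c \<odot>\<^bsub>M\<^esub> a \<in> ?U" using Jc[OF J0(1) f(1) c] by blast
  qed
  fix n h assume "n \<in> ?U" and h: "h \<in> dual K H"
  then obtain f where f: "f \<in> J" "n = x \<cdot> f" by blast
  have "n \<cdot> h = x \<cdot> (convolution K H f h)"
    unfolding f(2) using dual_act_convolution[OF J[OF f(1)] h x] by simp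
  then show "n \<cdot> h \<in> ?U" using Jr[OF f(1) h] by blast
qed

lemma zero_dual: "(\<lambda>_. \<zero>) \<in> dual K H"
  by (rule linI) auto

lemma dual_act_zero_right: "m \<in> carrier M \<Longrightarrow> m \<cdot> (\<lambda>_. \<zero>) = \<zero>\<^bsub>M\<^esub>"
proof -
  assume m: "m \<in> carrier M"
  \<comment> \<open>Zero is rewritten as 0 + (-1) 0, so that the combination formula subtracts a
    vector from itself.\<close>
  have "m \<cdot> (\<lambda>x. \<zero> \<oplus> (\<ominus> \<one>) \<otimes> \<zero>) =
      m \<cdot> (\<lambda>_. \<zero>) \<oplus>\<^bsub>M\<^esub> (\<ominus> \<one>) \<odot>\<^bsub>M\<^esub> m \<cdot> (\<lambda>_. \<zero>)"
    by (rule dual_combination(2)[OF zero_dual zero_dual _ m]) simp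
  then show ?thesis using dual_act_closed[OF zero_dual m] by (simp add: M.smult_l_minus M.r_neg)
qed

lemma orbit_stable:
  assumes m: "m \<in> carrier M"
  shows "stable {m \<cdot> f |f. f \<in> dual K H}" and "m \<in> {m \<cdot> f |f. f \<in> dual K H}"
proof -
  show "stable {m \<cdot> f |f. f \<in> dual K H}"
    by (rule annihilated_submodule[OF m _ zero_dual dual_act_zero_right[OF m]])
      (simp_all add: dual_combination[OF _ _ _ m] convolution_dual)
  show "m \<in> {m \<cdot> f |f. f \<in> dual K H}"
    using dual_act_counit[OF m] counit_linear by force
qed

text \<open>One orbit lies in the span of a finite set. A minimal nonzero subcomodule inside that
  span is minimal among all, since anything below it stays in the span.\<close>

lemma minimal_stable_exists:
  assumes "carrier M \<noteq> {\<zero>\<^bsub>M\<^esub>}"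
  shows "\<exists>N. stable N \<and> N \<noteq> {\<zero>\<^bsub>M\<^esub>} \<and> (\<forall>N'. stable N' \<and> N' \<subseteq> N \<longrightarrow> N' = {\<zero>\<^bsub>M\<^esub>} \<or> N' = N)"
proof -
  obtain m where m: "m \<in> carrier M" "m \<noteq> \<zero>\<^bsub>M\<^esub>" using assms M.zero_closed by blast
  obtain Y where Y: "finite Y" "Y \<subseteq> carrier M" "\<forall>f\<in>dual K H. m \<cdot> f \<in> lin_span K M Y"
    using two_modules.contract_finite[OF two_modules_HM field_axioms coact_closed[OF m(1)]] unfolding dual_act_def by blast
  define F where "F = {N. stable N \<and> N \<noteq> {\<zero>\<^bsub>M\<^esub>} \<and> N \<subseteq> lin_span K M Y}"
  have FI: "{m \<cdot> f |f. f \<in> dual K H} \<in> F"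
    using orbit_stable[OF m(1)] m(2) Y(3) unfolding F_def by blast
  have "\<exists>W\<in>F. \<forall>W'\<in>F. W' \<subseteq> W \<longrightarrow> W' = W"
  proof (rule finite_span_minimal[OF field_axioms modM Y(1,2)])
    show "F \<noteq> {}" using FI by blast
  qed (simp add: F_def)
  then obtain W where W: "W \<in> F" "\<forall>W'\<in>F. W' \<subseteq> W \<longrightarrow> W' = W" by (rule bexE)
  have "N' = {\<zero>\<^bsub>M\<^esub>} \<or> N' = W" if N': "stable N'" "N' \<subseteq> W" for N'
  proof (rule disjCI)
    assume "N' \<noteq> W"
    then have "N' \<notin> F" using W(2) N'(2) by blast
    moreover have "N' \<subseteq> lin_span K M Y" using N'(2) W(1) by (auto simp: F_def)
    ultimately show "N' = {\<zero>\<^bsub>M\<^esub>}" using N'(1) unfolding F_def by blast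
  qed
  then show ?thesis using W(1) unfolding F_def by (intro exI[of _ W]) simp
qed

lemma eigenvector_exists:
  assumes N: "stable N" and min: "\<And>N'. \<lbrakk>stable N'; N' \<subseteq> N\<rbrakk> \<Longrightarrow> N' = {\<zero>\<^bsub>M\<^esub>} \<or> N' = N"
    and g: "g \<in> grouplikes K H"
    and Z: "finite Z" "Z \<subseteq> N" "\<And>f. \<lbrakk>f \<in> dual K H; \<forall>y\<in>Z. y \<cdot> f = \<zero>\<^bsub>M\<^esub>\<rbrakk> \<Longrightarrow> f g = \<zero>"
  shows "\<exists>n\<in>N. n \<noteq> \<zero>\<^bsub>M\<^esub> \<and> (\<forall>f\<in>dual K H. n \<cdot> f = f g \<odot>\<^bsub>M\<^esub> n)"
  using Z
proof (induction Z rule: finite_induct)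
  case empty
  \<comment> \<open>With no vectors to kill, the hypothesis applies to every functional and would
    make the counit vanish at \<open>g\<close>, where it is 1.\<close>
  then have "counit H g = \<zero>" using counit_linear by blast
  then show ?case using g by (simp add: grouplike_group_def)
next
  case (insert x Z)
  have gH: "g \<in> carrier H" "comult H g = pure_tensor K H H g g" "counit H g = \<one>"
    using g by (simp_all add: grouplike_group_def)
  have fg: "f g \<in> carrier K" if "f \<in> dual K H" for f using lin_closed[OF that gH(1)] by simp
  have NM: "N \<subseteq> carrier M" using N submodule_subset by blast
  have x: "x \<in> N" "x \<in> carrier M" and Zc: "\<And>y. y \<in> Z \<Longrightarrow> y \<in> carrier M" using insert.prems NM by auto
  show ?case
  proof (cases "\<forall>f\<in>dual K H. (\<forall>y\<in>Z. y \<cdot> f = \<zero>\<^bsub>M\<^esub>) \<longrightarrow> f g = \<zero>")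
    case True
    then show ?thesis using insert.prems(1) by (intro insert.IH) auto
  next
    case False
    then obtain j where j: "j \<in> dual K H" "\<forall>y\<in>Z. y \<cdot> j = \<zero>\<^bsub>M\<^esub>" "j g \<noteq> \<zero>" by blast
    \<comment> \<open>The annihilator of \<open>Z\<close> intersected with the functionals vanishing
      at \<open>g\<close>. It is a right ideal because evaluation at \<open>g\<close> is
      multiplicative.\<close>
    define J where "J = {f \<in> dual K H. (\<forall>y\<in>Z. y \<cdot> f = \<zero>\<^bsub>M\<^esub>) \<and> f g = \<zero>}"
    define U where "U = {x \<cdot> f |f. f \<in> J}"
    have conv0: "\<forall>y\<in>Z. y \<cdot> (convolution K H f h) = \<zero>\<^bsub>M\<^esub>"
      if "f \<in> dual K H" "\<forall>y\<in>Z. y \<cdot> f = \<zero>\<^bsub>M\<^esub>" "h \<in> dual K H" for f h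
      using that Zc by (simp add: dual_act_convolution dual_act_zero)
    have U: "stable U" unfolding U_def
    proof (rule annihilated_submodule[OF x(2) _ _ dual_act_zero_right[OF x(2)]])
      show "f \<in> J \<Longrightarrow> f \<in> dual K H" for f by (simp add: J_def)
      show "(\<lambda>_. \<zero>) \<in> J" using zero_dual dual_act_zero_right Zc by (simp add: J_def)
      show "(\<lambda>x. f x \<oplus> c \<otimes> h x) \<in> J" if "f \<in> J" "h \<in> J" "c \<in> carrier K" for f h c
        using that Zc dual_combination[OF _ _ _ x(2)] by (auto simp: J_def dual_combination)
      show "convolution K H f h \<in> J" if "f \<in> J" "h \<in> dual K H" for f h
        using that conv0 fg by (auto simp: J_def convolution_dual convolution_grouplike[OF _ _ gH(1,2)])
    qed
    have UN: "U \<subseteq> N" unfolding U_def J_def using N x(1) by blast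
    \<comment> \<open>If x j = x p, then j - p kills \<open>x\<close> and \<open>Z\<close> and
      therefore vanishes at \<open>g\<close>, although j(g) \<noteq> 0 = p(g). So x j lies outside
      \<open>U\<close>, which is thus proper, and the case p = 0 gives x j \<noteq> 0.\<close>
    have unrelated: "x \<cdot> j \<noteq> x \<cdot> p" if p: "p \<in> J" for p
    proof
      assume eq: "x \<cdot> j = x \<cdot> p"
      have pd: "p \<in> dual K H" "\<forall>y\<in>Z. y \<cdot> p = \<zero>\<^bsub>M\<^esub>" "p g = \<zero>" using p by (auto simp: J_def)
      let ?q = "\<lambda>h. j h \<oplus> (\<ominus> \<one>) \<otimes> p h"
      have q: "?q \<in> dual K H" "\<And>y. y \<in> carrier M \<Longrightarrow>
          y \<cdot> ?q = y \<cdot> j \<oplus>\<^bsub>M\<^esub> (\<ominus> \<one>) \<odot>\<^bsub>M\<^esub> y \<cdot> p"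
        using dual_combination[OF j(1) pd(1)] x(2) by simp_all
      have "x \<cdot> ?q = \<zero>\<^bsub>M\<^esub>"
        using q(2)[OF x(2)] dual_act_closed[OF pd(1) x(2)] by (simp add: eq M.smult_l_minus M.r_neg)
      moreover have "y \<cdot> ?q = \<zero>\<^bsub>M\<^esub>" if "y \<in> Z" for y
        using q(2)[OF Zc[OF that]] j(2) pd(2) that by simp
      ultimately have "?q g = \<zero>" using insert.prems(2)[OF q(1)] by blast
      then show False using pd(3) j(3) fg[OF j(1)] by simp
    qed
    have jN: "x \<cdot> j \<in> N" using N x(1) j(1) by blast
    have "U \<noteq> N" using unrelated jN unfolding U_def by blast
    then have U0: "U = {\<zero>\<^bsub>M\<^esub>}" using min[OF U UN] by blast
    let ?n = "x \<cdot> j"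
    have nM: "?n \<in> carrier M" using jN NM by blast
    have "(\<lambda>_. \<zero>) \<in> J" using zero_dual dual_act_zero_right Zc by (simp add: J_def)
    then have "?n \<noteq> \<zero>\<^bsub>M\<^esub>" using unrelated[of "\<lambda>_. \<zero>"] dual_act_zero_right[OF x(2)] by simp
    moreover have "?n \<cdot> f = f g \<odot>\<^bsub>M\<^esub> ?n" if f: "f \<in> dual K H" for f
    proof -
      \<comment> \<open>f - f(g) \<epsilon> vanishes at \<open>g\<close>, so its product with
        \<open>j\<close> lies in \<open>J\<close> and kills \<open>x\<close>. As \<epsilon> acts as
        the identity, this says (x j) f = f(g) (x j).\<close>
      let ?f = "\<lambda>h. f h \<oplus> (\<ominus> f g) \<otimes> counit H h"
      have mf: "\<ominus> f g \<in> carrier K" using fg[OF f] by simp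
      note f' = dual_combination[OF f counit_linear mf nM]
      have "?f g = \<zero>" using fg[OF f] gH(3) by (simp add: abelian_group.r_neg[OF K_abelian_group])
      then have "convolution K H j ?f \<in> J"
        using conv0[OF j(1,2) f'(1)] convolution_dual[OF j(1) f'(1)] fg[OF j(1)]
          convolution_grouplike[OF j(1) f'(1) gH(1,2)] by (simp add: J_def)
      then have "x \<cdot> (convolution K H j ?f) = \<zero>\<^bsub>M\<^esub>" using U0 unfolding U_def by blast
      then have "?n \<cdot> ?f = \<zero>\<^bsub>M\<^esub>" by (simp add: dual_act_convolution[OF j(1) f'(1) x(2)])
      then have "?n \<cdot> f \<oplus>\<^bsub>M\<^esub> (\<ominus> f g) \<odot>\<^bsub>M\<^esub> ?n = \<zero>\<^bsub>M\<^esub>"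
        by (simp add: f'(2) dual_act_counit[OF nM])
      then have "?n \<cdot> f \<ominus>\<^bsub>M\<^esub> f g \<odot>\<^bsub>M\<^esub> ?n = \<zero>\<^bsub>M\<^esub>"
        by (simp only: M.smult_l_minus[OF fg[OF f] nM] a_minus_def)
      then show ?thesis
        by (rule minus_zero_imp_eq[OF M.abelian_group_axioms dual_act_closed[OF f nM] M.smult_closed[OF fg[OF f] nM]])
    qed
    ultimately show ?thesis using jN by blast
  qed
qed

theorem grouplike_vector_exists:
  assumes pointed: "\<And>D. simple_subcoalgebra K H D \<Longrightarrow> one_dimensional K H D"
    and nz: "carrier M \<noteq> {\<zero>\<^bsub>M\<^esub>}"
  shows "\<exists>g\<in>grouplikes K H. \<exists>m\<in>carrier M. m \<noteq> \<zero>\<^bsub>M\<^esub> \<and> coact M m = pure_tensor K H M g m"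
proof -
  obtain N where N0: "stable N \<and> N \<noteq> {\<zero>\<^bsub>M\<^esub>} \<and> (\<forall>N'. stable N' \<and> N' \<subseteq> N \<longrightarrow> N' = {\<zero>\<^bsub>M\<^esub>} \<or> N' = N)"
    using minimal_stable_exists[OF nz] by (rule exE)
  note N = conjunct1[OF N0] conjunct1[OF conjunct2[OF N0]]
  have min: "N' = {\<zero>\<^bsub>M\<^esub>} \<or> N' = N" if "stable N'" "N' \<subseteq> N" for N'
    using mp[OF spec[OF conjunct2[OF conjunct2[OF N0]]] conjI[OF that]] .
  have NM: "N \<subseteq> carrier M" using N(1) submodule_subset by blast
  obtain n where n: "n \<in> N" "n \<noteq> \<zero>\<^bsub>M\<^esub>" using N submodule_zero[of N K M] by blast
  have nM: "n \<in> carrier M" using n(1) NM by blast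
  \<comment> \<open>By minimality \<open>n\<close> alone generates \<open>N\<close>. So the finite
    set spanning the orbit of \<open>n\<close> lies in \<open>N\<close> and spans it.\<close>
  have orb: "{n \<cdot> f |f. f \<in> dual K H} = N"
  proof -
    have "{n \<cdot> f |f. f \<in> dual K H} \<subseteq> N" using n(1) N(1) by blast
    from min[OF orbit_stable(1)[OF nM] this] show ?thesis
    proof
      assume "{n \<cdot> f |f. f \<in> dual K H} = {\<zero>\<^bsub>M\<^esub>}"
      then show ?thesis using orbit_stable(2)[OF nM] n(2) by (metis singletonD)
    qed
  qed
  obtain Y where Y: "finite Y" "Y \<subseteq> carrier M" "\<forall>f\<in>dual K H. n \<cdot> f \<in> lin_span K M Y"
    "\<forall>y\<in>Y. \<exists>f\<in>dual K H. y = n \<cdot> f"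
    using two_modules.contract_finite[OF two_modules_HM field_axioms coact_closed[OF nM]] unfolding dual_act_def by blast
  have YN: "Y \<subseteq> N" and NY: "N \<subseteq> lin_span K M Y" using Y(3,4) orb by blast+
  define A where "A = {f \<in> dual K H. \<forall>x\<in>N. x \<cdot> f = \<zero>\<^bsub>M\<^esub>}"
  \<comment> \<open>The vectors killed by \<open>f\<close> form a submodule, so killing the spanning
    set \<open>Y\<close> is enough.\<close>
  have AY: "f \<in> A" if f: "f \<in> dual K H" "\<forall>y\<in>Y. y \<cdot> f = \<zero>\<^bsub>M\<^esub>" for f
  proof -
    have "lin_span K M Y \<subseteq> {x \<in> carrier M. x \<cdot> f = \<zero>\<^bsub>M\<^esub>}"
      by (rule lin_span_least[OF kernel_submodule[OF modM modM dual_act_linear[OF f(1)]]]) (use f(2) Y(2) in auto)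
    then show ?thesis using f(1) NY by (auto simp: A_def)
  qed
  define C where "C = {h \<in> carrier H. \<forall>f\<in>A. f h = \<zero>}"
  have Ad: "f \<in> A \<Longrightarrow> f \<in> dual K H" for f by (simp add: A_def)
  interpret H: module K H by (rule modC)
  have C: "submodule C K H"
  proof (rule submoduleI'[OF modC])
    show "\<zero>\<^bsub>H\<^esub> \<in> C" using lin_zero[OF modC ground_mod Ad] module.carrier_is_submodule[OF modC]
      by (auto simp: C_def dest: submodule_zero)
    fix a assume "a \<in> C"
    then have a: "a \<in> carrier H" "\<And>f. f \<in> A \<Longrightarrow> f a = \<zero>" by (auto simp: C_def)
    show "a \<oplus>\<^bsub>H\<^esub> b \<in> C" if "b \<in> C" for b
    proof -
      have b: "b \<in> carrier H" "\<And>f. f \<in> A \<Longrightarrow> f b = \<zero>" using that by (auto simp: C_def)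
      show ?thesis by (simp add: C_def lin_add[OF Ad] a b)
    qed
    show "c \<odot>\<^bsub>H\<^esub> a \<in> C" if "c \<in> carrier K" for c
      by (simp add: C_def lin_smult[OF Ad] a that)
  qed (simp add: C_def subset_iff)
  have Csub: "subcoalgebra K H C"
    unfolding subcoalgebra_iff[OF C]
  proof (intro ballI conjI)
    fix d f assume d: "d \<in> C" and f: "f \<in> dual K H"
    have dH: "d \<in> carrier H" using d by (simp add: C_def)
    \<comment> \<open>The annihilator of \<open>N\<close> is a two-sided ideal: on one side because
      \<open>N\<close> is stable, on the other because the action fixes zero. Its common zeros
      \<open>C\<close> are therefore closed under both contractions.\<close>
    have cA: "convolution K H f a \<in> A" "convolution K H a f \<in> A" if a: "a \<in> A" for a
    proof -
      have a': "a \<in> dual K H" "\<And>x. x \<in> N \<Longrightarrow> x \<cdot> a = \<zero>\<^bsub>M\<^esub>" using a by (auto simp: A_def)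
      have "x \<cdot> (convolution K H f a) = \<zero>\<^bsub>M\<^esub>" if "x \<in> N" for x
        using dual_act_convolution[OF f a'(1), of x] a'(2)[of "x \<cdot> f"] that N(1) NM f by auto
      then show "convolution K H f a \<in> A" using convolution_dual[OF f a'(1)] by (simp add: A_def)
      have "x \<cdot> (convolution K H a f) = \<zero>\<^bsub>M\<^esub>" if "x \<in> N" for x
        using dual_act_convolution[OF a'(1) f, of x] a'(2)[of x] that NM f dual_act_zero by auto
      then show "convolution K H a f \<in> A" using convolution_dual[OF a'(1) f] by (simp add: A_def)
    qed
    have "a (contract_left K H f (comult H d)) = \<zero>" if "a \<in> A" for a
      using cA(1)[OF that] d by (simp add: C_def convolution_def)
    then show "contract_left K H f (comult H d) \<in> C"
      using lin_closed[OF contract_left_linear[OF modC modC f] comult_closed[OF dH]] by (simp add: C_def)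
    have "a (contract_right K H f (comult H d)) = \<zero>" if "a \<in> A" for a
      using cA(2)[OF that] d convolution_eq[OF Ad[OF that] f dH] by (simp add: C_def)
    then show "contract_right K H f (comult H d) \<in> C"
      using lin_closed[OF contract_right_linear[OF modC modC f] comult_closed[OF dH]] by (simp add: C_def)
  qed
  \<comment> \<open>Each \<open>y\<close> is controlled by finitely many elements of
    \<open>H\<close>; together they will span a space containing \<open>C\<close>.\<close>
  have "\<forall>y\<in>Y. \<exists>X. finite X \<and> X \<subseteq> carrier H \<and>
      (\<forall>f\<in>dual K H. (\<forall>x\<in>X. f x = \<zero>) \<longrightarrow> y \<cdot> f = \<zero>\<^bsub>M\<^esub>)"
  proof
    fix y assume "y \<in> Y"
    then have "y \<in> carrier M" using Y(2) by blast
    from two_modules.contract_finite[OF two_modules_HM field_axioms coact_closed[OF this]]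
    show "\<exists>X. finite X \<and> X \<subseteq> carrier H \<and>
      (\<forall>f\<in>dual K H. (\<forall>x\<in>X. f x = \<zero>) \<longrightarrow> y \<cdot> f = \<zero>\<^bsub>M\<^esub>)"
      unfolding dual_act_def by (elim exE conjE) (intro exI conjI)
  qed
  then obtain X where X: "\<forall>y\<in>Y. finite (X y) \<and> X y \<subseteq> carrier H \<and>
      (\<forall>f\<in>dual K H. (\<forall>x\<in>X y. f x = \<zero>) \<longrightarrow> y \<cdot> f = \<zero>\<^bsub>M\<^esub>)" by (rule bchoice[THEN exE])
  let ?X = "\<Union>y\<in>Y. X y"
  have XH: "finite ?X" "?X \<subseteq> carrier H" using X Y(1) by auto
  \<comment> \<open>A functional separating a point of \<open>C\<close> from this span vanishes on
    every \<open>X y\<close>, so it kills \<open>Y\<close> and belongs to \<open>A\<close>. But then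
    it vanishes on \<open>C\<close> as well.\<close>
  have CX: "C \<subseteq> lin_span K H ?X"
  proof (rule ccontr)
    assume "\<not> C \<subseteq> lin_span K H ?X"
    then obtain h where h: "h \<in> C" "h \<notin> lin_span K H ?X" by blast
    have hH: "h \<in> carrier H" using h(1) by (simp add: C_def)
    obtain f where f: "f \<in> dual K H" "\<And>w. w \<in> lin_span K H ?X \<Longrightarrow> f w = \<zero>" "f h = \<one>"
      using dual_separates[OF field_axioms modC lin_span_submodule[OF modC XH(2)] hH h(2)] by blast
    have "f \<in> A"
    proof (rule AY[OF f(1)], rule ballI)
      fix y assume y: "y \<in> Y"
      have "\<forall>x\<in>X y. f x = \<zero>" using f(2) lin_span_incl[of ?X K H] y by blast
      then show "y \<cdot> f = \<zero>\<^bsub>M\<^esub>" using X y f(1) by blast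
    qed
    then have "f h = \<zero>" using h(1) unfolding C_def by blast
    then show False using f(3) by simp
  qed
  \<comment> \<open>Take the matrix coefficient of \<open>n\<close> at a functional \<psi> with
    \<psi>(n) = 1. It lies in \<open>C\<close>, and its counit is \<psi>(n \<cdot> \<epsilon>) =
    \<psi>(n) = 1.\<close>
  have "C \<noteq> {\<zero>\<^bsub>H\<^esub>}"
  proof -
    obtain \<psi> where \<psi>: "\<psi> \<in> dual K M" "\<psi> n = \<one>"
      using dual_separates[OF field_axioms modM zero_submodule[OF modM] nM] n(2) by blast
    let ?c = "contract_right K H \<psi> (coact M n)"
    have cH: "?c \<in> carrier H"
      by (rule lin_closed[OF contract_right_linear[OF modC modM \<psi>(1)] coact_closed[OF nM]])
    have fc: "f ?c = \<psi> (n \<cdot> f)" if "f \<in> dual K H" for f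
      unfolding dual_act_def by (rule contract_swap[OF modC modM that \<psi>(1) coact_closed[OF nM]])
    have "f ?c = \<zero>" if "f \<in> A" for f
    proof -
      have "n \<cdot> f = \<zero>\<^bsub>M\<^esub>" using that n(1) unfolding A_def by blast
      then show ?thesis using fc[OF Ad[OF that]] lin_zero[OF modM ground_mod \<psi>(1)] by simp
    qed
    then have "?c \<in> C" using cH unfolding C_def by blast
    moreover have "counit H ?c = \<one>" using fc[OF counit_linear] dual_act_counit[OF nM] \<psi>(2) by simp
    then have "?c \<noteq> \<zero>\<^bsub>H\<^esub>" using lin_zero[OF modC ground_mod counit_linear] by auto
    ultimately show ?thesis by blast
  qed
  \<comment> \<open>A minimal nonzero subcoalgebra inside \<open>C\<close> is simple, since its own
    subcoalgebras lie in \<open>C\<close> again.\<close>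
  define F where "F = {D. subcoalgebra K H D \<and> D \<noteq> {\<zero>\<^bsub>H\<^esub>} \<and> D \<subseteq> C}"
  have CF: "C \<in> F" using Csub \<open>C \<noteq> {\<zero>\<^bsub>H\<^esub>}\<close> by (simp add: F_def)
  have "\<exists>W\<in>F. \<forall>W'\<in>F. W' \<subseteq> W \<longrightarrow> W' = W"
  proof (rule finite_span_minimal[OF field_axioms modC XH])
    show "F \<noteq> {}" using CF by blast
    show "submodule W K H \<and> W \<subseteq> lin_span K H ?X" if "W \<in> F" for W
    proof
      show "submodule W K H" using that by (simp add: F_def subcoalgebra_def)
      have "W \<subseteq> C" using that by (simp add: F_def)
      then show "W \<subseteq> lin_span K H ?X" using CX by (rule subset_trans)
    qed
  qed
  then obtain D where D: "D \<in> F" "\<forall>W'\<in>F. W' \<subseteq> D \<longrightarrow> W' = D" by (rule bexE)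
  have "simple_subcoalgebra K H D"
    unfolding simple_subcoalgebra_def
  proof (intro conjI allI impI)
    show "subcoalgebra K H D" "D \<noteq> {\<zero>\<^bsub>H\<^esub>}" using D(1) by (auto simp: F_def)
    fix E assume E: "subcoalgebra K H E \<and> E \<subseteq> D"
    show "E = {\<zero>\<^bsub>H\<^esub>} \<or> E = D"
    proof (rule disjCI)
      assume "E \<noteq> D"
      then have "E \<notin> F" using D(2) E by blast
      moreover have "E \<subseteq> C" using E D(1) by (auto simp: F_def)
      ultimately show "E = {\<zero>\<^bsub>H\<^esub>}" using E unfolding F_def by blast
    qed
  qed
  then have "one_dimensional K H D" by (rule pointed)
  moreover have "subcoalgebra K H D" "D \<subseteq> C" using D(1) by (auto simp: F_def)
  ultimately obtain g where g: "g \<in> grouplikes K H" "g \<in> C"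
    using one_dimensional_subcoalgebra by blast
  have "f g = \<zero>" if "f \<in> dual K H" "\<forall>y\<in>Y. y \<cdot> f = \<zero>\<^bsub>M\<^esub>" for f
    using AY[OF that] g(2) by (simp add: C_def)
  then obtain m where m: "m \<in> N" "m \<noteq> \<zero>\<^bsub>M\<^esub>" "\<forall>f\<in>dual K H. m \<cdot> f = f g \<odot>\<^bsub>M\<^esub> m"
    using eigenvector_exists[OF N(1) min g(1) Y(1) YN] by blast
  have "m \<in> carrier M" "g \<in> carrier H" using m(1) NM g(1) by (auto simp: grouplike_group_def)
  then show ?thesis using dual_act_grouplike m g(1) by blast
qed

end

section \<open>Grouplike elements and twisted comodule algebras\<close>

lemma contract_left_cong:
  assumes "module K M" "module K N" "f \<in> dual K M" "g \<in> dual K M"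
    and "\<And>x. x \<in> carrier M \<Longrightarrow> f x = g x" "t \<in> carrier (tensor_product K M N)"
  shows "contract_left K N f t = contract_left K N g t"
proof (rule tensor_linear_eqI[OF assms(1,2,2) contract_left_linear[OF assms(1-3)]
      contract_left_linear[OF assms(1,2,4)] _ assms(6)])
qed (simp add: contract_left_pure[OF assms(1,2)] assms(3-5))

text \<open>Multiplying by a pure tensor acts on the two factors separately. This describes
  \<Delta>(g h) for grouplike \<open>g\<close>, and \<rho>(m a) when \<rho>(m) = g \<otimes>
  m.\<close>

lemma tensor_pairing_pure_left:
  assumes "module K A" "module K B" "module K C" "module K D" "module K P" "module K Q"
    and p: "p \<in> bilinear_maps K A B P" and q: "q \<in> bilinear_maps K C D Q"
    and ac: "a \<in> carrier A" "c \<in> carrier C" and u: "u \<in> carrier (tensor_product K B D)"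
  shows "tensor_pairing K P Q p q (pure_tensor K A C a c) u = tensor_map K P Q (p a) (q c) u"
proof (rule tensor_linear_eqI[OF assms(2,4) tensor_module[OF assms(5,6)] _ _ _ u])
  note pa = bilin_right[OF p ac(1)] and qc = bilin_right[OF q ac(2)]
  show "tensor_pairing K P Q p q (pure_tensor K A C a c) \<in> linear_maps K (tensor_product K B D) (tensor_product K P Q)"
    by (rule bilin_right[OF tensor_pairing_bilinear[OF assms(1-8)] pure_closed[OF assms(1,3) ac]])
  show "tensor_map K P Q (p a) (q c) \<in> linear_maps K (tensor_product K B D) (tensor_product K P Q)"
    by (rule tensor_map_linear[OF assms(2,4,5,6) pa qc])
  fix b d assume bd: "b \<in> carrier B" "d \<in> carrier D"
  show "tensor_pairing K P Q p q (pure_tensor K A C a c) (pure_tensor K B D b d) =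
      tensor_map K P Q (p a) (q c) (pure_tensor K B D b d)"
    by (simp only: tensor_pairing_pure[OF assms(1-8) ac(1) bd(1) ac(2) bd(2)]
        tensor_map_pure[OF assms(2,4,5,6) pa qc bd])
qed

lemma grouplike_closed: "g \<in> grouplikes K H \<Longrightarrow> g \<in> carrier H"
  by (simp add: grouplike_group_def)

lemma mult_bilinear:
  assumes "unital_algebra K A" shows "monoid.mult A \<in> bilinear_maps K A A A"
proof -
  interpret unital_algebra K A by fact
  show ?thesis
    by (intro bilinI linI)
      (simp_all add: smult_mult_left smult_mult_right A.l_distr A.r_distr)
qed

context bialgebra
begin

lemma unital_H: "unital_algebra K H" by (rule unital_algebra_axioms)

lemma left_mult_linear: "g \<in> carrier H \<Longrightarrow> (monoid.mult H g) \<in> linear_maps K H H"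
  by (rule bilin_right[OF mult_bilinear[OF unital_H]])

lemma comult_grouplike_mult:
  assumes "g \<in> grouplikes K H" "h \<in> carrier H"
  shows "comult H (g \<otimes>\<^bsub>H\<^esub> h) = tensor_map K H H (monoid.mult H g) (monoid.mult H g) (comult H h)"
proof -
  note mb = mult_bilinear[OF unital_H]
  have g: "g \<in> carrier H" "comult H g = pure_tensor K H H g g" using assms by (simp_all add: grouplike_group_def)
  have "comult H (g \<otimes>\<^bsub>H\<^esub> h) = tensor_pairing K H H (monoid.mult H) (monoid.mult H) (comult H g) (comult H h)"
    using ring_hom_mult[OF comult_ring_hom g(1) assms(2)] by (simp add: tensor_algebra_def)
  also have "\<dots> = tensor_map K H H (monoid.mult H g) (monoid.mult H g) (comult H h)"
    unfolding g(2) by (rule tensor_pairing_pure_left[OF modC modC modC modC modC modC mb mb g(1,1) comult_closed[OF assms(2)]])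
  finally show ?thesis .
qed

lemma counit_grouplike_mult:
  assumes "g \<in> grouplikes K H" "h \<in> carrier H"
  shows "counit H (g \<otimes>\<^bsub>H\<^esub> h) = counit H h"
proof -
  have g: "g \<in> carrier H" "counit H g = \<one>\<^bsub>K\<^esub>" using assms by (simp_all add: grouplike_group_def)
  have "counit H h \<in> carrier K" using lin_closed[OF counit_linear assms(2)] by simp
  then show ?thesis using ring_hom_mult[OF counit_ring_hom g(1) assms(2)] g(2) by simp
qed

lemma comult_one: "comult H \<one>\<^bsub>H\<^esub> = pure_tensor K H H \<one>\<^bsub>H\<^esub> \<one>\<^bsub>H\<^esub>"
  using ring_hom_one[OF comult_ring_hom] by (simp add: tensor_algebra_def)

lemma one_grouplike: "\<one>\<^bsub>H\<^esub> \<in> grouplikes K H"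
  using comult_one ring_hom_one[OF counit_ring_hom] by (simp add: grouplike_group_def)

lemma mult_grouplike:
  assumes "g \<in> grouplikes K H" "h \<in> grouplikes K H"
  shows "g \<otimes>\<^bsub>H\<^esub> h \<in> grouplikes K H"
proof -
  have g: "g \<in> carrier H" and h: "h \<in> carrier H" "comult H h = pure_tensor K H H h h" "counit H h = \<one>\<^bsub>K\<^esub>"
    using assms by (simp_all add: grouplike_group_def)
  have "comult H (g \<otimes>\<^bsub>H\<^esub> h) = pure_tensor K H H (g \<otimes>\<^bsub>H\<^esub> h) (g \<otimes>\<^bsub>H\<^esub> h)"
    unfolding comult_grouplike_mult[OF assms(1) h(1)] h(2)
    by (rule tensor_map_pure[OF modC modC modC modC left_mult_linear[OF g] left_mult_linear[OF g] h(1,1)])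
  then show ?thesis using g h counit_grouplike_mult[OF assms(1) h(1)] by (simp add: grouplike_group_def)
qed

text \<open>Insert the identity x = s (g x) in both factors: \<Delta>(s) = (s \<otimes> s) (g
  \<otimes> g) \<Delta>(s) = (s \<otimes> s) \<Delta>(g s) = s \<otimes> s.\<close>

lemma inverse_grouplike:
  assumes g: "g \<in> grouplikes K H" and s: "s \<in> carrier H"
    and sg: "s \<otimes>\<^bsub>H\<^esub> g = \<one>\<^bsub>H\<^esub>" "g \<otimes>\<^bsub>H\<^esub> s = \<one>\<^bsub>H\<^esub>"
  shows "s \<in> grouplikes K H"
proof -
  note gH = grouplike_closed[OF g]
  note l = left_mult_linear[OF gH] and m = left_mult_linear[OF s]
  have sgx: "s \<otimes>\<^bsub>H\<^esub> (g \<otimes>\<^bsub>H\<^esub> x) = x" if "x \<in> carrier H" for x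
    using that s gH sg(1) A.m_assoc[OF s gH that] by simp
  have "comult H s = tensor_map K H H (\<lambda>x. s \<otimes>\<^bsub>H\<^esub> (g \<otimes>\<^bsub>H\<^esub> x)) (\<lambda>x. s \<otimes>\<^bsub>H\<^esub> (g \<otimes>\<^bsub>H\<^esub> x)) (comult H s)"
    by (rule tensor_map_id[OF modC modC lin_comp[OF l m] lin_comp[OF l m] sgx sgx comult_closed[OF s], symmetric])
  also have "\<dots> = tensor_map K H H (monoid.mult H s) (monoid.mult H s) (comult H (g \<otimes>\<^bsub>H\<^esub> s))"
    unfolding comult_grouplike_mult[OF g s]
    by (rule tensor_map_comp[OF modC modC modC modC modC modC l l m m comult_closed[OF s], symmetric])
  also have "\<dots> = pure_tensor K H H s s"
    unfolding sg(2) comult_one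
    using tensor_map_pure[OF modC modC modC modC m m, of "\<one>\<^bsub>H\<^esub>" "\<one>\<^bsub>H\<^esub>"] s by simp
  finally have "comult H s = pure_tensor K H H s s" .
  moreover have "counit H s = \<one>\<^bsub>K\<^esub>"
    using counit_grouplike_mult[OF g s] sg(2) ring_hom_one[OF counit_ring_hom] by simp
  ultimately show ?thesis using s by (simp add: grouplike_group_def)
qed

end

text \<open>On \<Delta>(g) = g \<otimes> g the two antipode axioms become the equations of a
  two-sided inverse.\<close>

lemma (in hopf_algebra) antipode_grouplike:
  assumes g: "g \<in> grouplikes K H"
  shows "antipode H g \<in> carrier H" "antipode H g \<otimes>\<^bsub>H\<^esub> g = \<one>\<^bsub>H\<^esub>" "g \<otimes>\<^bsub>H\<^esub> antipode H g = \<one>\<^bsub>H\<^esub>"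
proof -
  have gH: "g \<in> carrier H" "comult H g = pure_tensor K H H g g" "counit H g = \<one>\<^bsub>K\<^esub>"
    using g by (simp_all add: grouplike_group_def)
  show "antipode H g \<in> carrier H" by (rule lin_closed[OF antipode_linear gH(1)])
  note mb = mult_bilinear[OF unital_H]
  have "tensor_lift K H (\<lambda>x y. antipode H x \<otimes>\<^bsub>H\<^esub> y) (pure_tensor K H H g g) = antipode H g \<otimes>\<^bsub>H\<^esub> g"
    by (rule tensor_lift_pure[OF modC modC modC bilin_precomp[OF mb antipode_linear lin_id] gH(1,1)])
  then show "antipode H g \<otimes>\<^bsub>H\<^esub> g = \<one>\<^bsub>H\<^esub>" using antipode_left[OF gH(1)] gH by simp
  have "tensor_lift K H (\<lambda>x y. x \<otimes>\<^bsub>H\<^esub> antipode H y) (pure_tensor K H H g g) = g \<otimes>\<^bsub>H\<^esub> antipode H g"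
    by (rule tensor_lift_pure[OF modC modC modC bilin_precomp[OF mb lin_id antipode_linear] gH(1,1)])
  then show "g \<otimes>\<^bsub>H\<^esub> antipode H g = \<one>\<^bsub>H\<^esub>" using antipode_right[OF gH(1)] gH by simp
qed

lemma (in hopf_algebra) grouplike_group_is_group: "group (grouplike_group K H)"
proof (rule groupI)
  note sub = grouplike_closed[of _ K H]
  have ops: "\<one>\<^bsub>grouplike_group K H\<^esub> = \<one>\<^bsub>H\<^esub>" "\<And>x y. x \<otimes>\<^bsub>grouplike_group K H\<^esub> y = x \<otimes>\<^bsub>H\<^esub> y"
    by (simp_all add: grouplike_group_def)
  fix x assume x: "x \<in> grouplikes K H"
  show "\<one>\<^bsub>grouplike_group K H\<^esub> \<otimes>\<^bsub>grouplike_group K H\<^esub> x = x" using sub[OF x] by (simp add: ops)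
  note s = antipode_grouplike[OF x]
  show "\<exists>y\<in>grouplikes K H. y \<otimes>\<^bsub>grouplike_group K H\<^esub> x = \<one>\<^bsub>grouplike_group K H\<^esub>"
    using inverse_grouplike[OF x s] s(2) by (auto simp: ops)
  fix y assume y: "y \<in> grouplikes K H"
  show "x \<otimes>\<^bsub>grouplike_group K H\<^esub> y \<in> grouplikes K H"
    using mult_grouplike[OF x y] by (simp add: ops)
  fix z assume z: "z \<in> grouplikes K H"
  show "x \<otimes>\<^bsub>grouplike_group K H\<^esub> y \<otimes>\<^bsub>grouplike_group K H\<^esub> z =
      x \<otimes>\<^bsub>grouplike_group K H\<^esub> (y \<otimes>\<^bsub>grouplike_group K H\<^esub> z)"
    using A.m_assoc[OF sub[OF x] sub[OF y] sub[OF z]] by (simp add: ops)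
next
  have "\<one>\<^bsub>grouplike_group K H\<^esub> = \<one>\<^bsub>H\<^esub>" by (simp add: grouplike_group_def)
  then show "\<one>\<^bsub>grouplike_group K H\<^esub> \<in> grouplikes K H" using one_grouplike by simp
qed

section \<open>The twist of a comodule algebra by a grouplike element\<close>

lemma twisted_simps [simp]:
  "carrier (twisted K H A g) = carrier A" "\<zero>\<^bsub>twisted K H A g\<^esub> = \<zero>\<^bsub>A\<^esub>"
  "add (twisted K H A g) = add A" "smult (twisted K H A g) = smult A"
  "act (twisted K H A g) = monoid.mult A"
  "coact (twisted K H A g) a = tensor_map K H A (monoid.mult H g) (\<lambda>x. x) (coact A a)"
  by (simp_all add: twisted_def)

lemma twisted_linear_maps [simp]:
  "linear_maps K M (twisted K H A g) = linear_maps K M A"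
  "linear_maps K (twisted K H A g) N = linear_maps K A N"
  by (simp_all add: linear_maps_def hom_def)

text \<open>These constructions see the carrier and the linear structure, which the twist shares
  with \<open>A\<close>. The tensor products are therefore equal and not merely isomorphic, and
  coactions can be compared without transport.\<close>

lemma twisted_tensor_product [simp]:
  "tensor_product K M (twisted K H A g) = tensor_product K M A"
  "pure_tensor K M (twisted K H A g) = pure_tensor K M A"
  by (simp_all add: fun_eq_iff tensor_product_def pure_tensor_def tensor_null_def tensor_relations_def)

lemma twisted_tensor_maps [simp]:
  "tensor_map K P (twisted K H A g) = tensor_map K P A"
  "tensor_assoc K L M (twisted K H A g) = tensor_assoc K L M A"
  "tensor_pairing K P (twisted K H A g) = tensor_pairing K P A"
  by (simp_all add: fun_eq_iff tensor_map_def tensor_assoc_def tensor_pairing_def)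

lemma twisted_module:
  assumes "module K A" shows "module K (twisted K H A g)"
proof -
  interpret module K A by fact
  have "abelian_group (twisted K H A g)"
  proof (rule abelian_groupI)
    fix x assume "x \<in> carrier (twisted K H A g)"
    then show "\<exists>y\<in>carrier (twisted K H A g). y \<oplus>\<^bsub>twisted K H A g\<^esub> x = \<zero>\<^bsub>twisted K H A g\<^esub>"
      by (intro bexI[of _ "\<ominus>\<^bsub>A\<^esub> x"]) (simp_all add: M.l_neg)
  qed (simp_all add: M.a_assoc M.a_comm M.a_lcomm)
  then show ?thesis
    by (intro moduleI R.is_cring) (simp_all add: smult_l_distr smult_r_distr smult_assoc1)
qed

context left_comodule_algebra
begin

lemma modA: "module K A" by (rule modM)

lemma unital_A: "unital_algebra K A" by (rule A.unital_algebra_axioms)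

lemma coact_mult:
  "\<lbrakk>a \<in> carrier A; b \<in> carrier A\<rbrakk> \<Longrightarrow>
    coact A (a \<otimes>\<^bsub>A\<^esub> b) = tensor_pairing K H A (monoid.mult H) (monoid.mult A) (coact A a) (coact A b)"
  using ring_hom_mult[OF coact_ring_hom] by (simp add: tensor_algebra_def)

lemma coact_one: "coact A \<one>\<^bsub>A\<^esub> = pure_tensor K H A \<one>\<^bsub>H\<^esub> \<one>\<^bsub>A\<^esub>"
  using ring_hom_one[OF coact_ring_hom] by (simp add: tensor_algebra_def)

lemma translate_linear:
  "g \<in> carrier H \<Longrightarrow> tensor_map K H A (monoid.mult H g) (\<lambda>x. x) \<in> linear_maps K (tensor_product K H A) (tensor_product K H A)"
  by (rule tensor_map_linear[OF modC modA modC modA left_mult_linear lin_id])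

lemma translate_pure:
  "\<lbrakk>g \<in> carrier H; h \<in> carrier H; a \<in> carrier A\<rbrakk> \<Longrightarrow>
    tensor_map K H A (monoid.mult H g) (\<lambda>x. x) (pure_tensor K H A h a) = pure_tensor K H A (g \<otimes>\<^bsub>H\<^esub> h) a"
  by (rule tensor_map_pure[OF modC modA modC modA left_mult_linear lin_id])

text \<open>Left translation of the first factor commutes with right multiplication, by
  associativity in \<open>H\<close>. Both arguments are tensors, so pure tensors are reached first
  in \<open>u\<close>, then in \<open>t\<close>. It makes the twisted coaction compatible with the
  action of \<open>A\<close>.\<close>

lemma translate_pairing:
  assumes g: "g \<in> carrier H" and t: "t \<in> carrier (tensor_product K H A)" and u: "u \<in> carrier (tensor_product K H A)"
  shows "tensor_map K H A (monoid.mult H g) (\<lambda>x. x) (tensor_pairing K H A (monoid.mult H) (monoid.mult A) t u) =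
    tensor_pairing K H A (monoid.mult H) (monoid.mult A) (tensor_map K H A (monoid.mult H g) (\<lambda>x. x) t) u"
proof -
  let ?L = "tensor_map K H A (monoid.mult H g) (\<lambda>x. x)"
  let ?P = "tensor_pairing K H A (monoid.mult H) (monoid.mult A)"
  note HAm = tensor_module[OF modC modA]
  note mH = mult_bilinear[OF unital_H] and mA = mult_bilinear[OF unital_A]
  note L = translate_linear[OF g] and P = tensor_pairing_bilinear[OF modC modC modA modA modC modA mH mA]
  note Pp = tensor_pairing_pure[OF modC modC modA modA modC modA mH mA]
  have 1: "?L (?P (pure_tensor K H A h a) u) = ?P (?L (pure_tensor K H A h a)) u"
    if ha: "h \<in> carrier H" "a \<in> carrier A" for h a
  proof (rule tensor_linear_eqI[OF modC modA HAm _ _ _ u])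
    note p = pure_closed[OF modC modA ha]
    show "(\<lambda>u. ?L (?P (pure_tensor K H A h a) u)) \<in> linear_maps K (tensor_product K H A) (tensor_product K H A)"
      by (rule lin_comp[OF bilin_right[OF P p] L])
    show "?P (?L (pure_tensor K H A h a)) \<in> linear_maps K (tensor_product K H A) (tensor_product K H A)"
      by (rule bilin_right[OF P lin_closed[OF L p]])
    fix k b assume kb: "k \<in> carrier H" "b \<in> carrier A"
    have c: "h \<otimes>\<^bsub>H\<^esub> k \<in> carrier H" "a \<otimes>\<^bsub>A\<^esub> b \<in> carrier A" "g \<otimes>\<^bsub>H\<^esub> h \<in> carrier H"
      using g ha kb by simp_all
    have "g \<otimes>\<^bsub>H\<^esub> (h \<otimes>\<^bsub>H\<^esub> k) = g \<otimes>\<^bsub>H\<^esub> h \<otimes>\<^bsub>H\<^esub> k" by (rule H.A.m_assoc[OF g ha(1) kb(1), symmetric])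
    then show "?L (?P (pure_tensor K H A h a) (pure_tensor K H A k b)) = ?P (?L (pure_tensor K H A h a)) (pure_tensor K H A k b)"
      by (simp only: Pp[OF ha(1) kb(1) ha(2) kb(2)] translate_pure[OF g c(1,2)] translate_pure[OF g ha]
          Pp[OF c(3) kb(1) ha(2) kb(2)])
  qed
  show ?thesis
  proof (rule tensor_linear_eqI[OF modC modA HAm _ _ _ t])
    show "?L (?P (pure_tensor K H A h a) u) = ?P (?L (pure_tensor K H A h a)) u"
      if "h \<in> carrier H" "a \<in> carrier A" for h a by (rule 1[OF that])
    show "(\<lambda>t. ?L (?P t u)) \<in> linear_maps K (tensor_product K H A) (tensor_product K H A)"
      by (rule lin_comp[OF bilin_left[OF P u] L])
    show "(\<lambda>t. ?P (?L t) u) \<in> linear_maps K (tensor_product K H A) (tensor_product K H A)"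
      by (rule lin_comp[OF L bilin_left[OF P u]])
  qed
qed

lemma translate_dual: "g \<in> carrier H \<Longrightarrow> f \<in> dual K H \<Longrightarrow> (\<lambda>h. f (g \<otimes>\<^bsub>H\<^esub> h)) \<in> dual K H"
  by (rule lin_comp[OF left_mult_linear])

lemma contract_translate:
  assumes "g \<in> carrier H" "f \<in> dual K H" "t \<in> carrier (tensor_product K H A)"
  shows "contract_left K A f (tensor_map K H A (monoid.mult H g) (\<lambda>x. x) t) = contract_left K A (\<lambda>h. f (g \<otimes>\<^bsub>H\<^esub> h)) t"
  by (rule contract_left_tensor_map[OF modC modA modC modA left_mult_linear[OF assms(1)] lin_id assms(2,3)])

text \<open>A contraction into the twist sums in another record than one into \<open>A\<close>, so
  the two are compared on pure tensors, where both give f(x) y.\<close>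

lemma contract_twisted:
  assumes "f \<in> dual K H" "t \<in> carrier (tensor_product K H A)"
  shows "contract_left K (twisted K H A g) f t = contract_left K A f t"
proof (rule tensor_linear_eqI[OF modC modA modA _ contract_left_linear[OF modC modA assms(1)] _ assms(2)])
  note tw = twisted_module[OF modA, of H g]
  show "contract_left K (twisted K H A g) f \<in> linear_maps K (tensor_product K H A) A"
    using contract_left_linear[OF modC tw assms(1)] by simp
  fix x y assume xy: "x \<in> carrier H" "y \<in> carrier A"
  show "contract_left K (twisted K H A g) f (pure_tensor K H A x y) = contract_left K A f (pure_tensor K H A x y)"
    using contract_left_pure[OF modC tw assms(1) xy(1), of y] xy contract_left_pure[OF modC modA assms(1) xy] by simp
qed

text \<open>Twisting changes the dual action by translating the functional, which reduces statements
  about the twist to statements about \<open>A\<close>.\<close>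

lemma twisted_dual_act:
  assumes "g \<in> carrier H" "a \<in> carrier A" "\<phi> \<in> dual K H"
  shows "dual_act K (twisted K H A g) a \<phi> = dual_act K A a (\<lambda>h. \<phi> (g \<otimes>\<^bsub>H\<^esub> h))"
  unfolding dual_act_def twisted_simps(6)
    contract_twisted[OF assms(3) lin_closed[OF translate_linear[OF assms(1)] coact_closed[OF assms(2)]]]
  by (rule contract_translate[OF assms(1,3) coact_closed[OF assms(2)]])

lemma dual_act_cong:
  assumes "f \<in> dual K H" "h \<in> dual K H" "\<And>x. x \<in> carrier H \<Longrightarrow> f x = h x" "a \<in> carrier A"
  shows "dual_act K A a f = dual_act K A a h"
  unfolding dual_act_def by (rule contract_left_cong[OF modC modA assms(1-3) coact_closed[OF assms(4)]])

text \<open>Translating functionals by a grouplike \<open>g\<close> respects convolution and fixes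
  the counit, since \<Delta>(g x) = (g \<otimes> g) \<Delta>(x) and \<epsilon>(g x) = \<epsilon>(x).
  So the translated action is again an action, and \<open>coassoc_iff\<close> converts this back
  into coassociativity.\<close>

lemma twisted_left_comodule:
  assumes g: "g \<in> grouplikes K H"
  shows "left_comodule K H (twisted K H A g)"
proof (intro left_comodule.intro left_comodule_axioms.intro)
  let ?tw = "twisted K H A g"
  note gH = grouplike_closed[OF g]
  note L = translate_linear[OF gH] and lg = left_mult_linear[OF gH]
  show "coalgebra K H" by (rule H.coalgebra_axioms)
  show tw: "module K ?tw" by (rule twisted_module[OF modA])
  have "coact ?tw \<in> linear_maps K A (tensor_product K H A)"
    unfolding twisted_simps(6)[abs_def] by (rule lin_comp[OF coact_linear L])
  then show cl: "coact ?tw \<in> linear_maps K ?tw (tensor_product K H ?tw)" by simp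
  fix a assume a': "a \<in> carrier ?tw"
  then have a: "a \<in> carrier A" by simp
  have "dual_act K ?tw a (convolution K H f h) = dual_act K ?tw (dual_act K ?tw a f) h"
    if f: "f \<in> dual K H" and h: "h \<in> dual K H" for f h
  proof -
    note fg = translate_dual[OF gH f] and hg = translate_dual[OF gH h]
    have "dual_act K ?tw a (convolution K H f h) = dual_act K A a (\<lambda>x. convolution K H f h (g \<otimes>\<^bsub>H\<^esub> x))"
      by (rule twisted_dual_act[OF gH a convolution_dual[OF f h]])
    also have "\<dots> = dual_act K A a (convolution K H (\<lambda>x. f (g \<otimes>\<^bsub>H\<^esub> x)) (\<lambda>x. h (g \<otimes>\<^bsub>H\<^esub> x)))"
    proof (rule dual_act_cong[OF translate_dual[OF gH convolution_dual[OF f h]] convolution_dual[OF fg hg] _ a])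
      fix x assume x: "x \<in> carrier H"
      show "convolution K H f h (g \<otimes>\<^bsub>H\<^esub> x) = convolution K H (\<lambda>x. f (g \<otimes>\<^bsub>H\<^esub> x)) (\<lambda>x. h (g \<otimes>\<^bsub>H\<^esub> x)) x"
        unfolding convolution_def comult_grouplike_mult[OF g x]
        by (simp only: contract_left_tensor_map[OF modC modC modC modC lg lg f comult_closed[OF x]])
    qed
    also have "\<dots> = dual_act K ?tw (dual_act K ?tw a f) h"
      unfolding twisted_dual_act[OF gH a f] twisted_dual_act[OF gH dual_act_closed[OF fg a] h]
      by (rule dual_act_convolution[OF fg hg a])
    finally show ?thesis .
  qed
  then show "tensor_assoc K H H ?tw (tensor_map K (tensor_product K H H) ?tw (comult H) (\<lambda>x. x) (coact ?tw a)) =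
      tensor_map K H (tensor_product K H ?tw) (\<lambda>h. h) (coact ?tw) (coact ?tw a)"
    unfolding coassoc_iff[OF tw cl a'] by blast
  have "dual_act K ?tw a (counit H) = dual_act K A a (counit H)"
    unfolding twisted_dual_act[OF gH a counit_linear]
    by (rule dual_act_cong[OF translate_dual[OF gH counit_linear] counit_linear counit_grouplike_mult[OF g] a])
  then show "tensor_lift K ?tw (\<lambda>h x. counit H h \<odot>\<^bsub>?tw\<^esub> x) (coact ?tw a) = a"
    using dual_act_counit[OF a] by (simp add: dual_act_def contract_left_def)
qed

lemma twisted_hopf_module:
  assumes g: "g \<in> grouplikes K H"
  shows "hopf_module K H A (twisted K H A g)"
proof (intro hopf_module.intro hopf_module_axioms.intro)
  show "left_comodule_algebra K H A" by (rule left_comodule_algebra_axioms)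
  show "left_comodule K H (twisted K H A g)" by (rule twisted_left_comodule[OF g])
  note gH = grouplike_closed[OF g]
  fix m a assume "m \<in> carrier (twisted K H A g)" and a: "a \<in> carrier A"
  then have m: "m \<in> carrier A" by simp
  show "coact (twisted K H A g) (act (twisted K H A g) m a) =
      tensor_pairing K H (twisted K H A g) (monoid.mult H) (act (twisted K H A g)) (coact (twisted K H A g) m) (coact A a)"
    by (simp add: coact_mult[OF m a] translate_pairing[OF gH coact_closed[OF m] coact_closed[OF a]])
qed (simp_all add: A.l_distr A.r_distr A.smult_mult_left A.smult_mult_right A.m_assoc)

end

section \<open>Homomorphisms of relative Hopf modules\<close>

lemma hopf_module_comodule: "hopf_module K H A M \<Longrightarrow> left_comodule K H M"
  by (rule hopf_module.axioms(2))

lemma hopf_module_module: "hopf_module K H A M \<Longrightarrow> module K M"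
  by (rule left_comodule.modM[OF hopf_module_comodule])

lemma comodule_map_iff:
  assumes M: "left_comodule K H M" and N: "left_comodule K H N"
    and f: "f \<in> linear_maps K M N" and m: "m \<in> carrier M"
  shows "coact N (f m) = tensor_map K H N (\<lambda>h. h) f (coact M m) \<longleftrightarrow>
    (\<forall>\<phi>\<in>dual K H. dual_act K N (f m) \<phi> = f (dual_act K M m \<phi>))"
proof -
  interpret M: left_comodule K H M by (rule M)
  interpret N: left_comodule K H N by (rule N)
  note tm = tensor_map_linear[OF M.modC M.modM M.modC N.modM lin_id f]
  have c: "contract_left K N \<phi> (tensor_map K H N (\<lambda>h. h) f (coact M m)) = f (dual_act K M m \<phi>)"
    if "\<phi> \<in> dual K H" for \<phi>
    unfolding dual_act_def
    by (rule contract_left_tensor_map[OF M.modC M.modM M.modC N.modM lin_id f that M.coact_closed[OF m]])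
  show ?thesis
  proof
    assume eq: "coact N (f m) = tensor_map K H N (\<lambda>h. h) f (coact M m)"
    show "\<forall>\<phi>\<in>dual K H. dual_act K N (f m) \<phi> = f (dual_act K M m \<phi>)"
      using c by (simp add: dual_act_def[of K N] eq)
  next
    assume *: "\<forall>\<phi>\<in>dual K H. dual_act K N (f m) \<phi> = f (dual_act K M m \<phi>)"
    show "coact N (f m) = tensor_map K H N (\<lambda>h. h) f (coact M m)"
      by (rule N.coact_eqI[OF lin_closed[OF tm M.coact_closed[OF m]] lin_closed[OF f m]])
        (use * c in simp)
  qed
qed

lemma hopf_module_hom_iff:
  assumes "hopf_module K H A M" "hopf_module K H A N"
  shows "f \<in> hopf_module_hom K H A M N \<longleftrightarrow> f \<in> linear_maps K M N \<and>
    (\<forall>m\<in>carrier M. \<forall>\<phi>\<in>dual K H. dual_act K N (f m) \<phi> = f (dual_act K M m \<phi>)) \<and>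
    (\<forall>m\<in>carrier M. \<forall>a\<in>carrier A. f (act M m a) = act N (f m) a)"
  using comodule_map_iff[OF assms[THEN hopf_module_comodule]] unfolding hopf_module_hom_def by blast

lemma hopf_submoduleI:
  assumes "hopf_module K H A M" "submodule N K M"
    and "\<And>n \<phi>. \<lbrakk>n \<in> N; \<phi> \<in> dual K H\<rbrakk> \<Longrightarrow> dual_act K M n \<phi> \<in> N"
    and "\<And>n a. \<lbrakk>n \<in> N; a \<in> carrier A\<rbrakk> \<Longrightarrow> act M n a \<in> N"
  shows "hopf_submodule K H A M N"
  using assms(3,4) left_comodule.subcomodule_iff[OF hopf_module_comodule[OF assms(1)] assms(2)]
  by (simp add: hopf_submodule_def)

lemma hopf_module_iso_refl:
  assumes "hopf_module K H A M" shows "hopf_module_iso K H A M M"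
proof -
  have "(\<lambda>x. x) \<in> hopf_module_hom K H A M M"
    unfolding hopf_module_hom_iff[OF assms assms] by (simp add: lin_id)
  then show ?thesis unfolding hopf_module_iso_def by (intro bexI[of _ "\<lambda>x. x"]) simp_all
qed

lemma hopf_module_iso_sym: "hopf_module_iso K H A M N \<Longrightarrow> hopf_module_iso K H A N M"
  unfolding hopf_module_iso_def by blast

lemma hopf_module_hom_closed: "\<lbrakk>f \<in> hopf_module_hom K H A M N; m \<in> carrier M\<rbrakk> \<Longrightarrow> f m \<in> carrier N"
  by (rule lin_closed[of f K M N]) (simp_all add: hopf_module_hom_def)

lemma hopf_module_hom_comp:
  assumes M: "hopf_module K H A M" and N: "hopf_module K H A N" and P: "hopf_module K H A P"
    and f: "f \<in> hopf_module_hom K H A M N" and g: "g \<in> hopf_module_hom K H A N P"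
  shows "(\<lambda>x. g (f x)) \<in> hopf_module_hom K H A M P"
  using f g hopf_module_hom_closed[OF f] unfolding hopf_module_hom_iff[OF M N] hopf_module_hom_iff[OF N P] hopf_module_hom_iff[OF M P]
  by (auto intro: lin_comp[of f K M N])

lemma hopf_module_iso_trans:
  assumes "hopf_module K H A M" "hopf_module K H A N" "hopf_module K H A P"
    and "hopf_module_iso K H A M N" "hopf_module_iso K H A N P"
  shows "hopf_module_iso K H A M P"
proof -
  obtain f f' where f: "f \<in> hopf_module_hom K H A M N" "f' \<in> hopf_module_hom K H A N M"
    "\<forall>m\<in>carrier M. f' (f m) = m" "\<forall>n\<in>carrier N. f (f' n) = n"
    using assms(4) unfolding hopf_module_iso_def by blast
  obtain g g' where g: "g \<in> hopf_module_hom K H A N P" "g' \<in> hopf_module_hom K H A P N"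
    "\<forall>m\<in>carrier N. g' (g m) = m" "\<forall>n\<in>carrier P. g (g' n) = n"
    using assms(5) unfolding hopf_module_iso_def by blast
  note c = hopf_module_hom_closed[OF f(1)] hopf_module_hom_closed[OF g(2)]
  show ?thesis
    unfolding hopf_module_iso_def
  proof (intro bexI conjI ballI)
    show "(\<lambda>x. g (f x)) \<in> hopf_module_hom K H A M P" by (rule hopf_module_hom_comp[OF assms(1-3) f(1) g(1)])
    show "(\<lambda>x. f' (g' x)) \<in> hopf_module_hom K H A P M" by (rule hopf_module_hom_comp[OF assms(3,2,1) g(2) f(2)])
  qed (use f g c in auto)
qed

lemma iso_class_eq_iff:
  assumes "hopf_module K H A M" "hopf_module K H A N"
  shows "iso_class K H A M = iso_class K H A N \<longleftrightarrow> hopf_module_iso K H A M N"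
proof
  assume "iso_class K H A M = iso_class K H A N"
  moreover have "N \<in> iso_class K H A N" using assms hopf_module_iso_refl by (auto simp: iso_class_def)
  ultimately have "N \<in> iso_class K H A M" by blast
  then show "hopf_module_iso K H A M N" by (simp add: iso_class_def)
next
  assume "hopf_module_iso K H A M N"
  then show "iso_class K H A M = iso_class K H A N"
    using hopf_module_iso_trans hopf_module_iso_sym assms unfolding iso_class_def by blast
qed

text \<open>Schur's lemma: kernel and image are subobjects, and the vector \<open>u\<close> excludes
  a full kernel and a zero image, so \<open>f\<close> is bijective.\<close>

lemma simple_hopf_module_hom_iso:
  assumes M: "simple_hopf_module K H A M" and N: "simple_hopf_module K H A N"
    and f: "f \<in> hopf_module_hom K H A M N" and nz: "u \<in> carrier M" "f u \<noteq> \<zero>\<^bsub>N\<^esub>"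
  shows "hopf_module_iso K H A M N"
proof -
  have hM: "hopf_module K H A M" and hN: "hopf_module K H A N"
    using M N by (simp_all add: simple_hopf_module_def)
  note mM = hopf_module_module[OF hM] and mN = hopf_module_module[OF hN]
  interpret Mm: module K M by (rule mM)
  interpret Nm: module K N by (rule mN)
  interpret M: hopf_module K H A M by (rule hM)
  interpret N: hopf_module K H A N by (rule hN)
  have lin: "f \<in> linear_maps K M N"
    and fd: "\<And>m \<phi>. \<lbrakk>m \<in> carrier M; \<phi> \<in> dual K H\<rbrakk> \<Longrightarrow> dual_act K N (f m) \<phi> = f (dual_act K M m \<phi>)"
    and fa: "\<And>m a. \<lbrakk>m \<in> carrier M; a \<in> carrier A\<rbrakk> \<Longrightarrow> f (act M m a) = act N (f m) a"
    using f unfolding hopf_module_hom_iff[OF hM hN] by blast+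
  note fc = lin_closed[OF lin]
  note dM = left_comodule.dual_act_closed[OF hopf_module_comodule[OF hM]]
  note z = lin_zero[OF mM mN lin]
  let ?ker = "{m \<in> carrier M. f m = \<zero>\<^bsub>N\<^esub>}"
  have act0: "act N \<zero>\<^bsub>N\<^esub> a = \<zero>\<^bsub>N\<^esub>" if a: "a \<in> carrier A" for a
    using N.act_smult_left[OF _ Nm.zero_closed a, of "\<zero>\<^bsub>K\<^esub>"] N.act_closed[OF Nm.zero_closed a] by simp
  have "hopf_submodule K H A M ?ker"
  proof (rule hopf_submoduleI[OF hM kernel_submodule[OF mM mN lin]])
    fix n \<phi> assume n: "n \<in> ?ker" and \<phi>: "\<phi> \<in> dual K H"
    then show "dual_act K M n \<phi> \<in> ?ker"
      using fd[of n \<phi>] dM[OF \<phi>] left_comodule.dual_act_zero[OF hopf_module_comodule[OF hN] \<phi>] by simp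
  next
    fix n a assume "n \<in> ?ker" and a: "a \<in> carrier A"
    then show "act M n a \<in> ?ker" using fa[of n a] M.act_closed[of n a] act0[OF a] by simp
  qed
  then have "?ker = {\<zero>\<^bsub>M\<^esub>} \<or> ?ker = carrier M" using M unfolding simple_hopf_module_def by blast
  moreover have "u \<notin> ?ker" using nz by simp
  ultimately have ker: "?ker = {\<zero>\<^bsub>M\<^esub>}" using nz(1) by blast
  have inj: "x = y" if xy: "x \<in> carrier M" "y \<in> carrier M" "f x = f y" for x y
  proof -
    have "f (x \<ominus>\<^bsub>M\<^esub> y) = \<zero>\<^bsub>N\<^esub>"
      using lin_minus[OF mM mN lin xy(1,2)] xy fc by (simp add: a_minus_def Nm.r_neg)
    then have "x \<ominus>\<^bsub>M\<^esub> y \<in> ?ker" using xy by simp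
    then have "x \<ominus>\<^bsub>M\<^esub> y = \<zero>\<^bsub>M\<^esub>" unfolding ker by simp
    then show ?thesis by (rule minus_zero_imp_eq[OF module_abelian_group[OF mM] xy(1,2)])
  qed
  have "hopf_submodule K H A N (f ` carrier M)"
  proof (rule hopf_submoduleI[OF hN])
    show "submodule (f ` carrier M) K N"
    proof (rule submoduleI'[OF mN])
      show "\<zero>\<^bsub>N\<^esub> \<in> f ` carrier M" using z by (metis Mm.zero_closed image_eqI)
      fix a b assume "a \<in> f ` carrier M" "b \<in> f ` carrier M"
      then obtain x y where xy: "x \<in> carrier M" "y \<in> carrier M" "a = f x" "b = f y" by blast
      have "a \<oplus>\<^bsub>N\<^esub> b = f (x \<oplus>\<^bsub>M\<^esub> y)" unfolding xy(3,4) by (rule lin_add[OF lin xy(1,2), symmetric])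
      then show "a \<oplus>\<^bsub>N\<^esub> b \<in> f ` carrier M" using xy by simp
    next
      fix c a assume c: "c \<in> carrier K" and "a \<in> f ` carrier M"
      then obtain x where x: "x \<in> carrier M" "a = f x" by blast
      have "c \<odot>\<^bsub>N\<^esub> a = f (c \<odot>\<^bsub>M\<^esub> x)" unfolding x(2) by (rule lin_smult[OF lin c x(1), symmetric])
      then show "c \<odot>\<^bsub>N\<^esub> a \<in> f ` carrier M" using x c by simp
    qed (use fc in auto)
  next
    fix n \<phi> assume "n \<in> f ` carrier M" and \<phi>: "\<phi> \<in> dual K H"
    then obtain m where m: "m \<in> carrier M" "n = f m" by blast
    show "dual_act K N n \<phi> \<in> f ` carrier M" unfolding m(2) fd[OF m(1) \<phi>] by (rule imageI[OF dM[OF \<phi> m(1)]])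
  next
    fix n a assume "n \<in> f ` carrier M" and a: "a \<in> carrier A"
    then obtain m where m: "m \<in> carrier M" "n = f m" by blast
    show "act N n a \<in> f ` carrier M" unfolding m(2) fa[OF m(1) a, symmetric] by (rule imageI[OF M.act_closed[OF m(1) a]])
  qed
  moreover have "f u \<in> f ` carrier M" using nz(1) by simp
  ultimately have im: "f ` carrier M = carrier N" using N nz(2) unfolding simple_hopf_module_def by blast
  define g where "g = inv_into (carrier M) f"
  have gc: "g n \<in> carrier M" and fg: "f (g n) = n" if "n \<in> carrier N" for n
    using that inv_into_into[of n f "carrier M"] f_inv_into_f[of n f "carrier M"] im by (simp_all add: g_def)
  have gf: "g (f m) = m" if "m \<in> carrier M" for m using inj[OF gc[OF fc[OF that]] that fg[OF fc[OF that]]] .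
  \<comment> \<open>Values of the inverse are identified by applying \<open>f\<close>: each property
    of \<open>g\<close> below is the matching property of \<open>f\<close> at the points
    \<open>g n\<close>.\<close>
  have geq: "g n = m" if "m \<in> carrier M" "f m = n" for m n using gf that by auto
  have "g \<in> hopf_module_hom K H A N M"
    unfolding hopf_module_hom_iff[OF hN hM]
  proof (intro conjI ballI linI)
    fix n assume n: "n \<in> carrier N"
    show "g n \<in> carrier M" by (rule gc[OF n])
    show "g (n \<oplus>\<^bsub>N\<^esub> n') = g n \<oplus>\<^bsub>M\<^esub> g n'" if "n' \<in> carrier N" for n'
      by (rule geq) (use n that gc fg lin_add[OF lin] in simp_all)
    show "g (c \<odot>\<^bsub>N\<^esub> n) = c \<odot>\<^bsub>M\<^esub> g n" if "c \<in> carrier K" for c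
      by (rule geq) (use n that gc fg lin_smult[OF lin] in simp_all)
    show "dual_act K M (g n) \<phi> = g (dual_act K N n \<phi>)" if "\<phi> \<in> dual K H" for \<phi>
      by (rule geq[symmetric]) (use n that gc fg fd[of "g n" \<phi>] dM in simp_all)
    show "g (act N n a) = act M (g n) a" if "a \<in> carrier A" for a
      by (rule geq) (use n that gc fg fa[of "g n" a] M.act_closed in simp_all)
  qed
  then show ?thesis unfolding hopf_module_iso_def using f gf fg by blast
qed

section \<open>The classification\<close>

text \<open>Every subobject of the twist is an H-stable right ideal of \<open>A\<close>: the twisted
  action of the functional h \<mapsto> f(s h) is the original action of \<open>f\<close>, because s
  (g h) = h.\<close>

lemma (in left_comodule_algebra) twisted_simple:
  assumes simple: "right_H_simple K H A"
    and g: "g \<in> grouplikes K H" and s: "s \<in> carrier H" "s \<otimes>\<^bsub>H\<^esub> g = \<one>\<^bsub>H\<^esub>"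
  shows "simple_hopf_module K H A (twisted K H A g)"
  unfolding simple_hopf_module_def
proof (intro conjI allI impI)
  let ?tw = "twisted K H A g"
  note gH = grouplike_closed[OF g]
  show "hopf_module K H A ?tw" by (rule twisted_hopf_module[OF g])
  show "carrier ?tw \<noteq> {\<zero>\<^bsub>?tw\<^esub>}" using simple by (simp add: right_H_simple_def)
  fix N assume N: "hopf_submodule K H A ?tw N"
  have sub: "submodule N K ?tw" using N by (simp add: hopf_submodule_def subcomodule_def)
  have sA: "submodule N K A"
  proof (rule submoduleI'[OF modA])
    show "N \<subseteq> carrier A" using submodule_subset[OF sub] by simp
    show "\<zero>\<^bsub>A\<^esub> \<in> N" using submodule_zero[OF sub] by simp
    show "a \<oplus>\<^bsub>A\<^esub> b \<in> N" if "a \<in> N" "b \<in> N" for a b using submodule_add[OF sub that] by simp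
    show "c \<odot>\<^bsub>A\<^esub> a \<in> N" if "c \<in> carrier K" "a \<in> N" for c a using submodule_smult[OF sub that] by simp
  qed
  have st: "\<forall>n\<in>N. \<forall>f\<in>dual K H. dual_act K ?tw n f \<in> N"
    using N left_comodule.subcomodule_iff[OF twisted_left_comodule[OF g] sub] by (simp add: hopf_submodule_def)
  have "subcomodule K H A N"
    unfolding subcomodule_iff[OF sA]
  proof (intro ballI)
    fix n f assume n: "n \<in> N" and f: "f \<in> dual K H"
    have nA: "n \<in> carrier A" using n submodule_subset[OF sA] by blast
    note fs = translate_dual[OF s(1) f]
    have "s \<otimes>\<^bsub>H\<^esub> (g \<otimes>\<^bsub>H\<^esub> h) = h" if "h \<in> carrier H" for h
      using H.A.m_assoc[OF s(1) gH that] s(2) that by simp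
    then have "dual_act K A n (\<lambda>h. f (s \<otimes>\<^bsub>H\<^esub> (g \<otimes>\<^bsub>H\<^esub> h))) = dual_act K A n f"
      by (intro dual_act_cong[OF translate_dual[OF gH fs] f _ nA]) simp
    then show "dual_act K A n f \<in> N" using bspec[OF bspec[OF st n] fs] twisted_dual_act[OF gH nA fs] by simp
  qed
  moreover have "right_ideal A N"
    unfolding right_ideal_def
  proof (intro conjI ballI)
    show "additive_subgroup N A" by (rule additive_subgroup.intro) (rule submodule.axioms(1)[OF sA])
    show "x \<otimes>\<^bsub>A\<^esub> a \<in> N" if "x \<in> N" "a \<in> carrier A" for x a
      using N that by (simp add: hopf_submodule_def)
  qed
  ultimately show "N = {\<zero>\<^bsub>?tw\<^esub>} \<or> N = carrier ?tw" using simple by (simp add: right_H_simple_def)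
qed

lemma twisted_iso_iff:
  assumes M: "simple_hopf_module K H A M" and A: "right_H_simple K H A"
    and g: "g \<in> grouplikes K H" and s: "s \<in> carrier H" "s \<otimes>\<^bsub>H\<^esub> g = \<one>\<^bsub>H\<^esub>"
  shows "hopf_module_iso K H A (twisted K H A g) M \<longleftrightarrow>
    (\<exists>m\<in>carrier M. m \<noteq> \<zero>\<^bsub>M\<^esub> \<and> coact M m = pure_tensor K H M g m)"
proof -
  have hM: "hopf_module K H A M" using M by (simp add: simple_hopf_module_def)
  note mM = hopf_module_module[OF hM]
  interpret Mm: module K M by (rule mM)
  interpret A: left_comodule_algebra K H A by (rule hopf_module.axioms(1)[OF hM])
  interpret M: hopf_module K H A M by (rule hM)
  let ?tw = "twisted K H A g"
  note gH = grouplike_closed[OF g]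
  note htw = A.twisted_hopf_module[OF g] and stw = A.twisted_simple[OF A g s]
  have one: "\<one>\<^bsub>A\<^esub> \<in> carrier A" by simp
  show ?thesis
  proof
    assume "hopf_module_iso K H A ?tw M"
    then obtain f f' where f: "f \<in> hopf_module_hom K H A ?tw M" "f' \<in> hopf_module_hom K H A M ?tw"
      "\<forall>a\<in>carrier A. f' (f a) = a"
      unfolding hopf_module_iso_def by auto
    have lin: "f \<in> linear_maps K A M" "f' \<in> linear_maps K M A" using f by (simp_all add: hopf_module_hom_def)
    let ?m = "f \<one>\<^bsub>A\<^esub>"
    have m: "?m \<in> carrier M" by (rule lin_closed[OF lin(1) one])
    have "?m \<noteq> \<zero>\<^bsub>M\<^esub>"
    proof
      assume "?m = \<zero>\<^bsub>M\<^esub>"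
      \<comment> \<open>Applying the inverse morphism to the image of 1 would give 1 = 0 in
        \<open>A\<close>, whereas a right H-simple algebra is nonzero.\<close>
      then have "\<one>\<^bsub>A\<^esub> = \<zero>\<^bsub>A\<^esub>" using f(3) one lin_zero[OF mM A.modA lin(2)] by metis
      then have "carrier A = {\<zero>\<^bsub>A\<^esub>}" using A.A.one_zeroD by blast
      then show False using A by (simp add: right_H_simple_def)
    qed
    moreover have "coact M ?m = pure_tensor K H M g ?m"
    proof -
      have "coact M ?m = tensor_map K H M (\<lambda>h. h) f (coact ?tw \<one>\<^bsub>A\<^esub>)"
        using f(1) one by (simp add: hopf_module_hom_def)
      also have "coact ?tw \<one>\<^bsub>A\<^esub> = pure_tensor K H A g \<one>\<^bsub>A\<^esub>"
        using A.translate_pure[OF gH _ one, of "\<one>\<^bsub>H\<^esub>"] gH by (simp add: A.coact_one)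
      also have "tensor_map K H M (\<lambda>h. h) f \<dots> = pure_tensor K H M g ?m"
        by (rule tensor_map_pure[OF A.modC A.modA A.modC mM lin_id lin(1) gH one])
      finally show ?thesis .
    qed
    ultimately show "\<exists>m\<in>carrier M. m \<noteq> \<zero>\<^bsub>M\<^esub> \<and> coact M m = pure_tensor K H M g m" using m by blast
  next
    assume "\<exists>m\<in>carrier M. m \<noteq> \<zero>\<^bsub>M\<^esub> \<and> coact M m = pure_tensor K H M g m"
    then obtain m where m: "m \<in> carrier M" "m \<noteq> \<zero>\<^bsub>M\<^esub>" "coact M m = pure_tensor K H M g m" by blast
    have ab: "act M \<in> bilinear_maps K M A M"
      by (intro bilinI linI)
        (simp_all add: M.act_closed M.act_add_left M.act_add_right M.act_smult_left M.act_smult_right)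
    note am = bilin_right[OF ab m(1)]
    note lg = A.left_mult_linear[OF gH]
    have "act M m \<in> hopf_module_hom K H A ?tw M"
      unfolding hopf_module_hom_def
    proof (intro CollectI conjI ballI)
      show "act M m \<in> linear_maps K ?tw M" using am by simp
      fix a assume "a \<in> carrier ?tw"
      then have a: "a \<in> carrier A" by simp
      note ra = A.coact_closed[OF a]
      \<comment> \<open>As \<rho>(m) = g \<otimes> m, compatibility gives \<rho>(m a) = g a_(-1)
        \<otimes> m a_(0), which is the twisted coaction of \<open>a\<close> carried along a
        \<mapsto> m a.\<close>
      have "coact M (act M m a) = tensor_map K H M (monoid.mult H g) (act M m) (coact A a)"
        unfolding M.coact_act[OF m(1) a] m(3)
        by (rule tensor_pairing_pure_left[OF A.modC A.modC mM A.modA A.modC mM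
              mult_bilinear[OF A.unital_H] ab gH m(1) ra])
      also have "\<dots> = tensor_map K H M (\<lambda>h. h) (act M m) (coact ?tw a)"
        unfolding twisted_simps(6)
        by (rule tensor_map_comp[OF A.modC A.modA A.modC A.modA A.modC mM lg lin_id lin_id am ra, symmetric])
      finally show "coact M (act M m a) = tensor_map K H M (\<lambda>h. h) (act M m) (coact ?tw a)" .
      fix b assume "b \<in> carrier A"
      then show "act M m (act ?tw a b) = act M (act M m a) b" using M.act_mult[OF m(1) a] by simp
    qed
    then show "hopf_module_iso K H A ?tw M"
      by (rule simple_hopf_module_hom_iso[OF stw M, where u="\<one>\<^bsub>A\<^esub>"]) (use one M.act_one[OF m(1)] m(2) in simp_all)
  qed
qed


text \<open>One direction translates by \<open>s\<close> and uses s h = 1, the other translates by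
  \<open>h\<close> and uses h s = 1.\<close>

lemma (in left_comodule_algebra) twisted_coact_iff:
  assumes "g \<in> carrier H" "h \<in> carrier H" "s \<in> carrier H" "s \<otimes>\<^bsub>H\<^esub> h = \<one>\<^bsub>H\<^esub>" "h \<otimes>\<^bsub>H\<^esub> s = \<one>\<^bsub>H\<^esub>" "a \<in> carrier A"
  shows "coact (twisted K H A h) a = pure_tensor K H A g a \<longleftrightarrow> coact A a = pure_tensor K H A (s \<otimes>\<^bsub>H\<^esub> g) a"
proof
  note lh = left_mult_linear[OF assms(2)] and ls = left_mult_linear[OF assms(3)]
  have sh: "s \<otimes>\<^bsub>H\<^esub> (h \<otimes>\<^bsub>H\<^esub> x) = x" if "x \<in> carrier H" for x
    using H.A.m_assoc[OF assms(3,2) that] assms(4) that by simp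
  assume eq: "coact (twisted K H A h) a = pure_tensor K H A g a"
  have "coact A a = tensor_map K H A (\<lambda>x. s \<otimes>\<^bsub>H\<^esub> (h \<otimes>\<^bsub>H\<^esub> x)) (\<lambda>x. x) (coact A a)"
    by (rule tensor_map_id[OF modC modA lin_comp[OF lh ls] lin_id sh refl coact_closed[OF assms(6)], symmetric])
  also have "\<dots> = tensor_map K H A (monoid.mult H s) (\<lambda>x. x) (coact (twisted K H A h) a)"
    unfolding twisted_simps(6)
    by (rule tensor_map_comp[OF modC modA modC modA modC modA lh lin_id ls lin_id coact_closed[OF assms(6)], symmetric])
  also have "\<dots> = pure_tensor K H A (s \<otimes>\<^bsub>H\<^esub> g) a"
    unfolding eq by (rule translate_pure[OF assms(3,1,6)])
  finally show "coact A a = pure_tensor K H A (s \<otimes>\<^bsub>H\<^esub> g) a" .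
next
  assume eq: "coact A a = pure_tensor K H A (s \<otimes>\<^bsub>H\<^esub> g) a"
  have "s \<otimes>\<^bsub>H\<^esub> g \<in> carrier H" using assms by simp
  then show "coact (twisted K H A h) a = pure_tensor K H A g a"
    unfolding twisted_simps(6) eq translate_pure[OF assms(2) \<open>s \<otimes>\<^bsub>H\<^esub> g \<in> carrier H\<close> assms(6)]
    using H.A.m_assoc[OF assms(2,3,1)] assms(1,5) by simp
qed

text \<open>Zero lies in each component. A component is therefore never empty, and it differs from
  {0} exactly if it has a nonzero element.\<close>

lemma (in left_comodule_algebra) grouplike_support_iff:
  "g \<in> grouplike_support K H A \<longleftrightarrow> g \<in> grouplikes K H \<and>
    (\<exists>a\<in>carrier A. a \<noteq> \<zero>\<^bsub>A\<^esub> \<and> coact A a = pure_tensor K H A g a)"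
proof -
  have "\<zero>\<^bsub>A\<^esub> \<in> grouplike_component K H A g" if "g \<in> grouplikes K H"
  proof -
    note gH = grouplike_closed[OF that]
    have "coact A \<zero>\<^bsub>A\<^esub> = pure_tensor K H A g \<zero>\<^bsub>A\<^esub>"
      using lin_zero[OF modA tensor_module[OF modC modA] coact_linear]
        lin_zero[OF modA tensor_module[OF modC modA] bilin_right[OF pure_bilinear[OF modC modA] gH]]
      by simp
    then show ?thesis by (simp add: grouplike_component_def)
  qed
  then show ?thesis unfolding grouplike_support_def grouplike_component_def by blast
qed

lemma left_coset_eq_iff:
  assumes "group G" "subgroup F G" "g \<in> carrier G" "h \<in> carrier G"
  shows "g <#\<^bsub>G\<^esub> F = h <#\<^bsub>G\<^esub> F \<longleftrightarrow> inv\<^bsub>G\<^esub> h \<otimes>\<^bsub>G\<^esub> g \<in> F"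
proof -
  interpret group G by fact
  note Fc = subgroup.mem_carrier[OF assms(2)]
  show ?thesis
  proof
    assume eq: "g <#\<^bsub>G\<^esub> F = h <#\<^bsub>G\<^esub> F"
    have "g \<in> h <#\<^bsub>G\<^esub> F" using lcos_self[OF assms(3,2)] eq by simp
    then obtain f where f: "f \<in> F" "g = h \<otimes>\<^bsub>G\<^esub> f" by (auto simp: l_coset_def)
    then show "inv\<^bsub>G\<^esub> h \<otimes>\<^bsub>G\<^esub> g \<in> F" using Fc[OF f(1)] assms(4) by (simp add: m_assoc[symmetric])
  next
    assume f: "inv\<^bsub>G\<^esub> h \<otimes>\<^bsub>G\<^esub> g \<in> F"
    have "g = h \<otimes>\<^bsub>G\<^esub> (inv\<^bsub>G\<^esub> h \<otimes>\<^bsub>G\<^esub> g)" using assms(3,4) by (simp add: m_assoc[symmetric])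
    then have "g \<in> h <#\<^bsub>G\<^esub> F" using f by (auto simp: l_coset_def)
    then show "g <#\<^bsub>G\<^esub> F = h <#\<^bsub>G\<^esub> F" using l_repr_independence[OF _ assms(4,2)] by simp
  qed
qed

text \<open>The element \<open>g\<close> is found in the target, from a grouplike vector of
  \<open>M\<close>. The type of \<open>M\<close> is independent of that of \<open>A\<close>, so
  objects outside the universe of the twists are covered too.\<close>

lemma simple_hopf_module_twisted:
  assumes "pointed_hopf_algebra K H" and A: "right_H_simple K H A" and M: "simple_hopf_module K H A M"
  shows "\<exists>g\<in>grouplikes K H. hopf_module_iso K H A (twisted K H A g) M"
proof -
  interpret H: pointed_hopf_algebra K H by fact
  have hM: "hopf_module K H A M" using M by (simp add: simple_hopf_module_def)
  interpret M: left_comodule K H M by (rule hopf_module_comodule[OF hM])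
  have "carrier M \<noteq> {\<zero>\<^bsub>M\<^esub>}" using M by (simp add: simple_hopf_module_def)
  then obtain g m where g: "g \<in> grouplikes K H"
    and m: "m \<in> carrier M" "m \<noteq> \<zero>\<^bsub>M\<^esub>" "coact M m = pure_tensor K H M g m"
    using M.grouplike_vector_exists[OF H.pointed] by blast
  then show ?thesis using twisted_iso_iff[OF M A g H.antipode_grouplike(1,2)[OF g]] by blast
qed

theorem theorem4p12:
  fixes K :: "'k ring"
    and H :: "('k, 'h) hopf_algebra"
    and A :: "('k, 'h, 'a) comodule"
  assumes "pointed_hopf_algebra K H"
    and "left_comodule_algebra K H A"
    and "right_H_simple K H A"
  shows "(\<forall>g\<in>carrier (grouplike_group K H). \<forall>h\<in>carrier (grouplike_group K H).
            g <#\<^bsub>grouplike_group K H\<^esub> grouplike_support K H A =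
            h <#\<^bsub>grouplike_group K H\<^esub> grouplike_support K H A \<longrightarrow>
            iso_class K H A (twisted K H A g) = iso_class K H A (twisted K H A h)) \<and>
         bij_betw (\<lambda>C. the_elem ((\<lambda>g. iso_class K H A (twisted K H A g)) ` C))
           (lcosets\<^bsub>grouplike_group K H\<^esub> (grouplike_support K H A))
           (Simp K H A) \<and>
         (\<forall>M :: ('k, 'h, 'a, 'm) hopf_module. simple_hopf_module K H A M \<longrightarrow>
            (\<exists>g\<in>carrier (grouplike_group K H). hopf_module_iso K H A (twisted K H A g) M))"
proof -
  interpret H: pointed_hopf_algebra K H by (rule assms(1))
  interpret A: left_comodule_algebra K H A by (rule assms(2))
  note ex = simple_hopf_module_twisted[OF assms(1,3)]
  let ?G = "grouplike_group K H" and ?F = "grouplike_support K H A" and ?tw = "twisted K H A"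
    and ?K = "\<lambda>g. g <#\<^bsub>grouplike_group K H\<^esub> grouplike_support K H A"
    and ?I = "hopf_module_iso K H A"
  interpret G: group ?G by (rule H.grouplike_group_is_group)
  have ops: "\<one>\<^bsub>?G\<^esub> = \<one>\<^bsub>H\<^esub>" "\<And>x y. x \<otimes>\<^bsub>?G\<^esub> y = x \<otimes>\<^bsub>H\<^esub> y"
    by (simp_all add: grouplike_group_def)
  note GH = grouplike_closed[of _ K H]
  have inv: "inv\<^bsub>?G\<^esub> g \<in> carrier H" "inv\<^bsub>?G\<^esub> g \<otimes>\<^bsub>H\<^esub> g = \<one>\<^bsub>H\<^esub>" "g \<otimes>\<^bsub>H\<^esub> inv\<^bsub>?G\<^esub> g = \<one>\<^bsub>H\<^esub>"
    if g: "g \<in> carrier ?G" for g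
    using GH[OF G.inv_closed[OF g]] G.l_inv[OF g] G.r_inv[OF g] by (simp_all add: ops)
  have hm: "hopf_module K H A (?tw g)" if "g \<in> carrier ?G" for g by (rule A.twisted_hopf_module[OF that])
  have sm: "simple_hopf_module K H A (?tw g)" if "g \<in> carrier ?G" for g
    by (rule A.twisted_simple[OF assms(3) that inv(1,2)[OF that]])
  \<comment> \<open>The criterion for a twist to be isomorphic to a simple object, with the twist by
    \<open>h\<close> as that object. Moving \<open>h\<close> to the other side of h a_(-1) \<otimes>
    a_(0) = g \<otimes> a multiplies \<open>g\<close> from the left, which is why left cosets
    appear.\<close>
  have iso: "?I (?tw g) (?tw h) \<longleftrightarrow> inv\<^bsub>?G\<^esub> h \<otimes>\<^bsub>?G\<^esub> g \<in> ?F"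
    if g: "g \<in> carrier ?G" and h: "h \<in> carrier ?G" for g h
  proof -
    have "?I (?tw g) (?tw h) \<longleftrightarrow>
        (\<exists>a\<in>carrier A. a \<noteq> \<zero>\<^bsub>A\<^esub> \<and> coact (?tw h) a = pure_tensor K H A g a)"
      using twisted_iso_iff[OF sm[OF h] assms(3) g inv(1,2)[OF g]] by simp
    also have "\<dots> \<longleftrightarrow> (\<exists>a\<in>carrier A. a \<noteq> \<zero>\<^bsub>A\<^esub> \<and> coact A a = pure_tensor K H A (inv\<^bsub>?G\<^esub> h \<otimes>\<^bsub>H\<^esub> g) a)"
      using A.twisted_coact_iff[OF GH[OF g] GH[OF h] inv[OF h]] by blast
    also have "\<dots> \<longleftrightarrow> inv\<^bsub>?G\<^esub> h \<otimes>\<^bsub>?G\<^esub> g \<in> ?F"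
      using g h by (simp add: A.grouplike_support_iff ops(2)[symmetric])
    finally show ?thesis .
  qed
  \<comment> \<open>F(A) consists of the \<open>g\<close> whose twist is isomorphic to the twist by
    1. That it is a subgroup then follows from isomorphism being an equivalence relation.\<close>
  have isoF: "?I (?tw g) (?tw \<one>\<^bsub>?G\<^esub>) \<longleftrightarrow> g \<in> ?F" if "g \<in> carrier ?G" for g
    using iso[OF that G.one_closed] that by simp
  have FG: "?F \<subseteq> carrier ?G" by (auto simp: grouplike_support_def)
  have F: "subgroup ?F ?G"
  proof (rule G.subgroupI[OF FG])
    show "?F \<noteq> {}" using isoF[OF G.one_closed] hopf_module_iso_refl[OF hm[OF G.one_closed]] by blast
    fix g assume gF: "g \<in> ?F"
    then have g: "g \<in> carrier ?G" using FG by blast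
    have e: "?I (?tw g) (?tw \<one>\<^bsub>?G\<^esub>)" using isoF[OF g] gF by simp
    show "inv\<^bsub>?G\<^esub> g \<in> ?F" using iso[OF G.one_closed g] hopf_module_iso_sym[OF e] g by simp
    fix h assume hF: "h \<in> ?F"
    then have h: "h \<in> carrier ?G" using FG by blast
    \<comment> \<open>Since \<open>h\<close> lies in F(A), the twists by g h and by \<open>g\<close>
      are isomorphic, and the latter is isomorphic to the twist by 1.\<close>
    have "inv\<^bsub>?G\<^esub> g \<otimes>\<^bsub>?G\<^esub> (g \<otimes>\<^bsub>?G\<^esub> h) = h" using g h by (simp add: G.m_assoc[symmetric])
    then have "?I (?tw (g \<otimes>\<^bsub>?G\<^esub> h)) (?tw g)" using iso[OF G.m_closed[OF g h] g] hF by simp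
    then have "?I (?tw (g \<otimes>\<^bsub>?G\<^esub> h)) (?tw \<one>\<^bsub>?G\<^esub>)"
      using hopf_module_iso_trans[OF hm[OF G.m_closed[OF g h]] hm[OF g] hm[OF G.one_closed] _ e] by blast
    then show "g \<otimes>\<^bsub>?G\<^esub> h \<in> ?F" using isoF[OF G.m_closed[OF g h]] by simp
  qed
  let ?c = "\<lambda>g. iso_class K H A (?tw g)"
  \<comment> \<open>Read from right to left this is well-definedness on cosets, from left to right
    injectivity.\<close>
  have cl: "?c g = ?c h \<longleftrightarrow> ?K g = ?K h" if "g \<in> carrier ?G" "h \<in> carrier ?G" for g h
    using iso_class_eq_iff[OF hm[OF that(1)] hm[OF that(2)]] iso[OF that]
      left_coset_eq_iff[OF G.is_group F that] by simp
  let ?f = "\<lambda>C. the_elem (?c ` C)"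
  \<comment> \<open>All members of a coset give the same class, so the image is a singleton and
    \<open>the_elem\<close> returns the class of any representative.\<close>
  have f: "?f (?K g) = ?c g" if g: "g \<in> carrier ?G" for g
  proof -
    have "?c h = ?c g" if "h \<in> ?K g" for h
    proof -
      have h: "h \<in> carrier ?G" using that g FG by (auto simp: l_coset_def)
      show ?thesis using G.l_repr_independence[OF that g F] cl[OF h g] by simp
    qed
    moreover have "g \<in> ?K g" by (rule G.lcos_self[OF g F])
    ultimately have "?c ` ?K g = {?c g}" by blast
    then show ?thesis by simp
  qed
  have lc: "lcosets\<^bsub>?G\<^esub> ?F = ?K ` carrier ?G" by (auto simp: LCOSETS_def)
  have "bij_betw ?f (lcosets\<^bsub>?G\<^esub> ?F) (Simp K H A)"
    unfolding bij_betw_def lc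
  proof
    show "inj_on ?f (?K ` carrier ?G)"
      by (rule inj_onI) (use f cl in auto)
    have "?f ` ?K ` carrier ?G = ?c ` carrier ?G" using f by (simp add: image_image)
    also have "\<dots> = Simp K H A"
    proof
      show "?c ` carrier ?G \<subseteq> Simp K H A" using sm unfolding Simp_def by blast
      show "Simp K H A \<subseteq> ?c ` carrier ?G"
      proof
        \<comment> \<open>The bijection takes place in the universe \<open>'a\<close>, where the
          twists live. The last conjunct, for an arbitrary type \<open>'m\<close>, comes from the
          same fact \<open>ex\<close>.\<close>
        fix C assume "C \<in> (Simp K H A :: ('k, 'h, 'a, 'a) hopf_module set set)"
        then obtain M where M: "C = iso_class K H A M" "simple_hopf_module K H A M" unfolding Simp_def by blast
        then obtain g where g: "g \<in> carrier ?G" "?I (?tw g) M" using ex by blast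
        have "hopf_module K H A M" using M(2) by (simp add: simple_hopf_module_def)
        then have "?c g = C" using iso_class_eq_iff[OF hm[OF g(1)]] g(2) M(1) by blast
        then show "C \<in> ?c ` carrier ?G" using g(1) by blast
      qed
    qed
    finally show "?f ` ?K ` carrier ?G = Simp K H A" .
  qed
  then show ?thesis using cl ex by blast
qed

end
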